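(* Let $D$ be one of the following (non-rectangular) planar domains: \begin{itemize} \item (elliptic) $\{(x,y)\in\mathbb{R}^2:(x/a)^2+(y/b)^2<1\}$ with $a,b>0$, $a\neq b$; \item (parabolic) $\{(x,y)\in\mathbb{R}^2:y>cx^2\}$ with $c>0$; \item (hyperbolic) $\{(x,y)\in\mathbb{R}^2:\frac{x^2}{a^2}-\frac{y^2}{b^2}>1,\ x>a\}$ with $a,b>0$, $a>(1+\sqrt{2})b$; \item (wedge) $\{re^{i\theta}:0<r<\infty,\ -\frac{\alpha}{2}<\theta<\frac{\alpha}{2}\}$ with $0<\alpha<\frac{\pi}{4}$ (where $\mathbb{C}$ is identified with $\mathbb{R}^2$); \item (equilateral triangle) $\{(x,y)\in\mathbb{R}^2:-\frac{b}{\sqrt3}<x<\frac{b}{\sqrt3},\ 0<y<b-\sqrt{3}|x|\}$ with $b>0$. \end{itemize} Then the values of the first two exit time moments at a point of $D$ determine that point up to symmetry of $D$: if $p,q\in D$ satisfy $\mathbb{E}^{p}[\tau_D]=\mathbb{E}^{q}[\tau_D]$ and $\mathbb{E}^{p}[\tau_D^2]=\mathbb{E}^{q}[\tau_D^2]$, then $q=g(p)$ for some symmetry $g$ of $D$. Equivalently, the mean exit time and the variance of the exit time determine the point up to symmetry: if $\mathbb{E}^{p}[\tau_D]=\mathbb{E}^{q}[\tau_D]$ and $\mathrm{Var}^{p}[\tau_D]=\mathrm{Var}^{q}[\tau_D]$, then $q=g(p)$ for some symmetry $g$ of $D$. If $\mathcal{R}=\{(x,y)\in\mathbb{R}^2:0<x<a,\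 0<y<b\}$ with $a,b>0$, $a\neq b$, then the full sequence of exit time moments at a point of $\mathcal{R}$ determines that point up to symmetry of $\mathcal{R}$: if $p,q\in\mathcal{R}$ satisfy $\mathbb{E}^{p}[\tau_{\mathcal{R}}^k]=\mathbb{E}^{q}[\tau_{\mathcal{R}}^k]$ for all $k\geq1$, then $q=g(p)$ for some symmetry $g$ of $\mathcal{R}$.
   Context: For a planar domain $D\subseteq\mathbb{R}^2$ and $p\in D$, let $X_t$ be planar Brownian motion with continuous paths started at $p$, normalized so that its generator is $\Delta$ (i.e. $X_t=p+\sqrt{2}B_t$ with $B_t$ standard planar Brownian motion). Its first exit time from $D$ is $\tau_D=\inf\{t\geq0:X_t\notin D\}$; $\mathbb{E}^{p}[\tau_D^k]$ denotes the $k$th moment of $\tau_D$ for Brownian motion started at $p$, and $\mathrm{Var}^{p}[\tau_D]=\mathbb{E}^{p}[\tau_D^2]-(\mathbb{E}^{p}[\tau_D])^2$. A symmetry of $D$ is a Euclidean isometry $g$ of $\mathbb{R}^2$ with $g(D)=D$. *)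

theory Defs
  imports "HOL-Probability.Probability"
begin

text \<open>Standard planar Brownian motion started at the origin. The increment over \<open>[s, t]\<close> is
  centred Gaussian with covariance matrix \<open>(t - s) I\<close>. Only times \<open>t \<ge> 0\<close> are
  constrained.\<close>

locale standard_planar_brownian_motion = prob_space M
  for M :: "'w measure" +
  fixes B :: "real \<Rightarrow> 'w \<Rightarrow> real \<times> real"
  assumes measurable_time: "\<And>t. 0 \<le> t \<Longrightarrow> random_variable borel (B t)"
    and start: "\<And>\<omega>. \<omega> \<in> space M \<Longrightarrow> B 0 \<omega> = 0"
    and continuous_paths: "\<And>\<omega>. \<omega> \<in> space M \<Longrightarrow> continuous_on {0..} (\<lambda>t. B t \<omega>)"
    and gaussian_increments: "\<And>s t. 0 \<le> s \<Longrightarrow> s < t \<Longrightarrow>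
      distributed M lborel (\<lambda>\<omega>. B t \<omega> - B s \<omega>)
        (\<lambda>(x, y). ennreal (normal_density 0 (sqrt (t - s)) x * normal_density 0 (sqrt (t - s)) y))"
    and independent_increments: "\<And>(n::nat) (\<tau> :: nat \<Rightarrow> real). 0 \<le> \<tau> 0 \<Longrightarrow> strict_mono \<tau> \<Longrightarrow>
      indep_vars (\<lambda>_. borel) (\<lambda>i \<omega>. B (\<tau> (Suc i)) \<omega> - B (\<tau> i) \<omega>) {..<n}"

text \<open>The factor \<open>sqrt 2\<close> makes the generator the Laplacian rather than half of it.\<close>

definition brownian_from :: "(real \<Rightarrow> 'w \<Rightarrow> real \<times> real) \<Rightarrow> real \<times> real \<Rightarrow> real \<Rightarrow> 'w \<Rightarrow> real \<times> real" where
  "brownian_from B p t \<omega> = p + sqrt 2 *\<^sub>R B t \<omega>"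

text \<open>The value is \<open>\<infinity>\<close> on paths that never leave \<open>D\<close>.\<close>

definition exit_time :: "(real \<times> real) set \<Rightarrow> (real \<Rightarrow> 'w \<Rightarrow> real \<times> real) \<Rightarrow> 'w \<Rightarrow> ennreal" where
  "exit_time D X \<omega> = Inf {ennreal t | t. 0 \<le> t \<and> X t \<omega> \<notin> D}"

definition exit_moment ::
  "'w measure \<Rightarrow> (real \<Rightarrow> 'w \<Rightarrow> real \<times> real) \<Rightarrow> (real \<times> real) set \<Rightarrow> nat \<Rightarrow> real \<times> real \<Rightarrow> ennreal" where
  "exit_moment M B D k p = (\<integral>\<^sup>+ \<omega>. exit_time D (brownian_from B p) \<omega> ^ k \<partial>M)"

text \<open>Subtraction is taken in \<^typ>\<open>ereal\<close>, since it is truncated at \<open>0\<close> in \<^typ>\<open>ennreal\<close>.\<close>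

definition exit_variance ::
  "'w measure \<Rightarrow> (real \<Rightarrow> 'w \<Rightarrow> real \<times> real) \<Rightarrow> (real \<times> real) set \<Rightarrow> real \<times> real \<Rightarrow> ereal" where
  "exit_variance M B D p = enn2ereal (exit_moment M B D 2 p) - (enn2ereal (exit_moment M B D 1 p))\<^sup>2"

definition symmetry_of :: "(real \<times> real) set \<Rightarrow> (real \<times> real \<Rightarrow> real \<times> real) \<Rightarrow> bool" where
  "symmetry_of D g \<longleftrightarrow> (\<forall>u v. dist (g u) (g v) = dist u v) \<and> g ` D = D"

definition elliptic_domain :: "real \<Rightarrow> real \<Rightarrow> (real \<times> real) set" where
  "elliptic_domain a b = {(x, y). (x / a)\<^sup>2 + (y / b)\<^sup>2 < 1}"

definition parabolic_domain :: "real \<Rightarrow> (real \<times> real) set" where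
  "parabolic_domain c = {(x, y). y > c * x\<^sup>2}"

definition hyperbolic_domain :: "real \<Rightarrow> real \<Rightarrow> (real \<times> real) set" where
  "hyperbolic_domain a b = {(x, y). x\<^sup>2 / a\<^sup>2 - y\<^sup>2 / b\<^sup>2 > 1 \<and> x > a}"

definition wedge_domain :: "real \<Rightarrow> (real \<times> real) set" where
  "wedge_domain \<alpha> = {(r * cos \<theta>, r * sin \<theta>) | r \<theta>. 0 < r \<and> - \<alpha> / 2 < \<theta> \<and> \<theta> < \<alpha> / 2}"

definition equilateral_triangle :: "real \<Rightarrow> (real \<times> real) set" where
  "equilateral_triangle b =
    {(x, y). - b / sqrt 3 < x \<and> x < b / sqrt 3 \<and> 0 < y \<and> y < b - sqrt 3 * \<bar>x\<bar>}"

definition rectangle :: "real \<Rightarrow> real \<Rightarrow> (real \<times> real) set" where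
  "rectangle a b = {(x, y). 0 < x \<and> x < a \<and> 0 < y \<and> y < b}"

end

(* For each non-rectangular domain D there are explicit polynomials u1, u2, vanishing on the boundary
   and nonnegative inside, with Laplacians -1 and -2 u1. Then t + u1 and t^2 + 2 t u1 + u2 are
   caloric, so optional stopping identifies u1 and u2 with the first two moments of the exit time;
   for unbounded D the passage to the limit rests on an L^4 estimate of the path after a late time.
   That u1 and u2 separate points up to symmetry is then algebra.

   In the rectangle, the eigenfunctions sin (m pi x / a) sin (n pi y / b) and Abel summation of the
   sine series of 1 give the two leading exponentials of P(tau > t) with an exponentially smaller
   remainder. The moments determine their coefficients, which are multiples of sin X sin Y and
   sin 3X sin Y (for a > b), where X = pi x / a and Y = pi y / b. As sin 3X = sin X (3 - 4 sin^2 X),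
   sin X and sin Y are determined. *)
theory Submission imports Defs begin

section \<open>Caloric functions\<close>

text \<open>No stochastic calculus enters: being caloric is expressed by a Gaussian mean value
  property, so the martingale property follows from independence of increments by Fubini. Stopping
  takes place on a time grid that is then refined; the functions involved may be unbounded, so the
  limit is controlled in L^2 by a dominating caloric function.

  For a conic with defining polynomial \<open>w\<close>, the ansatz \<open>u1 = K * w\<close>,
  \<open>u2 = w * q\<close> with \<open>q\<close> quadratic turns the two Poisson equations into a
  linear system for the coefficients of \<open>q\<close>. For the cone
  \<open>x^2 > \<rho> * y^2 + \<kappa>\<close> its determinant is a multiple of
  \<open>\<rho>^2 - 6 * \<rho> + 1\<close>. Positivity of this with \<open>\<rho> > 1\<close> is
  exactly \<open>a > (1 + sqrt 2) * b\<close> for the hyperbola and \<open>\<alpha> < pi / 4\<close>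
  for the wedge. Equal moments fix \<open>w\<close> and \<open>q\<close>; for a centred conic both
  are affine in the squares of the coordinates, and on the ellipse they are independent precisely
  because \<open>a \<noteq> b\<close>.

  In the rectangle with \<open>a > b\<close>, the mode (3, 1) decays strictly more slowly than (1,
  3). In a square the two rates would coincide.\<close>

definition centred_gaussian :: "real \<Rightarrow> real measure" where
  "centred_gaussian h = density lborel (\<lambda>w. ennreal (normal_density 0 (sqrt h) w))"

definition planar_gaussian :: "real \<Rightarrow> (real \<times> real) measure" where
  "planar_gaussian h = centred_gaussian h \<Otimes>\<^sub>M centred_gaussian h"

lemma sets_centred_gaussian [simp, measurable_cong]: "sets (centred_gaussian h) = sets borel"
  by (simp add: centred_gaussian_def)

lemma space_centred_gaussian [simp]: "space (centred_gaussian h) = UNIV"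
  by (simp add: centred_gaussian_def)

lemma sets_planar_gaussian [simp, measurable_cong]: "sets (planar_gaussian h) = sets borel"
  unfolding planar_gaussian_def borel_prod[symmetric]
  by (intro sets_pair_measure_cong) simp_all

lemma prob_space_centred_gaussian: "0 < h \<Longrightarrow> prob_space (centred_gaussian h)"
  unfolding centred_gaussian_def by (rule prob_space_normal_density) simp

text \<open>Matches the product measure, convenient for Fubini, with the joint density that
  \<open>gaussian_increments\<close> prescribes.\<close>

lemma planar_gaussian_eq_density:
  assumes "0 < h"
  shows "planar_gaussian h = density lborel (\<lambda>(x, y).
    ennreal (normal_density 0 (sqrt h) x * normal_density 0 (sqrt h) y))"
proof -
  interpret prob_space "centred_gaussian h" by (rule prob_space_centred_gaussian[OF assms])
  have "sigma_finite_measure (density lborel (\<lambda>w. ennreal (normal_density 0 (sqrt h) w)))"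
    using sigma_finite_measure_axioms by (simp add: centred_gaussian_def)
  then have "planar_gaussian h = density (lborel \<Otimes>\<^sub>M lborel)
      (\<lambda>(x, y). ennreal (normal_density 0 (sqrt h) x) * ennreal (normal_density 0 (sqrt h) y))"
    unfolding planar_gaussian_def centred_gaussian_def
    by (subst pair_measure_density) (auto intro: lborel.sigma_finite_measure_axioms)
  also have "\<dots> = density lborel (\<lambda>(x, y).
      ennreal (normal_density 0 (sqrt h) x * normal_density 0 (sqrt h) y))"
    by (simp add: lborel_prod ennreal_mult')
  finally show ?thesis .
qed

lemma has_bochner_integral_centred_gaussian:
  fixes f :: "real \<Rightarrow> real"
  assumes "f \<in> borel_measurable borel"
    and "has_bochner_integral lborel (\<lambda>w. normal_density 0 (sqrt h) w * f w) x"
  shows "has_bochner_integral (centred_gaussian h) f x"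
  unfolding centred_gaussian_def
  using assms by (intro has_bochner_integral_density) auto

text \<open>With the factor \<open>sqrt 2\<close> the variance is \<open>2 * h\<close>, whence the
  fourth moment \<open>3 * (2 * h)^2\<close>. Order five suffices because no polynomial used below
  exceeds degree five in either variable; that degree occurs for the triangle.\<close>

lemma normal_moments:
  assumes "0 < h"
  shows "has_bochner_integral (centred_gaussian h) (\<lambda>w. 1) (1::real)"
    and "has_bochner_integral (centred_gaussian h) (\<lambda>w. sqrt 2 * w) 0"
    and "has_bochner_integral (centred_gaussian h) (\<lambda>w. (sqrt 2 * w)^2) (2 * h)"
    and "has_bochner_integral (centred_gaussian h) (\<lambda>w. (sqrt 2 * w)^3) 0"
    and "has_bochner_integral (centred_gaussian h) (\<lambda>w. (sqrt 2 * w)^4) (12 * h^2)"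
    and "has_bochner_integral (centred_gaussian h) (\<lambda>w. (sqrt 2 * w)^5) 0"
proof -
  have s: "0 < sqrt h" using assms by simp
  have e: "has_bochner_integral (centred_gaussian h) (\<lambda>w. w^(2*k)) (fact (2*k) / ((2 / h)^k * fact k))" for k
    using normal_moment_even[OF s, of 0 k] assms
    by (intro has_bochner_integral_centred_gaussian) auto
  have o: "has_bochner_integral (centred_gaussian h) (\<lambda>w. w^(2*k+1)) 0" for k
    using normal_moment_odd[OF s, of 0 k]
    by (intro has_bochner_integral_centred_gaussian) auto
  have sq: "sqrt 2 ^ 4 = (4::real)"
    using power_mult[of "sqrt 2" 2 2] by simp
  show "has_bochner_integral (centred_gaussian h) (\<lambda>w. 1) (1::real)"
    using e[of 0] by simp
  show "has_bochner_integral (centred_gaussian h) (\<lambda>w. sqrt 2 * w) 0"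
    using has_bochner_integral_mult_right[of "sqrt 2", OF o[of 0]] by simp
  show "has_bochner_integral (centred_gaussian h) (\<lambda>w. (sqrt 2 * w)^2) (2*h)"
    using has_bochner_integral_mult_right[of "2", OF e[of 1]] assms
    by (simp add: power_mult_distrib fact_numeral)
  show "has_bochner_integral (centred_gaussian h) (\<lambda>w. (sqrt 2 * w)^3) 0"
    using has_bochner_integral_mult_right[of "sqrt 2 ^ 3", OF o[of 1]]
    by (simp add: power_mult_distrib)
  show "has_bochner_integral (centred_gaussian h) (\<lambda>w. (sqrt 2 * w)^4) (12*h^2)"
    using has_bochner_integral_mult_right[of "4", OF e[of 2]] assms
    by (simp add: power_mult_distrib sq fact_numeral power_divide field_simps)
  show "has_bochner_integral (centred_gaussian h) (\<lambda>w. (sqrt 2 * w)^5) 0"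
    using has_bochner_integral_mult_right[of "sqrt 2 ^ 5", OF o[of 2]] 
    by (simp add: power_mult_distrib)
qed

lemma has_bochner_integral_quintic:
  assumes "0 < h"
  shows "has_bochner_integral (centred_gaussian h)
    (\<lambda>w. a0 + a1 * (sqrt 2 * w) + a2 * (sqrt 2 * w)^2 + a3 * (sqrt 2 * w)^3 + a4 * (sqrt 2 * w)^4
      + a5 * (sqrt 2 * w)^5) (a0 + 2 * h * a2 + 12 * h^2 * a4)"
proof -
  note m = normal_moments[OF assms]
  show ?thesis
    using has_bochner_integral_add[OF has_bochner_integral_add[OF has_bochner_integral_add[OF
      has_bochner_integral_add[OF has_bochner_integral_add[OF
        has_bochner_integral_mult_right[of a0, OF m(1)] has_bochner_integral_mult_right[of a1, OF m(2)]]
        has_bochner_integral_mult_right[of a2, OF m(3)]] has_bochner_integral_mult_right[of a3, OF m(4)]]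
        has_bochner_integral_mult_right[of a4, OF m(5)]] has_bochner_integral_mult_right[of a5, OF m(6)]]
    by (simp add: mult_ac)
qed

section \<open>Exponential growth and caloric functions of one space variable\<close>

text \<open>Both constants may depend on the time horizon \<open>T\<close>. The class is closed
  under sums and products, and the square of such a bound is dominated by exponentials that are
  themselves caloric.\<close>

definition exp_growth :: "(real \<Rightarrow> real \<Rightarrow> real) \<Rightarrow> bool" where
  "exp_growth f \<longleftrightarrow> (\<forall>T. \<exists>C c. 0 \<le> C \<and> 0 \<le> c \<and> (\<forall>t\<in>{0..T}. \<forall>x. \<bar>f t x\<bar> \<le> C * exp (c * \<bar>x\<bar>)))"

lemma exp_growthE:
  assumes "exp_growth f"
  obtains C c where "0 \<le> C" "0 \<le> c" "\<And>t x. 0 \<le> t \<Longrightarrow> t \<le> T \<Longrightarrow> \<bar>f t x\<bar> \<le> C * exp (c * \<bar>x\<bar>)"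
  using assms unfolding exp_growth_def by (metis atLeastAtMost_iff)

lemma exp_growthI:
  assumes "\<And>T t x. 0 \<le> t \<Longrightarrow> t \<le> T \<Longrightarrow> \<bar>f t x\<bar> \<le> C T * exp (c * \<bar>x\<bar>)" "0 \<le> c" "\<And>T. 0 \<le> C T"
  shows "exp_growth f"
  unfolding exp_growth_def using assms by (metis atLeastAtMost_iff)

lemma exp_growth_time:
  assumes "continuous_on UNIV g"
  shows "exp_growth (\<lambda>t x. g t)"
  unfolding exp_growth_def
proof
  fix T :: real
  have "bounded (g ` {0..T})"
    by (intro compact_imp_bounded compact_continuous_image continuous_on_subset[OF assms]) auto
  then obtain C where "0 < C" "\<forall>x\<in>g ` {0..T}. \<bar>x\<bar> \<le> C"
    unfolding bounded_pos real_norm_def by auto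
  then show "\<exists>C c. 0 \<le> C \<and> 0 \<le> c \<and> (\<forall>t\<in>{0..T}. \<forall>x. \<bar>g t\<bar> \<le> C * exp (c * \<bar>x\<bar>))"
    by (intro exI[of _ C] exI[of _ 0]) auto
qed

lemma exp_growth_space: "exp_growth (\<lambda>t x. x)"
proof (rule exp_growthI[where C = "\<lambda>_. 1" and c = 1])
  fix x :: real
  show "\<bar>x\<bar> \<le> 1 * exp (1 * \<bar>x\<bar>)" using exp_ge_add_one_self[of "\<bar>x\<bar>"] unfolding mult_1_left by linarith
qed auto

lemma exp_growth_add:
  assumes "exp_growth f" "exp_growth g"
  shows "exp_growth (\<lambda>t x. f t x + g t x)"
  unfolding exp_growth_def
proof
  fix T
  obtain C c where f: "0 \<le> C" "0 \<le> c" "\<And>t x. 0 \<le> t \<Longrightarrow> t \<le> T \<Longrightarrow> \<bar>f t x\<bar> \<le> C * exp (c * \<bar>x\<bar>)"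
    using exp_growthE[OF assms(1)] by blast
  obtain D d where g: "0 \<le> D" "0 \<le> d" "\<And>t x. 0 \<le> t \<Longrightarrow> t \<le> T \<Longrightarrow> \<bar>g t x\<bar> \<le> D * exp (d * \<bar>x\<bar>)"
    using exp_growthE[OF assms(2)] by blast
  have "\<bar>f t x + g t x\<bar> \<le> (C + D) * exp (max c d * \<bar>x\<bar>)" if "t \<in> {0..T}" for t x
  proof -
    have "C * exp (c * \<bar>x\<bar>) \<le> C * exp (max c d * \<bar>x\<bar>)" "D * exp (d * \<bar>x\<bar>) \<le> D * exp (max c d * \<bar>x\<bar>)"
      using f(1) g(1) by (auto intro!: mult_left_mono mult_right_mono)
    then show ?thesis using f(3)[of t x] g(3)[of t x] that
        abs_triangle_ineq[of "f t x" "g t x"] unfolding distrib_right atLeastAtMost_iff by linarith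
  qed
  then show "\<exists>C c. 0 \<le> C \<and> 0 \<le> c \<and> (\<forall>t\<in>{0..T}. \<forall>x. \<bar>f t x + g t x\<bar> \<le> C * exp (c * \<bar>x\<bar>))"
    using f g by (intro exI[of _ "C + D"] exI[of _ "max c d"]) auto
qed

lemma exp_growth_mult:
  assumes "exp_growth f" "exp_growth g"
  shows "exp_growth (\<lambda>t x. f t x * g t x)"
  unfolding exp_growth_def
proof
  fix T
  obtain C c where f: "0 \<le> C" "0 \<le> c" "\<And>t x. 0 \<le> t \<Longrightarrow> t \<le> T \<Longrightarrow> \<bar>f t x\<bar> \<le> C * exp (c * \<bar>x\<bar>)"
    using exp_growthE[OF assms(1)] by blast
  obtain D d where g: "0 \<le> D" "0 \<le> d" "\<And>t x. 0 \<le> t \<Longrightarrow> t \<le> T \<Longrightarrow> \<bar>g t x\<bar> \<le> D * exp (d * \<bar>x\<bar>)"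
    using exp_growthE[OF assms(2)] by blast
  have "\<bar>f t x * g t x\<bar> \<le> (C * D) * exp ((c + d) * \<bar>x\<bar>)" if "t \<in> {0..T}" for t x
  proof -
    have "\<bar>f t x * g t x\<bar> \<le> (C * exp (c * \<bar>x\<bar>)) * (D * exp (d * \<bar>x\<bar>))"
      unfolding abs_mult using f g that by (intro mult_mono) auto
    then show ?thesis by (simp add: distrib_right distrib_left exp_add mult_ac)
  qed
  then show "\<exists>C c. 0 \<le> C \<and> 0 \<le> c \<and> (\<forall>t\<in>{0..T}. \<forall>x. \<bar>f t x * g t x\<bar> \<le> C * exp (c * \<bar>x\<bar>))"
    using f g by (intro exI[of _ "C * D"] exI[of _ "c + d"]) auto
qed

lemma exp_growth_power: "exp_growth f \<Longrightarrow> exp_growth (\<lambda>t x. f t x ^ n)"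
  by (induction n) (auto intro!: exp_growth_mult exp_growth_time)

text \<open>Solutions of \<open>\<partial>\<^sub>t f + f'' = 0\<close>, described by the mean value property that they satisfy
  along Brownian motion.\<close>

definition caloric1 :: "(real \<Rightarrow> real \<Rightarrow> real) \<Rightarrow> bool" where
  "caloric1 f \<longleftrightarrow> continuous_on UNIV (\<lambda>(t, x). f t x) \<and> exp_growth f \<and>
    (\<forall>t x h. 0 < h \<longrightarrow> has_bochner_integral (centred_gaussian h) (\<lambda>w. f (t + h) (x + sqrt 2 * w)) (f t x))"

text \<open>The factors of \<open>a0\<close> to \<open>a5\<close> solve the backward heat equation
  and reduce to monomials at \<open>t = 0\<close>. Of the powers of the increment only the second
  and the fourth have a mean that matters, and they shift the time from \<open>t + h\<close> back to
  \<open>t\<close>.\<close>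

lemma caloric1_quintic:
  assumes f: "\<And>t x. f t x = a0 + a1 * x + a2 * (x^2 - 2 * t) + a3 * (x^3 - 6 * t * x)
    + a4 * (x^4 - 12 * t * x^2 + 12 * t^2) + a5 * (x^5 - 20 * t * x^3 + 60 * t^2 * x)"
  shows "caloric1 f"
  unfolding caloric1_def
proof (intro conjI allI impI)
  show "continuous_on UNIV (\<lambda>(t, x). f t x)"
    unfolding f case_prod_beta by (intro continuous_intros)
  show "exp_growth f"
    unfolding f diff_conv_add_uminus minus_mult_left
    by (intro exp_growth_add exp_growth_mult exp_growth_power exp_growth_space exp_growth_time continuous_intros)
  fix t x h :: real assume h: "0 < h"
  show "has_bochner_integral (centred_gaussian h) (\<lambda>w. f (t + h) (x + sqrt 2 * w)) (f t x)"
  proof -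
    \<comment> \<open>Taylor expansion around \<open>x\<close> at the fixed time
      \<open>t + h\<close>: the coefficients are the space derivatives of \<open>f\<close> divided
      by factorials.\<close>
    have "(\<lambda>w. f (t + h) (x + sqrt 2 * w)) = (\<lambda>w.
      f (t + h) x
      + (a1 + 2 * a2 * x + a3 * (3 * x^2 - 6 * (t + h)) + a4 * (4 * x^3 - 24 * (t + h) * x)
          + a5 * (5 * x^4 - 60 * (t + h) * x^2 + 60 * (t + h)^2)) * (sqrt 2 * w)
      + (a2 + 3 * a3 * x + a4 * (6 * x^2 - 12 * (t + h)) + a5 * (10 * x^3 - 60 * (t + h) * x)) * (sqrt 2 * w)^2
      + (a3 + 4 * a4 * x + a5 * (10 * x^2 - 20 * (t + h))) * (sqrt 2 * w)^3
      + (a4 + 5 * a5 * x) * (sqrt 2 * w)^4 + a5 * (sqrt 2 * w)^5)"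
    proof
      fix w
      define v where "v = sqrt 2 * w"
      show "f (t + h) (x + sqrt 2 * w) = 
      f (t + h) x
      + (a1 + 2 * a2 * x + a3 * (3 * x^2 - 6 * (t + h)) + a4 * (4 * x^3 - 24 * (t + h) * x)
          + a5 * (5 * x^4 - 60 * (t + h) * x^2 + 60 * (t + h)^2)) * (sqrt 2 * w)
      + (a2 + 3 * a3 * x + a4 * (6 * x^2 - 12 * (t + h)) + a5 * (10 * x^3 - 60 * (t + h) * x)) * (sqrt 2 * w)^2
      + (a3 + 4 * a4 * x + a5 * (10 * x^2 - 20 * (t + h))) * (sqrt 2 * w)^3
      + (a4 + 5 * a5 * x) * (sqrt 2 * w)^4 + a5 * (sqrt 2 * w)^5"
        unfolding f v_def[symmetric] by (simp add: power_numeral_reduce algebra_simps)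
    qed
    moreover have "f t x = f (t + h) x
        + 2 * h * (a2 + 3 * a3 * x + a4 * (6 * x^2 - 12 * (t + h)) + a5 * (10 * x^3 - 60 * (t + h) * x))
        + 12 * h^2 * (a4 + 5 * a5 * x)"
      unfolding f by (simp add: power_numeral_reduce algebra_simps)
    ultimately show ?thesis
      using has_bochner_integral_quintic[OF h] by simp
  qed
qed

text \<open>Completing the square: the exponential tilts the Gaussian into one of mean
  \<open>sqrt 2 * c * h\<close>, which has total mass one. These functions serve to dominate
  others.\<close>

lemma caloric1_exp: "caloric1 (\<lambda>t x. exp (c * x - c^2 * t))"
  unfolding caloric1_def
proof (intro conjI allI impI)
  show "continuous_on UNIV (\<lambda>(t, x). exp (c * x - c^2 * t))"
    unfolding case_prod_beta by (intro continuous_intros)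
  show "exp_growth (\<lambda>t x. exp (c * x - c^2 * t))"
  proof (rule exp_growthI[where C = "\<lambda>_. 1" and c = "\<bar>c\<bar>"])
    fix t x :: real assume "0 \<le> t"
    then have "0 \<le> c^2 * t" by simp
    moreover have "c * x \<le> \<bar>c\<bar> * \<bar>x\<bar>" using abs_ge_self[of "c * x"] by (simp add: abs_mult)
    ultimately have "c * x - c^2 * t \<le> \<bar>c\<bar> * \<bar>x\<bar>" by linarith
    then show "\<bar>exp (c * x - c^2 * t)\<bar> \<le> 1 * exp (\<bar>c\<bar> * \<bar>x\<bar>)" by simp
  qed auto
  fix t x h :: real assume h: "0 < h"
  have eq: "normal_density 0 (sqrt h) w * exp (c * (x + sqrt 2 * w) - c^2 * (t + h))
      = exp (c * x - c^2 * t) * normal_density (sqrt 2 * c * h) (sqrt h) w" for w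
  proof -
    have "- ((w - 0)^2) / (2 * (sqrt h)^2) + (c * (x + sqrt 2 * w) - c^2 * (t + h))
        = (c * x - c^2 * t) + - ((w - sqrt 2 * c * h)^2) / (2 * (sqrt h)^2)"
    proof -
      have "(w - sqrt 2 * c * h)^2 = w^2 - 2 * sqrt 2 * c * h * w + 2 * c^2 * h^2"
        by (simp add: power2_diff power_mult_distrib)
      then show ?thesis using h by (simp add: field_simps power2_eq_square)
    qed
    then show ?thesis
      unfolding normal_density_def by (simp add: exp_add[symmetric] field_simps)
  qed
  have "has_bochner_integral lborel (\<lambda>w. normal_density (sqrt 2 * c * h) (sqrt h) w) 1"
    using h by (simp add: has_bochner_integral_iff)
  then have "has_bochner_integral lborel
      (\<lambda>w. normal_density 0 (sqrt h) w * exp (c * (x + sqrt 2 * w) - c^2 * (t + h))) (exp (c * x - c^2 * t))"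
    unfolding eq using has_bochner_integral_mult_right by fastforce
  then show "has_bochner_integral (centred_gaussian h)
      (\<lambda>w. exp (c * (x + sqrt 2 * w) - c^2 * (t + h))) (exp (c * x - c^2 * t))"
    by (intro has_bochner_integral_centred_gaussian) auto
qed

text \<open>Rescaling of the characteristic function of the standard normal law; the variance is
  \<open>h\<close> here, the factor \<open>sqrt 2\<close> being left to \<open>c\<close>.\<close>

lemma char_centred_gaussian:
  assumes "0 < h"
  shows "has_bochner_integral (centred_gaussian h) (\<lambda>w. iexp (c * w)) (complex_of_real (exp (- (c^2 * h / 2))))"
proof -
  have "char std_normal_distribution (c * sqrt h) = exp (- (c^2 * h / 2))"
    using assms by (simp add: char_std_normal_distribution power_mult_distrib)
  then have 1: "(CLINT x|std_normal_distribution. iexp (c * sqrt h * x)) = exp (- (c^2 * h / 2))"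
    unfolding char_def .
  interpret prob_space std_normal_distribution
    by (rule prob_space_normal_density) simp
  have "has_bochner_integral std_normal_distribution (\<lambda>x. iexp (c * sqrt h * x)) (complex_of_real (exp (- (c^2 * h / 2))))"
    unfolding has_bochner_integral_iff using 1
    by (auto intro!: integrable_const_bound[of _ 1])
  then have 2: "has_bochner_integral lborel
      (\<lambda>x. normal_density 0 1 x *\<^sub>R iexp (c * sqrt h * x)) (complex_of_real (exp (- (c^2 * h / 2))))"
    unfolding has_bochner_integral_iff
    by (auto simp: integrable_density integral_density)
  have nd: "normal_density 0 (sqrt h) x = inverse (sqrt h) * normal_density 0 1 (inverse (sqrt h) * x)" for x
    using assms by (simp add: normal_density_def real_sqrt_mult field_simps)
  have int: "has_bochner_integral lborel (\<lambda>x. normal_density 0 1 (0 + inverse (sqrt h) * x) *\<^sub>R iexp (c * sqrt h * (0 + inverse (sqrt h) * x)))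
      (complex_of_real (exp (- (c^2 * h / 2))) /\<^sub>R \<bar>inverse (sqrt h)\<bar>)"
    using 2 assms by (intro lborel_has_bochner_integral_real_affine_iff[THEN iffD1]) auto
  have cancel: "c * sqrt h * inverse (sqrt h) = c" "inverse (sqrt h) / \<bar>inverse (sqrt h)\<bar> = 1"
    "inverse (sqrt h) * sqrt h = 1" "\<bar>sqrt h\<bar> = sqrt h" "0 \<le> h" "0 < h" "sqrt h \<noteq> 0"
    using assms by auto
  from has_bochner_integral_scaleR_right[OF int, of "inverse (sqrt h)"]
  have "has_bochner_integral lborel (\<lambda>x. normal_density 0 (sqrt h) x *\<^sub>R iexp (c * x))
      (complex_of_real (exp (- (c^2 * h / 2))))"
    unfolding nd using cancel by (simp add: mult.assoc[symmetric] del: of_real_mult)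
  then show ?thesis
    unfolding centred_gaussian_def by (intro has_bochner_integral_density) auto
qed

text \<open>Imaginary part of a plane wave, which an increment \<open>sqrt 2 * w\<close> damps by
  \<open>exp (- (c^2 * h))\<close>; the growing factor in \<open>t\<close> compensates. With
  \<open>c\<close> a multiple of \<open>pi / a\<close> or \<open>pi / b\<close> these are the
  factors of the eigenfunctions of the rectangle.\<close>

lemma caloric1_sin: "caloric1 (\<lambda>t x. exp (c^2 * t) * sin (c * x))"
  unfolding caloric1_def
proof (intro conjI allI impI)
  show "continuous_on UNIV (\<lambda>(t, x). exp (c^2 * t) * sin (c * x))"
    unfolding case_prod_beta by (intro continuous_intros)
  have "exp_growth (\<lambda>t x. sin (c * x))"
    by (rule exp_growthI[where C = "\<lambda>_. 1" and c = 0]) auto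
  then show "exp_growth (\<lambda>t x. exp (c^2 * t) * sin (c * x))"
    by (intro exp_growth_mult exp_growth_time continuous_intros)
  fix t x h :: real assume h: "0 < h"
  have "has_bochner_integral (centred_gaussian h)
     (\<lambda>w. Im (iexp (c * x) * iexp ((c * sqrt 2) * w))) (Im (iexp (c * x) * complex_of_real (exp (- ((c * sqrt 2)^2 * h / 2)))))"
    by (intro has_bochner_integral_bounded_linear[OF bounded_linear_Im] has_bochner_integral_mult_right char_centred_gaussian h)
  moreover have "Im (iexp (c * x) * iexp ((c * sqrt 2) * w)) = sin (c * (x + sqrt 2 * w))" for w
    unfolding exp_add[symmetric] distrib_left[symmetric] of_real_add[symmetric]
    by (simp add: Im_exp algebra_simps)
  ultimately have "has_bochner_integral (centred_gaussian h)
     (\<lambda>w. sin (c * (x + sqrt 2 * w))) (sin (c * x) * exp (- (c^2 * h)))"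
    using h by (simp add: Im_exp power_mult_distrib)
  from has_bochner_integral_mult_right[of "exp (c^2 * (t + h))", OF this]
  show "has_bochner_integral (centred_gaussian h) (\<lambda>w. exp (c^2 * (t + h)) * sin (c * (x + sqrt 2 * w)))
     (exp (c^2 * t) * sin (c * x))"
    by (simp add: exp_add exp_minus field_simps)
qed

lemma caloric1_add:
  assumes "caloric1 f" "caloric1 g"
  shows "caloric1 (\<lambda>t x. f t x + g t x)"
  using assms unfolding caloric1_def case_prod_beta
  by (auto intro!: exp_growth_add continuous_intros has_bochner_integral_add)


section \<open>Caloric functions on the plane\<close>

text \<open>The moduli of the coordinates are added in the exponent so that products of one-variable
  bounds fit. Growth is controlled on bounded ranges of nonnegative times, where the capped exit
  times take their values.\<close>

definition caloric :: "(real \<Rightarrow> real \<times> real \<Rightarrow> real) \<Rightarrow> bool" where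
  "caloric F \<longleftrightarrow> continuous_on UNIV (\<lambda>(t, z). F t z) \<and>
    (\<forall>T. \<exists>C c. 0 \<le> C \<and> 0 \<le> c \<and>
      (\<forall>t\<in>{0..T}. \<forall>z. \<bar>F t z\<bar> \<le> C * exp (c * (\<bar>fst z\<bar> + \<bar>snd z\<bar>)))) \<and>
    (\<forall>t z h. 0 < h \<longrightarrow>
      has_bochner_integral (planar_gaussian h) (\<lambda>w. F (t + h) (z + sqrt 2 *\<^sub>R w)) (F t z))"

lemma caloric_continuous: "caloric F \<Longrightarrow> continuous_on UNIV (\<lambda>(t, z). F t z)"
  by (simp add: caloric_def)

lemma caloric_mean_value:
  "caloric F \<Longrightarrow> 0 < h \<Longrightarrow>
    has_bochner_integral (planar_gaussian h) (\<lambda>w. F (t + h) (z + sqrt 2 *\<^sub>R w)) (F t z)"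
  unfolding caloric_def by blast

lemma caloric_growthE:
  assumes "caloric F"
  obtains C c where "0 \<le> C" "0 \<le> c"
    "\<And>t z. 0 \<le> t \<Longrightarrow> t \<le> T \<Longrightarrow> \<bar>F t z\<bar> \<le> C * exp (c * (\<bar>fst z\<bar> + \<bar>snd z\<bar>))"
proof -
  have "\<exists>C c. 0 \<le> C \<and> 0 \<le> c \<and>
      (\<forall>t\<in>{0..T}. \<forall>z. \<bar>F t z\<bar> \<le> C * exp (c * (\<bar>fst z\<bar> + \<bar>snd z\<bar>)))"
    using assms unfolding caloric_def by blast
  then show thesis using that by (meson atLeastAtMost_iff)
qed

lemma caloric_add:
  assumes "caloric F" "caloric G"
  shows "caloric (\<lambda>t z. F t z + G t z)"
  unfolding caloric_def
proof (intro conjI allI impI)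
  show "continuous_on UNIV (\<lambda>(t, z). F t z + G t z)"
    using assms unfolding caloric_def case_prod_beta by (intro continuous_intros) auto
  fix T
  obtain C c where f: "0 \<le> C" "0 \<le> c"
    "\<And>t z. 0 \<le> t \<Longrightarrow> t \<le> T \<Longrightarrow> \<bar>F t z\<bar> \<le> C * exp (c * (\<bar>fst z\<bar> + \<bar>snd z\<bar>))"
    using caloric_growthE[OF assms(1)] by blast
  obtain D d where g: "0 \<le> D" "0 \<le> d"
    "\<And>t z. 0 \<le> t \<Longrightarrow> t \<le> T \<Longrightarrow> \<bar>G t z\<bar> \<le> D * exp (d * (\<bar>fst z\<bar> + \<bar>snd z\<bar>))"
    using caloric_growthE[OF assms(2)] by blast
  have "\<bar>F t z + G t z\<bar> \<le> (C + D) * exp (max c d * (\<bar>fst z\<bar> + \<bar>snd z\<bar>))" if "t \<in> {0..T}" for t z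
  proof -
    have "C * exp (c * (\<bar>fst z\<bar> + \<bar>snd z\<bar>)) \<le> C * exp (max c d * (\<bar>fst z\<bar> + \<bar>snd z\<bar>))"
      "D * exp (d * (\<bar>fst z\<bar> + \<bar>snd z\<bar>)) \<le> D * exp (max c d * (\<bar>fst z\<bar> + \<bar>snd z\<bar>))"
      using f(1) g(1) by (auto intro!: mult_left_mono mult_right_mono)
    then show ?thesis using f(3)[of t z] g(3)[of t z] that abs_triangle_ineq[of "F t z" "G t z"]
      unfolding distrib_right[of C D] atLeastAtMost_iff by linarith
  qed
  then show "\<exists>C c. 0 \<le> C \<and> 0 \<le> c \<and> (\<forall>t\<in>{0..T}. \<forall>z. \<bar>F t z + G t z\<bar> \<le> C * exp (c * (\<bar>fst z\<bar> + \<bar>snd z\<bar>)))"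
    using f g by (intro exI[of _ "C + D"] exI[of _ "max c d"]) auto
next
  fix t z and h :: real assume "0 < h"
  then show "has_bochner_integral (planar_gaussian h)
      (\<lambda>w. F (t + h) (z + sqrt 2 *\<^sub>R w) + G (t + h) (z + sqrt 2 *\<^sub>R w)) (F t z + G t z)"
    using assms by (intro has_bochner_integral_add caloric_mean_value)
qed

lemma has_bochner_integral_pair_mult:
  fixes f g :: "real \<Rightarrow> real"
  assumes "prob_space M" "prob_space N"
    and f: "has_bochner_integral M f x" and g: "has_bochner_integral N g y"
  shows "has_bochner_integral (M \<Otimes>\<^sub>M N) (\<lambda>p. f (fst p) * g (snd p)) (x * y)"
proof -
  interpret M: prob_space M by fact
  interpret N: prob_space N by fact
  interpret pair_prob_space M N ..
  have fi: "integrable M f" "integral\<^sup>L M f = x" and gi: "integrable N g" "integral\<^sup>L N g = y"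
    using f g by (auto simp: has_bochner_integral_iff)
  have [measurable]: "f \<in> borel_measurable M" "g \<in> borel_measurable N" using fi gi by auto
  have "integrable (M \<Otimes>\<^sub>M N) (\<lambda>(u, v). f u * g v)"
    by (rule Fubini_integrable) (use fi gi in \<open>auto simp: abs_mult\<close>)
  moreover from integral_fst[OF this] have "integral\<^sup>L (M \<Otimes>\<^sub>M N) (\<lambda>(u, v). f u * g v) = x * y"
    using fi gi by simp
  ultimately show ?thesis by (simp add: has_bochner_integral_iff case_prod_beta')
qed

text \<open>Separation of variables: the coordinates of a planar Gaussian are independent, so the
  mean of the product is the product of the means.\<close>

lemma caloric_mult:
  assumes "caloric1 f" "caloric1 g"
  shows "caloric (\<lambda>t z. f t (fst z) * g t (snd z))"
  unfolding caloric_def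
proof (intro conjI allI impI)
  have "continuous_on UNIV (\<lambda>(t, x). f t x)" "continuous_on UNIV (\<lambda>(t, x). g t x)"
    using assms by (auto simp: caloric1_def)
  from continuous_on_compose2[OF this(1), of UNIV "\<lambda>(t, z). (t, fst z)"]
    continuous_on_compose2[OF this(2), of UNIV "\<lambda>(t, z). (t, snd z)"]
  show "continuous_on UNIV (\<lambda>(t, z). f t (fst z) * g t (snd z))"
    unfolding case_prod_beta by (intro continuous_intros) (auto simp: continuous_intros)
  have gr: "exp_growth f" "exp_growth g" using assms by (auto simp: caloric1_def)
  fix T
  obtain C c where f: "0 \<le> C" "0 \<le> c" "\<And>t x. 0 \<le> t \<Longrightarrow> t \<le> T \<Longrightarrow> \<bar>f t x\<bar> \<le> C * exp (c * \<bar>x\<bar>)"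
    using exp_growthE[OF gr(1)] by blast
  obtain D d where g: "0 \<le> D" "0 \<le> d" "\<And>t x. 0 \<le> t \<Longrightarrow> t \<le> T \<Longrightarrow> \<bar>g t x\<bar> \<le> D * exp (d * \<bar>x\<bar>)"
    using exp_growthE[OF gr(2)] by blast
  have "\<bar>f t (fst z) * g t (snd z)\<bar> \<le> (C * D) * exp (max c d * (\<bar>fst z\<bar> + \<bar>snd z\<bar>))" if "t \<in> {0..T}" for t z
  proof -
    have "\<bar>f t (fst z)\<bar> \<le> C * exp (max c d * \<bar>fst z\<bar>)" "\<bar>g t (snd z)\<bar> \<le> D * exp (max c d * \<bar>snd z\<bar>)"
      using f g that by (auto intro!: order.trans[OF f(3)] order.trans[OF g(3)] mult_left_mono mult_right_mono)
    then have "\<bar>f t (fst z) * g t (snd z)\<bar> \<le> (C * exp (max c d * \<bar>fst z\<bar>)) * (D * exp (max c d * \<bar>snd z\<bar>))"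
      unfolding abs_mult using f g by (intro mult_mono) auto
    then show ?thesis by (simp add: distrib_left exp_add mult_ac)
  qed
  then show "\<exists>C c. 0 \<le> C \<and> 0 \<le> c \<and>
      (\<forall>t\<in>{0..T}. \<forall>z. \<bar>f t (fst z) * g t (snd z)\<bar> \<le> C * exp (c * (\<bar>fst z\<bar> + \<bar>snd z\<bar>)))"
    using f g by (intro exI[of _ "C * D"] exI[of _ "max c d"]) auto
next
  fix t z and h :: real assume h: "0 < h"
  have "has_bochner_integral (centred_gaussian h \<Otimes>\<^sub>M centred_gaussian h)
    (\<lambda>p. f (t + h) (fst z + sqrt 2 * fst p) * g (t + h) (snd z + sqrt 2 * snd p)) (f t (fst z) * g t (snd z))"
    using assms h by (intro has_bochner_integral_pair_mult prob_space_centred_gaussian) (auto simp: caloric1_def)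
  then show "has_bochner_integral (planar_gaussian h)
    (\<lambda>w. f (t + h) (fst (z + sqrt 2 *\<^sub>R w)) * g (t + h) (snd (z + sqrt 2 *\<^sub>R w))) (f t (fst z) * g t (snd z))"
    by (simp add: planar_gaussian_def)
qed

lemma caloric_cmult:
  assumes "caloric F"
  shows "caloric (\<lambda>t z. k * F t z)"
  unfolding caloric_def
proof (intro conjI allI impI)
  show "continuous_on UNIV (\<lambda>(t, z). k * F t z)"
    using assms unfolding caloric_def case_prod_beta by (intro continuous_intros) auto
  fix T
  obtain C c where f: "0 \<le> C" "0 \<le> c"
    "\<And>t z. 0 \<le> t \<Longrightarrow> t \<le> T \<Longrightarrow> \<bar>F t z\<bar> \<le> C * exp (c * (\<bar>fst z\<bar> + \<bar>snd z\<bar>))"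
    using caloric_growthE[OF assms] by blast
  then show "\<exists>C c. 0 \<le> C \<and> 0 \<le> c \<and> (\<forall>t\<in>{0..T}. \<forall>z. \<bar>k * F t z\<bar> \<le> C * exp (c * (\<bar>fst z\<bar> + \<bar>snd z\<bar>)))"
    by (intro exI[of _ "\<bar>k\<bar> * C"] exI[of _ c]) (auto simp: abs_mult mult.assoc intro!: mult_left_mono)
next
  fix t z and h :: real assume "0 < h"
  then show "has_bochner_integral (planar_gaussian h) (\<lambda>w. k * F (t + h) (z + sqrt 2 *\<^sub>R w)) (k * F t z)"
    using assms by (intro has_bochner_integral_mult_right caloric_mean_value)
qed

text \<open>Makes the values of \<open>F\<close> along the stopped path bounded in \<open>L\<^sup>2\<close>: the expectation of the
  dominating caloric function is conserved.\<close>

lemma caloric_square_le: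
  assumes "caloric F"
  obtains G where "caloric G" "\<And>t z. 0 \<le> G t z" "\<And>t z. 0 \<le> t \<Longrightarrow> t \<le> T \<Longrightarrow> (F t z)\<^sup>2 \<le> G t z"
proof -
  obtain C c where f: "0 \<le> C" "0 \<le> c"
    "\<And>t z. 0 \<le> t \<Longrightarrow> t \<le> T \<Longrightarrow> \<bar>F t z\<bar> \<le> C * exp (c * (\<bar>fst z\<bar> + \<bar>snd z\<bar>))"
    using caloric_growthE[OF assms] by blast
  \<comment> \<open>Squaring the growth bound doubles the rate.\<close>
  define d where "d = 2 * c"
  \<comment> \<open>The two-sided exponential dominates \<open>exp (d * \<bar>x\<bar>)\<close> up to
    the time factor \<open>exp (- (d^2 * t))\<close>. Each coordinate contributes one such factor,
    and \<open>exp (2 * d^2 * T)\<close> offsets both up to time \<open>T\<close>.\<close>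
  define e where "e = (\<lambda>t x. exp (d * x - d^2 * t) + exp (- d * x - (- d)^2 * t))"
  define G where "G = (\<lambda>t z. (C^2 * exp (2 * d^2 * T)) * (e t (fst z) * e t (snd z)))"
  have e: "caloric1 e" unfolding e_def by (intro caloric1_add caloric1_exp)
  have e0: "0 \<le> e t x" for t x by (simp add: e_def add_nonneg_nonneg)
  have "caloric G" unfolding G_def by (intro caloric_cmult caloric_mult e)
  moreover have "0 \<le> G t z" for t z unfolding G_def using e0 by simp
  moreover have "(F t z)\<^sup>2 \<le> G t z" if t: "0 \<le> t" "t \<le> T" for t z
  proof -
    have "(F t z)\<^sup>2 \<le> (C * exp (c * (\<bar>fst z\<bar> + \<bar>snd z\<bar>)))^2"
      using power_mono[OF f(3)[OF t, of z] abs_ge_zero, of 2] by simp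
    also have "\<dots> = C^2 * (exp (d * \<bar>fst z\<bar>) * exp (d * \<bar>snd z\<bar>))"
      by (simp add: power_mult_distrib d_def power2_eq_square exp_add[symmetric] algebra_simps)
    also have "\<dots> \<le> C^2 * ((exp (d^2 * T) * e t (fst z)) * (exp (d^2 * T) * e t (snd z)))"
    proof -
      have "exp (d * \<bar>x\<bar>) \<le> exp (d^2 * T) * e t x" for x
      proof -
        have "exp (d * \<bar>x\<bar>) \<le> exp (d^2 * (T - t)) * exp (d * \<bar>x\<bar>)"
          using t by simp
        also have "\<dots> \<le> exp (d^2 * (T - t)) * (exp (d * x) + exp (- (d * x)))"
          by (intro mult_left_mono) (auto simp: abs_if)
        also have "\<dots> = exp (d^2 * T) * e t x"
        proof -
          have "exp (d^2 * (T - t)) = exp (d^2 * T) * exp (- (d^2 * t))"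
            by (simp add: exp_add[symmetric] right_diff_distrib)
          moreover have "e t x = exp (- (d^2 * t)) * (exp (d * x) + exp (- (d * x)))"
            by (simp add: e_def exp_diff exp_minus field_simps)
          ultimately show ?thesis by simp
        qed
        finally show ?thesis .
      qed
      then show ?thesis using e0 by (intro mult_left_mono mult_mono) auto
    qed
    also have "\<dots> = G t z" 
    proof -
      have "exp (2 * d^2 * T) = exp (d^2 * T) * exp (d^2 * T)"
        by (simp add: exp_add[symmetric])
      then show ?thesis unfolding G_def by simp
    qed
    finally show ?thesis .
  qed
  ultimately show thesis using that by blast
qed


section \<open>Optional stopping\<close>

context standard_planar_brownian_motion
begin

section \<open>The past of the path and its independence of later increments\<close>

definition history :: "real \<Rightarrow> 'w measure" where
  "history s = sigma (space M) {B r -` A \<inter> space M | r A. 0 \<le> r \<and> r \<le> s \<and> A \<in> sets borel}"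

lemma space_history [simp]: "space (history s) = space M"
  unfolding history_def by (intro space_measure_of) auto

lemma sets_history:
  "sets (history s) = sigma_sets (space M) {B r -` A \<inter> space M | r A. 0 \<le> r \<and> r \<le> s \<and> A \<in> sets borel}"
  unfolding history_def by (intro sets_measure_of) auto

lemma measurable_B_history: "0 \<le> r \<Longrightarrow> r \<le> s \<Longrightarrow> B r \<in> measurable (history s) borel"
proof (rule measurableI)
  fix A :: "(real \<times> real) set" assume "0 \<le> r" "r \<le> s" "A \<in> sets borel"
  then show "B r -` A \<inter> space (history s) \<in> sets (history s)"
    unfolding sets_history space_history by (intro sigma_sets.Basic) blast
qed auto

lemma sets_history_subset: "sets (history s) \<subseteq> events"
  unfolding sets_history by (rule sets.sigma_sets_subset) (use measurable_sets[OF measurable_time] in blast)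

lemma measurable_from_history: "f \<in> measurable (history s) N \<Longrightarrow> f \<in> measurable M N"
  using sets_history_subset[of s] unfolding measurable_def space_history by blast

text \<open>The locale speaks of increments along a strictly increasing sequence of times. Positions
  at the times in \<open>J\<close> are partial sums of such increments, and the increment after
  \<open>s\<close> is the next one, so grouping independent variables gives the claim.\<close>

lemma prob_finite_past_increment:
  assumes J: "finite J" "J \<subseteq> {0..s}" and "0 \<le> s" "s < t"
    and A: "\<And>r. A r \<in> sets borel" and C: "C \<in> sets borel"
  shows "prob ({\<omega>\<in>space M. \<forall>r\<in>J. B r \<omega> \<in> A r} \<inter> ((\<lambda>\<omega>. B t \<omega> - B s \<omega>) -` C \<inter> space M)) =
    prob {\<omega>\<in>space M. \<forall>r\<in>J. B r \<omega> \<in> A r} * prob ((\<lambda>\<omega>. B t \<omega> - B s \<omega>) -` C \<inter> space M)"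
proof -
  \<comment> \<open>The entry \<open>0\<close> lets the partial sums start from
    \<open>B 0 \<omega> = 0\<close>; \<open>s\<close> becomes the last entry, so that the increment
    with index \<open>n\<close> runs from \<open>s\<close> to \<open>t\<close>.\<close>
  define l where "l = sorted_list_of_set (insert 0 (insert s J))"
  define n where "n = length l - 1"
  \<comment> \<open>The sequence has to increase strictly over all indices, hence the continuation
    \<open>t, t + 1, ...\<close> beyond the list.\<close>
  define \<tau> where "\<tau> i = (if i \<le> n then l ! i else t + real (i - Suc n))" for i
  have l: "sorted_wrt (<) l" "set l = insert 0 (insert s J)" "length l = Suc n"
  proof -
    show "sorted_wrt (<) l" unfolding l_def by simp
    show l2: "set l = insert 0 (insert s J)" unfolding l_def using J by (intro set_sorted_list_of_set) auto
    then show "length l = Suc n" unfolding n_def by (cases l) auto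
  qed
  have mono: "l ! i < l ! j" if "i < j" "j \<le> n" for i j
    using l that by (auto simp: sorted_wrt_iff_nth_less)
  have mem: "l ! i \<in> {0..s}" if "i \<le> n" for i
    using nth_mem[of i l] l J \<open>0 \<le> s\<close> that by auto
  have l0: "l ! 0 = 0"
  proof -
    obtain i where "i \<le> n" "l ! i = 0" using l by (metis in_set_conv_nth insertI1 less_Suc_eq_le)
    then show ?thesis using mono[of 0 i] mem[of 0] by (cases "i = 0") auto
  qed
  have ln: "l ! n = s"
  proof -
    obtain i where "i \<le> n" "l ! i = s" using l by (metis in_set_conv_nth insertI1 insertI2 less_Suc_eq_le)
    then show ?thesis using mono[of i n] mem[of n] by (cases "i = n") auto
  qed
  have "strict_mono \<tau>"
  proof (rule strict_mono_Suc_iff[THEN iffD2], intro allI)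
    fix i
    show "\<tau> i < \<tau> (Suc i)"
      using mono[of i "Suc i"] mem[of i] \<open>s < t\<close> by (auto simp: \<tau>_def Suc_diff_le)
  qed
  moreover have "0 \<le> \<tau> 0" by (simp add: \<tau>_def l0)
  ultimately have ind: "indep_vars (\<lambda>_. borel) (\<lambda>i \<omega>. B (\<tau> (Suc i)) \<omega> - B (\<tau> i) \<omega>) {..<Suc n}"
    by (intro independent_increments)
  define idx where "idx r = (SOME i. i \<le> n \<and> l ! i = r)" for r
  have idx: "idx r \<le> n \<and> l ! idx r = r" if "r \<in> J" for r
    unfolding idx_def
    by (rule someI_ex) (use that l in \<open>metis in_set_conv_nth insertCI less_Suc_eq_le\<close>)
  let ?X = "(\<lambda>x. \<lambda>r\<in>J. \<Sum>i<idx r. x i) \<circ> (\<lambda>\<omega>. \<lambda>i\<in>{..<n}. B (\<tau> (Suc i)) \<omega> - B (\<tau> i) \<omega>)"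
  \<comment> \<open>A single increment, written as a function on a one-point index set because
    \<open>indep_var\<close> relates variables with values in the same type.\<close>
  let ?Y = "(\<lambda>x. \<lambda>r\<in>{0::real}. x n) \<circ> (\<lambda>\<omega>. \<lambda>i\<in>{n}. B (\<tau> (Suc i)) \<omega> - B (\<tau> i) \<omega>)"
  have "indep_var (PiM J (\<lambda>_. borel)) ?X (PiM {0} (\<lambda>_. borel)) ?Y"
  proof (rule indep_var_compose[OF indep_var_restrict[OF ind]])
    have "(\<lambda>x. \<Sum>i<idx r. x i) \<in> Pi\<^sub>M {..<n} (\<lambda>_. borel) \<rightarrow>\<^sub>M (borel :: (real \<times> real) measure)" if "r \<in> J" for r
      using idx[OF that] by (intro borel_measurable_sum measurable_component_singleton) auto
    then show "(\<lambda>x. \<lambda>r\<in>J. \<Sum>i<idx r. x i) \<in> Pi\<^sub>M {..<n} (\<lambda>_. borel) \<rightarrow>\<^sub>M PiM J (\<lambda>_. borel :: (real \<times> real) measure)"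
      by (intro measurable_restrict) auto
    show "(\<lambda>x. \<lambda>r\<in>{0}. x n) \<in> Pi\<^sub>M {n} (\<lambda>_. borel) \<rightarrow>\<^sub>M PiM {0} (\<lambda>_. borel :: (real \<times> real) measure)"
      by (intro measurable_restrict measurable_component_singleton) auto
  qed auto
  moreover have "PiE {0::real} (\<lambda>_. C) \<in> sets (PiM {0} (\<lambda>_. borel))"
    using C by (intro sets_PiM_I_finite) auto
  moreover have "PiE J A \<in> sets (PiM J (\<lambda>_. borel))"
    using J A by (intro sets_PiM_I_finite) auto
  ultimately have *: "prob ((\<lambda>x. (?X x, ?Y x)) -` (PiE J A \<times> PiE {0} (\<lambda>_. C)) \<inter> space M) =
    prob (?X -` PiE J A \<inter> space M) * prob (?Y -` PiE {0} (\<lambda>_. C) \<inter> space M)"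
    by (intro indep_varD[of "PiM J (\<lambda>_. borel)" ?X "PiM {0} (\<lambda>_. borel)" ?Y])
  have X: "?X \<omega> = (\<lambda>r\<in>J. B r \<omega>)" if "\<omega> \<in> space M" for \<omega>
  proof -
    have "(\<Sum>i<idx r. (\<lambda>i\<in>{..<n}. B (\<tau> (Suc i)) \<omega> - B (\<tau> i) \<omega>) i) = B r \<omega>" if "r \<in> J" for r
    proof -
      have "(\<Sum>i<idx r. (\<lambda>i\<in>{..<n}. B (\<tau> (Suc i)) \<omega> - B (\<tau> i) \<omega>) i)
          = (\<Sum>i<idx r. B (\<tau> (Suc i)) \<omega> - B (\<tau> i) \<omega>)"
        using idx[OF that] by (intro sum.cong) auto
      also have "\<dots> = B (\<tau> (idx r)) \<omega> - B (\<tau> 0) \<omega>"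
        by (rule sum_lessThan_telescope)
      finally show ?thesis
        using idx[OF that] start[OF \<open>\<omega> \<in> space M\<close>] by (simp add: \<tau>_def l0)
    qed
    then show ?thesis by auto
  qed
  have Y: "?Y \<omega> = (\<lambda>r\<in>{0}. B t \<omega> - B s \<omega>)" for \<omega>
    by (simp add: \<tau>_def ln)
  have "(\<lambda>x. (?X x, ?Y x)) -` (PiE J A \<times> PiE {0} (\<lambda>_. C)) \<inter> space M =
      {\<omega>\<in>space M. \<forall>r\<in>J. B r \<omega> \<in> A r} \<inter> ((\<lambda>\<omega>. B t \<omega> - B s \<omega>) -` C \<inter> space M)"
    using X Y by (auto simp: restrict_PiE_iff simp del: comp_apply)
  moreover have "?X -` PiE J A \<inter> space M = {\<omega>\<in>space M. \<forall>r\<in>J. B r \<omega> \<in> A r}"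
    using X by (auto simp: restrict_PiE_iff simp del: comp_apply)
  moreover have "?Y -` PiE {0} (\<lambda>_. C) \<inter> space M = (\<lambda>\<omega>. B t \<omega> - B s \<omega>) -` C \<inter> space M"
    using Y by (auto simp: restrict_PiE_iff simp del: comp_apply)
  ultimately show ?thesis using * by simp
qed

text \<open>Finite-dimensional events form an intersection-stable generator of the past, and
  \<open>prob_finite_past_increment\<close> settles them; independence extends to the generated
  sigma-algebra.\<close>

lemma indep_history_increment:
  assumes "0 \<le> s" "s < t"
  shows "indep_set (sets (history s)) {(\<lambda>\<omega>. B t \<omega> - B s \<omega>) -` C \<inter> space M | C. C \<in> sets borel}"
proof -
  define I where "I = (\<lambda>\<omega>. B t \<omega> - B s \<omega>)"
  have I: "random_variable borel I"
    unfolding I_def using assms by (intro borel_measurable_diff measurable_time) auto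
  define P where "P = {{\<omega>\<in>space M. \<forall>r\<in>J. B r \<omega> \<in> A r} | J A. finite J \<and> J \<subseteq> {0..s} \<and> (\<forall>r. A r \<in> sets borel)}"
  define Q where "Q = {I -` C \<inter> space M | C. C \<in> sets borel}"
  have P_ev: "P \<subseteq> sets (history s)"
  proof
    fix E assume "E \<in> P"
    then obtain J A where E: "E = {\<omega>\<in>space M. \<forall>r\<in>J. B r \<omega> \<in> A r}"
      and J: "finite J" "J \<subseteq> {0..s}" "\<forall>r. A r \<in> sets borel" unfolding P_def by blast
    have "{\<omega>\<in>space (history s). \<forall>r\<in>J. B r \<omega> \<in> A r} \<in> sets (history s)"
    proof (rule sets.sets_Collect_finite_All[OF _ J(1)])
      fix r assume "r \<in> J"
      then show "{\<omega>\<in>space (history s). B r \<omega> \<in> A r} \<in> sets (history s)"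
        using J measurable_sets[OF measurable_B_history[of r s], of "A r"]
        by (auto simp: vimage_def Int_def conj_commute)
    qed
    then show "E \<in> sets (history s)" by (simp add: E)
  qed
  have "indep_set P Q"
  proof (rule indep_setI)
    show "P \<subseteq> events" using P_ev sets_history_subset by blast
    show "Q \<subseteq> events" unfolding Q_def using I by (auto intro: measurable_sets)
    fix a b assume "a \<in> P" "b \<in> Q"
    then show "prob (a \<inter> b) = prob a * prob b"
      unfolding P_def Q_def I_def using assms by (auto intro!: prob_finite_past_increment)
  qed
  moreover have "Int_stable P"
  proof (rule Int_stableI)
    fix E F assume "E \<in> P" "F \<in> P"
    then obtain J A K C where E: "E = {\<omega>\<in>space M. \<forall>r\<in>J. B r \<omega> \<in> A r}"
      and J: "finite J" "J \<subseteq> {0..s}" "\<forall>r. A r \<in> sets borel"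
      and F: "F = {\<omega>\<in>space M. \<forall>r\<in>K. B r \<omega> \<in> C r}"
      and K: "finite K" "K \<subseteq> {0..s}" "\<forall>r. C r \<in> sets borel" unfolding P_def by blast
    \<comment> \<open>A time constrained by only one of the two events gets \<open>UNIV\<close> from
      the other.\<close>
    define D where "D r = (if r \<in> J then A r else UNIV) \<inter> (if r \<in> K then C r else UNIV)" for r
    have "E \<inter> F = {\<omega>\<in>space M. \<forall>r\<in>J \<union> K. B r \<omega> \<in> D r}"
      by (auto simp: E F D_def)
    moreover have "\<forall>r. D r \<in> sets borel" using J K by (auto simp: D_def)
    ultimately show "E \<inter> F \<in> P"
      unfolding P_def using J K by (intro CollectI exI[of _ "J \<union> K"] exI[of _ D]) auto
  qed
  moreover have "Int_stable Q"
  proof (rule Int_stableI)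
    fix a b assume "a \<in> Q" "b \<in> Q"
    then obtain C D where "a = I -` C \<inter> space M" "b = I -` D \<inter> space M" "C \<in> sets borel" "D \<in> sets borel"
      unfolding Q_def by blast
    then show "a \<inter> b \<in> Q" unfolding Q_def by (intro CollectI exI[of _ "C \<inter> D"]) auto
  qed
  ultimately have ind: "indep_set (sigma_sets (space M) P) (sigma_sets (space M) Q)"
    by (rule indep_set_sigma_sets)
  have hist: "sets (history s) \<subseteq> sigma_sets (space M) P"
    unfolding sets_history
  proof (rule sigma_sets_mono, rule subsetI)
    fix E assume "E \<in> {B r -` A \<inter> space M |r A. 0 \<le> r \<and> r \<le> s \<and> A \<in> sets borel}"
    then obtain r A where E: "E = B r -` A \<inter> space M" and r: "0 \<le> r" "r \<le> s" "A \<in> sets borel" by blast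
    have "E \<in> P" unfolding P_def E using r
      by (intro CollectI exI[of _ "{r}"] exI[of _ "\<lambda>_. A"]) auto
    then show "E \<in> sigma_sets (space M) P" by (rule sigma_sets.Basic)
  qed
  show ?thesis
    unfolding I_def[symmetric]
  proof (rule indep_setI)
    show "sets (history s) \<subseteq> events" by (rule sets_history_subset)
    show "{I -` C \<inter> space M | C. C \<in> sets borel} \<subseteq> events"
      using measurable_sets[OF I] by blast
    fix a b assume "a \<in> sets (history s)" "b \<in> {I -` C \<inter> space M | C. C \<in> sets borel}"
    then show "prob (a \<inter> b) = prob a * prob b"
      using hist unfolding Q_def[symmetric] by (intro indep_setD[OF ind]) (auto intro: sigma_sets.Basic)
  qed
qed

end


section \<open>Limits of expectations under a second moment bound\<close>

text \<open>Bounded second moments give uniform integrability. By Fatou the limit is square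
  integrable; truncating at level \<open>m\<close> changes each mean by at most
  \<open>K / m\<close>; the truncated variables converge by dominated convergence; finally
  \<open>m\<close> tends to infinity.\<close>

lemma (in prob_space) integral_limit_L2_bounded:
  fixes V :: "nat \<Rightarrow> 'a \<Rightarrow> real"
  assumes V: "\<And>n. integrable M (V n)" "\<And>n. integrable M (\<lambda>\<omega>. (V n \<omega>)\<^sup>2)" "\<And>n. expectation (\<lambda>\<omega>. (V n \<omega>)\<^sup>2) \<le> K"
    and mean: "\<And>n. expectation (V n) = c"
    and lim: "\<And>\<omega>. \<omega> \<in> space M \<Longrightarrow> (\<lambda>n. V n \<omega>) \<longlonglongrightarrow> U \<omega>"
  shows "integrable M U" "expectation U = c"
proof -
  have [measurable]: "V n \<in> borel_measurable M" for n using V by auto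
  have [measurable]: "U \<in> borel_measurable M"
    by (rule borel_measurable_LIMSEQ_real[OF lim]) auto
  have K0: "0 \<le> K" using V(3)[of 0] by (rule order.trans[rotated]) simp
  have "(\<integral>\<^sup>+\<omega>. ennreal ((U \<omega>)\<^sup>2) \<partial>M) = (\<integral>\<^sup>+\<omega>. liminf (\<lambda>n. ennreal ((V n \<omega>)\<^sup>2)) \<partial>M)"
  proof (intro nn_integral_cong)
    fix \<omega> assume "\<omega> \<in> space M"
    then have "(\<lambda>n. ennreal ((V n \<omega>)\<^sup>2)) \<longlonglongrightarrow> ennreal ((U \<omega>)\<^sup>2)"
      by (intro tendsto_intros lim)
    then show "ennreal ((U \<omega>)\<^sup>2) = liminf (\<lambda>n. ennreal ((V n \<omega>)\<^sup>2))"
      using lim_imp_Liminf trivial_limit_sequentially by metis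
  qed
  also have "\<dots> \<le> liminf (\<lambda>n. \<integral>\<^sup>+\<omega>. ennreal ((V n \<omega>)\<^sup>2) \<partial>M)"
    by (rule nn_integral_liminf) simp
  also have "\<dots> \<le> liminf (\<lambda>n. ennreal K)"
    using V by (intro Liminf_mono always_eventually allI) (simp add: nn_integral_eq_integral ennreal_leI)
  also have "\<dots> < \<infinity>" by (simp add: Liminf_const)
  finally have U2: "integrable M (\<lambda>\<omega>. (U \<omega>)\<^sup>2)"
    by (intro integrableI_bounded) auto
  show U: "integrable M U"
    by (rule square_integrable_imp_integrable) (auto simp: U2)
  define clamp :: "nat \<Rightarrow> real \<Rightarrow> real" where "clamp m x = max (- real m) (min (real m) x)" for m x
  have [measurable]: "clamp m \<in> borel_measurable borel" for m unfolding clamp_def by measurable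
  have clamp_le: "\<bar>clamp m x\<bar> \<le> m" "\<bar>clamp m x\<bar> \<le> \<bar>x\<bar>" for m x by (auto simp: clamp_def)
  \<comment> \<open>The truncation error lives where \<open>\<bar>x\<bar> > m\<close>, and there
    \<open>\<bar>x\<bar> \<le> x^2 / m\<close>.\<close>
  have clamp_diff: "\<bar>x - clamp m x\<bar> \<le> x\<^sup>2 / m" if "0 < m" for m x
  proof (cases "\<bar>x\<bar> \<le> m")
    case False
    have "\<bar>x - clamp m x\<bar> \<le> \<bar>x\<bar>" using that by (auto simp: clamp_def)
    also have "\<dots> * m \<le> \<bar>x\<bar> * \<bar>x\<bar>" using False by (intro mult_left_mono) auto
    finally show ?thesis using that by (simp add: field_simps power2_eq_square mult_right_mono)
  qed (auto simp: clamp_def)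
  have int_clamp: "integrable M (\<lambda>\<omega>. clamp m (f \<omega>))" if [measurable]: "f \<in> borel_measurable M" for m f
    by (rule integrable_const_bound[of _ "real m"]) (auto simp: clamp_le)
  have 1: "\<bar>c - expectation (\<lambda>\<omega>. clamp m (U \<omega>))\<bar> \<le> K / m" if m: "0 < m" for m
  proof (rule tendsto_upperbound)
    show "(\<lambda>n. \<bar>c - expectation (\<lambda>\<omega>. clamp m (V n \<omega>))\<bar>) \<longlonglongrightarrow> \<bar>c - expectation (\<lambda>\<omega>. clamp m (U \<omega>))\<bar>"
    proof (intro tendsto_intros integral_dominated_convergence[where w = "\<lambda>_. real m"] AE_I2)
      fix \<omega> assume "\<omega> \<in> space M"
      then show "(\<lambda>n. clamp m (V n \<omega>)) \<longlonglongrightarrow> clamp m (U \<omega>)"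
        unfolding clamp_def by (intro tendsto_intros lim)
    qed (auto simp: clamp_le)
    have "\<bar>c - expectation (\<lambda>\<omega>. clamp m (V n \<omega>))\<bar> \<le> K / m" for n
    proof -
      have "\<bar>c - expectation (\<lambda>\<omega>. clamp m (V n \<omega>))\<bar> = \<bar>expectation (\<lambda>\<omega>. V n \<omega> - clamp m (V n \<omega>))\<bar>"
        using V mean by (simp add: int_clamp)
      also have "\<dots> \<le> expectation (\<lambda>\<omega>. \<bar>V n \<omega> - clamp m (V n \<omega>)\<bar>)"
        by (rule integral_abs_bound)
      also have "\<dots> \<le> expectation (\<lambda>\<omega>. (V n \<omega>)\<^sup>2 / m)"
        using V m clamp_diff by (intro integral_mono) (auto intro!: int_clamp integrable_abs)
      also have "\<dots> \<le> K / m" using V m by (simp add: divide_right_mono)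
      finally show ?thesis .
    qed
    then show "\<forall>\<^sub>F n in sequentially. \<bar>c - expectation (\<lambda>\<omega>. clamp m (V n \<omega>))\<bar> \<le> K / m" by simp
  qed simp
  have 2: "(\<lambda>m. expectation (\<lambda>\<omega>. clamp m (U \<omega>))) \<longlonglongrightarrow> expectation U"
  proof (intro integral_dominated_convergence[where w = "\<lambda>\<omega>. \<bar>U \<omega>\<bar>"] AE_I2)
    fix \<omega>
    obtain m0 :: nat where "\<bar>U \<omega>\<bar> \<le> m0" using real_arch_simple by blast
    then have "clamp m (U \<omega>) = U \<omega>" if "m0 \<le> m" for m using that by (auto simp: clamp_def)
    then show "(\<lambda>m. clamp m (U \<omega>)) \<longlonglongrightarrow> U \<omega>"
      by (intro tendsto_eventually) (auto simp: eventually_sequentially)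
  qed (auto simp: clamp_le U)
  have "\<bar>c - expectation U\<bar> \<le> 0"
  proof (rule tendsto_le[OF trivial_limit_sequentially])
    show "(\<lambda>m. \<bar>c - expectation (\<lambda>\<omega>. clamp m (U \<omega>))\<bar>) \<longlonglongrightarrow> \<bar>c - expectation U\<bar>"
      by (intro tendsto_intros 2)
    show "(\<lambda>m. K / real m) \<longlonglongrightarrow> 0" by (rule lim_const_over_n)
    show "\<forall>\<^sub>F m in sequentially. \<bar>c - expectation (\<lambda>\<omega>. clamp m (U \<omega>))\<bar> \<le> K / real m"
      using eventually_gt_at_top[of 0] by eventually_elim (rule 1)
  qed
  then show "expectation U = c" by simp
qed

lemma borel_measurable_caloric:
  assumes "caloric F"
  shows "F t \<in> borel_measurable borel"
proof (rule borel_measurable_continuous_onI)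
  show "continuous_on UNIV (F t)"
    using continuous_on_compose2[OF caloric_continuous[OF assms], of UNIV "\<lambda>z. (t, z)"]
    by (auto simp: continuous_intros)
qed

section \<open>The martingale property and stopping on a grid\<close>

context standard_planar_brownian_motion
begin

lemma distr_increment:
  assumes "0 \<le> s" "s < t"
  shows "distr M borel (\<lambda>\<omega>. B t \<omega> - B s \<omega>) = planar_gaussian (t - s)"
proof -
  have "distr M borel (\<lambda>\<omega>. B t \<omega> - B s \<omega>) = distr M lborel (\<lambda>\<omega>. B t \<omega> - B s \<omega>)"
    by (rule distr_cong) auto
  also have "\<dots> = planar_gaussian (t - s)"
    using distributed_distr_eq_density[OF gaussian_increments[OF assms]] assms
    by (simp add: planar_gaussian_eq_density)
  finally show ?thesis .
qed

lemma measurable_increment [measurable]: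
  "0 \<le> s \<Longrightarrow> s \<le> t \<Longrightarrow> (\<lambda>\<omega>. B t \<omega> - B s \<omega>) \<in> measurable M borel"
  by (intro borel_measurable_diff measurable_time) auto

lemma integrable_caloric_increment:
  assumes F: "caloric F" and "0 \<le> s" "s \<le> t"
  shows "integrable M (\<lambda>\<omega>. F (t - s) (z + sqrt 2 *\<^sub>R (B t \<omega> - B s \<omega>)))"
proof (cases "s = t")
  case False
  then have "integrable (distr M borel (\<lambda>\<omega>. B t \<omega> - B s \<omega>)) (\<lambda>w. F (0 + (t - s)) (z + sqrt 2 *\<^sub>R w))"
    using caloric_mean_value[OF F, of "t - s" 0 z] assms distr_increment[of s t]
    by (auto simp: has_bochner_integral_iff)
  then show ?thesis
    using assms borel_measurable_caloric[OF F] by (subst (asm) integrable_distr_eq) auto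
qed simp

text \<open>The martingale property on an event of the past up to \<open>u\<close>. The process
  restarts at time \<open>s\<close> from an arbitrary \<open>z\<close>, which covers the whole path
  as well as its displacement after a late time. The increment from \<open>u\<close> to
  \<open>v\<close> is independent of everything else, and integrating it out first is the mean value
  property with step \<open>v - u\<close>.\<close>

lemma caloric_conserved:
  assumes F: "caloric F" and "0 \<le> s" "s \<le> u" "u < v" and A: "A \<in> sets (history u)"
  shows "expectation (\<lambda>\<omega>. indicator A \<omega> * F (v - s) (z + sqrt 2 *\<^sub>R (B v \<omega> - B s \<omega>))) =
    expectation (\<lambda>\<omega>. indicator A \<omega> * F (u - s) (z + sqrt 2 *\<^sub>R (B u \<omega> - B s \<omega>)))"
proof -
  define Y where "Y = (\<lambda>\<omega>. (indicator A \<omega> :: real, z + sqrt 2 *\<^sub>R (B u \<omega> - B s \<omega>)))"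
  \<comment> \<open>The zero pads the increment so that it has the same type as \<open>Y\<close>, as
    \<open>indep_var\<close> demands.\<close>
  define D where "D = (\<lambda>\<omega>. (0 :: real, B v \<omega> - B u \<omega>))"
  define g where "g = (\<lambda>(y :: real \<times> real \<times> real) (w :: real \<times> real \<times> real).
    fst y * F (v - s) (snd y + sqrt 2 *\<^sub>R snd w))"
  note [measurable] = borel_measurable_caloric[OF F]
  have Bh: "B u \<in> measurable (history u) borel" "B s \<in> measurable (history u) borel"
    using assms by (auto intro!: measurable_B_history)
  have Y: "Y \<in> measurable (history u) (borel \<Otimes>\<^sub>M borel)"
    unfolding Y_def using A Bh by (intro measurable_Pair borel_measurable_indicator) simp_all
  have I: "random_variable borel (\<lambda>\<omega>. B v \<omega> - B u \<omega>)"
    using assms by (intro measurable_increment) auto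
  have D: "random_variable (borel \<Otimes>\<^sub>M borel) D" unfolding D_def using I by measurable
  note Y' = measurable_from_history[OF Y]
  have "indep_var (borel \<Otimes>\<^sub>M borel) Y (borel \<Otimes>\<^sub>M borel) D"
    unfolding indep_var_eq
  proof (intro conjI Y' D indep_setI)
    let ?Q = "{(\<lambda>\<omega>. B v \<omega> - B u \<omega>) -` C \<inter> space M | C. C \<in> sets borel}"
    \<comment> \<open>Preimages of a sigma-algebra already form a sigma-algebra, so its generated
      events are plain preimages.\<close>
    have vimage: "sigma_sets (space M) {f -` A \<inter> space M | A. A \<in> sets (borel \<Otimes>\<^sub>M borel)} =
        {f -` A \<inter> space M | A. A \<in> sets (borel \<Otimes>\<^sub>M borel)}" for f :: "'w \<Rightarrow> real \<times> real \<times> real"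
      using sets_vimage_algebra2[of f "space M" "borel \<Otimes>\<^sub>M borel"]
      by (simp add: sets_vimage_algebra space_pair_measure)
    show "sigma_sets (space M) {Y -` A \<inter> space M | A. A \<in> sets (borel \<Otimes>\<^sub>M borel)} \<subseteq> events"
      unfolding vimage using measurable_sets[OF Y'] by blast
    show "sigma_sets (space M) {D -` A \<inter> space M | A. A \<in> sets (borel \<Otimes>\<^sub>M borel)} \<subseteq> events"
      unfolding vimage using measurable_sets[OF D] by blast
    fix a b assume "a \<in> sigma_sets (space M) {Y -` A \<inter> space M | A. A \<in> sets (borel \<Otimes>\<^sub>M borel)}"
      "b \<in> sigma_sets (space M) {D -` A \<inter> space M | A. A \<in> sets (borel \<Otimes>\<^sub>M borel)}"
    then obtain C1 C2 where a: "a = Y -` C1 \<inter> space M" and b: "b = D -` C2 \<inter> space M"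
      and C: "C1 \<in> sets (borel \<Otimes>\<^sub>M borel)" "C2 \<in> sets (borel \<Otimes>\<^sub>M borel)"
      unfolding vimage by blast
    show "prob (a \<inter> b) = prob a * prob b"
    proof (rule indep_setD[OF indep_history_increment])
      show "0 \<le> u" "u < v" using assms by auto
      show "a \<in> sets (history u)" unfolding a using measurable_sets[OF Y C(1)] by simp
      have "Pair 0 -` C2 \<in> sets borel" using C(2) by (rule sets_Pair1)
      moreover have "b = (\<lambda>\<omega>. B v \<omega> - B u \<omega>) -` (Pair 0 -` C2) \<inter> space M"
        by (auto simp: b D_def)
      ultimately show "b \<in> ?Q" by blast
    qed
  qed
  then have prod: "distr M (borel \<Otimes>\<^sub>M borel) Y \<Otimes>\<^sub>M distr M (borel \<Otimes>\<^sub>M borel) D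
      = distr M ((borel \<Otimes>\<^sub>M borel) \<Otimes>\<^sub>M (borel \<Otimes>\<^sub>M borel)) (\<lambda>\<omega>. (Y \<omega>, D \<omega>))"
    using indep_var_distribution_eq by blast
  have gY: "g (Y \<omega>) (D \<omega>) = indicator A \<omega> * F (v - s) (z + sqrt 2 *\<^sub>R (B v \<omega> - B s \<omega>))" for \<omega>
    by (simp add: g_def Y_def D_def algebra_simps)
  have gm: "case_prod g \<in> borel_measurable ((borel \<Otimes>\<^sub>M borel) \<Otimes>\<^sub>M (borel \<Otimes>\<^sub>M borel))"
    unfolding g_def by measurable
  have AM: "A \<in> events" using A sets_history_subset by blast
  interpret PY: prob_space "distr M (borel \<Otimes>\<^sub>M borel) Y" using Y' by (rule prob_space_distr)
  interpret PD: prob_space "distr M (borel \<Otimes>\<^sub>M borel) D" using D by (rule prob_space_distr)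
  interpret P: pair_prob_space "distr M (borel \<Otimes>\<^sub>M borel) Y" "distr M (borel \<Otimes>\<^sub>M borel) D" ..
  have "integrable M (\<lambda>\<omega>. g (Y \<omega>) (D \<omega>))"
    unfolding gY using integrable_mult_indicator[OF AM integrable_caloric_increment[OF F, of s v z]] assms by simp
  then have int: "integrable (distr M (borel \<Otimes>\<^sub>M borel) Y \<Otimes>\<^sub>M distr M (borel \<Otimes>\<^sub>M borel) D) (case_prod g)"
    unfolding prod using Y' D gm by (subst integrable_distr_eq) auto
  have "expectation (\<lambda>\<omega>. g (Y \<omega>) (D \<omega>)) = integral\<^sup>L (distr M (borel \<Otimes>\<^sub>M borel) Y \<Otimes>\<^sub>M distr M (borel \<Otimes>\<^sub>M borel) D) (case_prod g)"
    unfolding prod using Y' D gm by (subst integral_distr) auto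
  also have "\<dots> = (\<integral>y. (\<integral>w. g y w \<partial>distr M (borel \<Otimes>\<^sub>M borel) D) \<partial>distr M (borel \<Otimes>\<^sub>M borel) Y)"
    using P.integral_fst[OF int] by simp
  also have "\<dots> = (\<integral>y. fst y * F (u - s) (snd y) \<partial>distr M (borel \<Otimes>\<^sub>M borel) Y)"
  proof -
    have "(\<integral>w. g y w \<partial>distr M (borel \<Otimes>\<^sub>M borel) D) = fst y * F (u - s) (snd y)" for y
    proof -
      have "(\<integral>w. g y w \<partial>distr M (borel \<Otimes>\<^sub>M borel) D) = expectation (\<lambda>\<omega>. g y (D \<omega>))"
        using D by (intro integral_distr) (auto simp: g_def)
      also have "\<dots> = (\<integral>w. fst y * F (v - s) (snd y + sqrt 2 *\<^sub>R w) \<partial>distr M borel (\<lambda>\<omega>. B v \<omega> - B u \<omega>))"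
        using I by (subst integral_distr) (auto simp: g_def D_def)
      also have "\<dots> = fst y * F (u - s) (snd y)"
        using caloric_mean_value[OF F, of "v - u" "u - s" "snd y"] assms
        by (subst distr_increment) (auto simp: has_bochner_integral_iff)
      finally show ?thesis .
    qed
    then show ?thesis by simp
  qed
  also have "\<dots> = expectation (\<lambda>\<omega>. indicator A \<omega> * F (u - s) (z + sqrt 2 *\<^sub>R (B u \<omega> - B s \<omega>)))"
    using Y' by (subst integral_distr) (auto simp: Y_def)
  finally show ?thesis unfolding gY .
qed

text \<open>\<open>E k\<close> plays the event of not having stopped by step \<open>k\<close>. As
  these events decrease, \<open>J n\<close> is the smaller of \<open>n\<close> and the first failing
  index. Hence \<open>V (Suc n) - V n\<close> is a martingale increment restricted to
  \<open>E n\<close>, and its mean vanishes by \<open>caloric_conserved\<close>.\<close>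

lemma discrete_optional_stopping:
  fixes E :: "nat \<Rightarrow> 'w set" and z :: "real \<times> real"
  assumes F: "caloric F" and "0 \<le> s" "0 < \<delta>"
    and E: "\<And>k. E k \<in> sets (history (s + k * \<delta>))" "\<And>k. E (Suc k) \<subseteq> E k"
  defines "J \<equiv> \<lambda>n \<omega>. card {k. k < n \<and> \<omega> \<in> E k}"
  defines "V \<equiv> \<lambda>n \<omega>. indicator (E 0) \<omega> *
    F (real (J n \<omega>) * \<delta>) (z + sqrt 2 *\<^sub>R (B (s + real (J n \<omega>) * \<delta>) \<omega> - B s \<omega>))"
  shows "integrable M (V n) \<and> expectation (V n) = prob (E 0) * F 0 z"
proof (induction n)
  case 0
  have "E 0 \<in> events" using E(1)[of 0] sets_history_subset by auto
  then have "integrable M (indicat_real (E 0))"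
    by (intro integrable_real_indicator) (auto simp: emeasure_eq_measure)
  then show ?case using \<open>E 0 \<in> events\<close> by (simp add: V_def J_def)
next
  case (Suc n)
  define g where "g k \<omega> = F (real k * \<delta>) (z + sqrt 2 *\<^sub>R (B (s + real k * \<delta>) \<omega> - B s \<omega>))" for k \<omega>
  have E_ev: "E k \<in> events" for k using E(1)[of k] sets_history_subset by blast
  have g: "integrable M (\<lambda>\<omega>. indicator (E n) \<omega> * g k \<omega>)" for k
    using integrable_mult_indicator[OF E_ev integrable_caloric_increment[OF F, of s "s + real k * \<delta>" z]] assms(2,3)
    by (simp add: g_def)
  have step: "V (Suc n) \<omega> = V n \<omega> + (indicator (E n) \<omega> * g (Suc n) \<omega> - indicator (E n) \<omega> * g n \<omega>)" for \<omega>
  proof (cases "\<omega> \<in> E n")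
    case True
    have "\<omega> \<in> E k" if "k \<le> n" for k
      using decseqD[OF decseq_SucI[of E] that] E(2) True by auto
    then have "{k. k < n \<and> \<omega> \<in> E k} = {..<n}" "{k. k < Suc n \<and> \<omega> \<in> E k} = {..<Suc n}" "\<omega> \<in> E 0"
      by auto
    then show ?thesis using True by (simp add: V_def J_def g_def)
  next
    case False
    then have "{k. k < Suc n \<and> \<omega> \<in> E k} = {k. k < n \<and> \<omega> \<in> E k}" using less_Suc_eq by auto
    then show ?thesis using False by (simp add: V_def J_def)
  qed
  have "expectation (\<lambda>\<omega>. indicator (E n) \<omega> * g (Suc n) \<omega>) = expectation (\<lambda>\<omega>. indicator (E n) \<omega> * g n \<omega>)"
    using caloric_conserved[OF F, of s "s + real n * \<delta>" "s + real (Suc n) * \<delta>" "E n" z] E(1)[of n] assms(2,3)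
    by (simp add: g_def)
  then show ?case
    unfolding step[abs_def] using Suc g by simp
qed


section \<open>Survival events and the capped exit time\<close>

text \<open>The time interval is closed, so for open \<open>D\<close> and \<open>t \<ge> 0\<close>
  this is the event that the exit time exceeds \<open>t\<close>. For negative \<open>t\<close> it is
  the whole space.\<close>

definition survives :: "(real \<times> real) set \<Rightarrow> real \<times> real \<Rightarrow> real \<Rightarrow> 'w set" where
  "survives D p t = {\<omega>\<in>space M. \<forall>r\<in>{0..t}. brownian_from B p r \<omega> \<in> D}"

text \<open>The exit time capped at \<open>T\<close>, as a real number. Inserting \<open>T\<close>
  keeps the set nonempty, so that the real infimum is meaningful also on paths that never leave
  \<open>D\<close>.\<close>

definition stop :: "(real \<times> real) set \<Rightarrow> real \<times> real \<Rightarrow> real \<Rightarrow> 'w \<Rightarrow> real" where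
  "stop D p T \<omega> = Inf (insert T {t. 0 \<le> t \<and> brownian_from B p t \<omega> \<notin> D})"

lemma continuous_on_brownian_from:
  "\<omega> \<in> space M \<Longrightarrow> continuous_on {0..} (\<lambda>t. brownian_from B p t \<omega>)"
  unfolding brownian_from_def by (intro continuous_intros continuous_paths)

text \<open>Reduction to countably many times: over a compact interval a path inside the open set
  \<open>D\<close> keeps a positive distance from the complement, and conversely a closed condition
  at a dense set of times holds at all times. Only times up to \<open>t\<close> are inspected, so
  the event belongs to the past up to \<open>t\<close> itself.\<close>

lemma survives_history:
  assumes D: "open D" and "0 \<le> t"
  shows "survives D p t \<in> sets (history t)"
proof -
  obtain Q where Q: "countable Q" "Q \<subseteq> {0..t}" "{0..t} \<subseteq> closure Q"
    using separable[of "{0..t}"] by blast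
  define K where "K n = {x. \<forall>y\<in>-D. 1 / Suc n \<le> dist x y}" for n
  have K: "closed (K n)" for n
  proof -
    have "K n = (\<Inter>y\<in>-D. {x. 1 / Suc n \<le> dist x y})" unfolding K_def by auto
    also have "closed \<dots>" by (intro closed_INT ballI closed_Collect_le continuous_intros)
    finally show ?thesis .
  qed
  have "survives D p t = {\<omega>\<in>space (history t). \<exists>n. \<forall>q\<in>Q. brownian_from B p q \<omega> \<in> K n}"
  proof (intro set_eqI iffI)
    fix \<omega> assume "\<omega> \<in> survives D p t"
    then have \<omega>: "\<omega> \<in> space M" and in_D: "(\<lambda>r. brownian_from B p r \<omega>) ` {0..t} \<subseteq> D"
      by (auto simp: survives_def)
    have "compact ((\<lambda>r. brownian_from B p r \<omega>) ` {0..t})"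
      by (intro compact_continuous_image continuous_on_subset[OF continuous_on_brownian_from[OF \<omega>]]) auto
    moreover have "closed (- D)" using D by (simp add: closed_def)
    moreover have "(\<lambda>r. brownian_from B p r \<omega>) ` {0..t} \<inter> - D = {}" using in_D by blast
    ultimately obtain d where
      d: "0 < d" "\<And>x y. x \<in> (\<lambda>r. brownian_from B p r \<omega>) ` {0..t} \<Longrightarrow> y \<in> -D \<Longrightarrow> d \<le> dist x y"
      by (metis separate_compact_closed)
    obtain n where "1 / Suc n < d" using d(1) nat_approx_posE by blast
    have "\<forall>q\<in>Q. brownian_from B p q \<omega> \<in> K n"
    proof
      fix q assume "q \<in> Q"
      then have "d \<le> dist (brownian_from B p q \<omega>) y" if "y \<in> -D" for y
        using d(2)[OF _ that] Q(2) by blast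
      then show "brownian_from B p q \<omega> \<in> K n"
        unfolding K_def using \<open>1 / Suc n < d\<close> by (smt (verit) mem_Collect_eq)
    qed
    then show "\<omega> \<in> {\<omega>\<in>space (history t). \<exists>n. \<forall>q\<in>Q. brownian_from B p q \<omega> \<in> K n}"
      using \<omega> by auto
  next
    fix \<omega> assume "\<omega> \<in> {\<omega>\<in>space (history t). \<exists>n. \<forall>q\<in>Q. brownian_from B p q \<omega> \<in> K n}"
    then obtain n where \<omega>: "\<omega> \<in> space M" and n: "(\<lambda>q. brownian_from B p q \<omega>) ` Q \<subseteq> K n" by auto
    have "closure Q \<subseteq> {0..t}" using Q(2) by (intro closure_minimal) auto
    then have cl: "closure Q \<subseteq> {0..}" by auto
    have "(\<lambda>q. brownian_from B p q \<omega>) ` closure Q \<subseteq> K n"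
      by (rule image_closure_subset[OF continuous_on_subset[OF continuous_on_brownian_from[OF \<omega>] cl] K n])
    moreover have "K n \<subseteq> D" unfolding K_def by force
    ultimately show "\<omega> \<in> survives D p t" using Q(3) \<omega> unfolding survives_def by blast
  qed
  also have "\<dots> \<in> sets (history t)"
  proof (intro sets.sets_Collect_countable_Ex sets.sets_Collect_countable_All' Q(1))
    fix n q assume "q \<in> Q"
    then have "B q \<in> measurable (history t) borel"
      using Q(2) by (intro measurable_B_history) auto
    then have "(\<lambda>\<omega>. brownian_from B p q \<omega>) \<in> measurable (history t) borel"
      unfolding brownian_from_def by simp
    from measurable_sets[OF this borel_closed[OF K]]
    show "{\<omega> \<in> space (history t). brownian_from B p q \<omega> \<in> K n} \<in> sets (history t)"
      by (simp add: vimage_def Int_def conj_commute)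
  qed
  finally show ?thesis .
qed

lemma survives_events: "open D \<Longrightarrow> 0 \<le> t \<Longrightarrow> survives D p t \<in> events"
  using survives_history sets_history_subset by blast

lemma stop_le: "stop D p T \<omega> \<le> T" if "0 \<le> T"
  unfolding stop_def by (rule cInf_lower) (auto intro!: bdd_belowI[of _ 0] that)

lemma stop_nonneg: "0 \<le> stop D p T \<omega>" if "0 \<le> T"
  unfolding stop_def by (rule cInf_greatest) (auto intro: that)

lemma inside_before_stop:
  assumes "0 \<le> r" "r < stop D p T \<omega>" "0 \<le> T"
  shows "brownian_from B p r \<omega> \<in> D"
proof (rule ccontr)
  assume "brownian_from B p r \<omega> \<notin> D"
  then have "stop D p T \<omega> \<le> r"
    unfolding stop_def using assms by (intro cInf_lower) (auto intro!: bdd_belowI[of _ 0])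
  with assms show False by simp
qed

text \<open>For open \<open>D\<close> the times spent outside \<open>D\<close> form a closed set, so
  the infimum is attained.\<close>

lemma outside_at_stop:
  assumes "open D" "\<omega> \<in> space M" "0 \<le> T" "stop D p T \<omega> < T"
  shows "brownian_from B p (stop D p T \<omega>) \<omega> \<notin> D"
proof -
  let ?E = "{t. 0 \<le> t \<and> brownian_from B p t \<omega> \<notin> D}"
  have "closed ({0..} \<inter> (\<lambda>t. brownian_from B p t \<omega>) -` (- D))"
    using assms by (intro continuous_closed_preimage continuous_on_brownian_from) (auto simp: closed_def)
  moreover have "{0..} \<inter> (\<lambda>t. brownian_from B p t \<omega>) -` (- D) = ?E" by auto
  ultimately have "closed (insert T ?E)" by simp
  then have "stop D p T \<omega> \<in> insert T ?E"
    unfolding stop_def using assms(3) by (intro closed_contains_Inf) (auto intro!: bdd_belowI[of _ 0])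
  then show ?thesis using assms(4) by auto
qed

text \<open>If the capped exit time were at most \<open>t < T\<close>, it would be a true exit time
  within \<open>{0..t}\<close>.\<close>

lemma survives_iff_less_stop:
  assumes "open D" "\<omega> \<in> space M" "0 \<le> t" "t < T"
  shows "\<omega> \<in> survives D p t \<longleftrightarrow> t < stop D p T \<omega>"
proof
  assume s: "\<omega> \<in> survives D p t"
  show "t < stop D p T \<omega>"
  proof (rule ccontr)
    assume *: "\<not> t < stop D p T \<omega>"
    then have "brownian_from B p (stop D p T \<omega>) \<omega> \<notin> D"
      using assms by (intro outside_at_stop) auto
    moreover have "stop D p T \<omega> \<in> {0..t}" using * stop_nonneg[of T D p \<omega>] assms by auto
    ultimately show False using s by (auto simp: survives_def)
  qed
next
  assume "t < stop D p T \<omega>"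
  then show "\<omega> \<in> survives D p t"
    unfolding survives_def using assms inside_before_stop[of _ D p T \<omega>] by auto
qed

lemma stop_eq_if_survives:
  assumes "\<omega> \<in> survives D p T" "0 \<le> T"
  shows "stop D p T \<omega> = T"
proof (rule antisym[OF stop_le[OF assms(2)]])
  show "T \<le> stop D p T \<omega>"
    unfolding stop_def using assms by (intro cInf_greatest) (auto simp: survives_def intro: linear)
qed

lemma survives_antimono: "s \<le> t \<Longrightarrow> survives D p t \<subseteq> survives D p s"
  by (auto simp: survives_def)

text \<open>Counting the grid points before \<tau> rounds \<tau> up to the grid. This count is the
  form in which \<open>discrete_optional_stopping\<close> delivers the stopping index.\<close>

lemma card_grid:
  fixes \<tau> :: real
  assumes "0 < \<delta>" "s \<le> \<tau>" "\<tau> \<le> s + real N * \<delta>"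
  shows "\<bar>s + real (card {k. k < N \<and> s + real k * \<delta> < \<tau>}) * \<delta> - \<tau>\<bar> \<le> \<delta>"
proof -
  define m where "m = (LEAST m. \<tau> \<le> s + real m * \<delta>)"
  have m: "\<tau> \<le> s + real m * \<delta>" and le: "m \<le> N"
    using assms(3) unfolding m_def by (auto intro: LeastI Least_le)
  have less: "s + real k * \<delta> < \<tau>" if "k < m" for k
    using not_less_Least[of k] that unfolding m_def by (meson not_le)
  have "\<not> s + real k * \<delta> < \<tau>" if "m \<le> k" for k
  proof -
    have "real m * \<delta> \<le> real k * \<delta>" using that assms(1) by (intro mult_right_mono) auto
    with m show ?thesis by simp
  qed
  then have "{k. k < N \<and> s + real k * \<delta> < \<tau>} = {..<m}"
    using less le by (auto simp: not_le[symmetric])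
  moreover have "s + real m * \<delta> \<le> \<tau> + \<delta>"
  proof (cases m)
    case (Suc j)
    then show ?thesis using less[of j] by (simp add: algebra_simps)
  qed (use assms in auto)
  ultimately show ?thesis using m by simp
qed

text \<open>The discrete version applies to the exit time rounded up to a grid, which is then
  refined. Continuity gives convergence along each path, and the caloric function dominating the
  square of \<open>F\<close> gives the uniform second moment that lets the means converge.\<close>

theorem optional_stopping:
  fixes p z :: "real \<times> real"
  assumes F: "caloric F" and D: "open D" and sT: "0 \<le> s" "s \<le> T"
  defines "U \<equiv> \<lambda>\<omega>. indicator (survives D p s) \<omega> *
    F (stop D p T \<omega> - s) (z + sqrt 2 *\<^sub>R (B (stop D p T \<omega>) \<omega> - B s \<omega>))"
  shows "integrable M U" "expectation U = prob (survives D p s) * F 0 z"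
proof -
  have "integrable M U \<and> expectation U = prob (survives D p s) * F 0 z"
  proof (cases "s = T")
    \<comment> \<open>The mesh used below would be zero here; on survivors nothing moves after
      \<open>s\<close>.\<close>
    case True
    have "U = (\<lambda>\<omega>. indicator (survives D p s) \<omega> * F 0 z)"
      using sT True stop_eq_if_survives[of _ D p s] by (auto simp: U_def indicator_def fun_eq_iff)
    moreover have "integrable M (indicat_real (survives D p s))"
      using survives_events[OF D sT(1)] by (intro integrable_real_indicator) (auto simp: emeasure_eq_measure)
    ultimately show ?thesis using survives_events[OF D sT(1)] by simp
  next
    case False
    define \<delta> where "\<delta> n = (T - s) / Suc n" for n
    have \<delta>: "0 < \<delta> n" "real (Suc n) * \<delta> n = T - s" for n
      using sT False by (auto simp: \<delta>_def field_simps)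
    define E where "E n k = survives D p (s + real k * \<delta> n)" for n k
    define J where "J n \<omega> = card {k. k < Suc n \<and> \<omega> \<in> E n k}" for n \<omega>
    \<comment> \<open>Kept general in \<open>H\<close>: it is used for \<open>F\<close> and for the
      function \<open>G\<close> dominating its square.\<close>
    define W where "W H n \<omega> = indicator (E n 0) \<omega> *
      H (real (J n \<omega>) * \<delta> n) (z + sqrt 2 *\<^sub>R (B (s + real (J n \<omega>) * \<delta> n) \<omega> - B s \<omega>))"
      for H :: "real \<Rightarrow> real \<times> real \<Rightarrow> real" and n \<omega>
    have ost: "integrable M (W H n) \<and> expectation (W H n) = prob (E n 0) * H 0 z" if "caloric H" for H n
      unfolding W_def[abs_def] J_def
    proof (rule discrete_optional_stopping[OF that sT(1) \<delta>(1)])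
      show "E n k \<in> sets (history (s + real k * \<delta> n))" for k
        unfolding E_def using sT \<delta>(1)[of n] by (intro survives_history D add_nonneg_nonneg) auto
      show "E n (Suc k) \<subseteq> E n k" for k
        unfolding E_def using \<delta>(1)[of n] by (intro survives_antimono) (simp add: algebra_simps)
    qed
    have E0: "E n 0 = survives D p s" for n by (simp add: E_def)
    obtain G where G: "caloric G" "\<And>t z. 0 \<le> G t z"
      and FG: "\<And>t z. 0 \<le> t \<Longrightarrow> t \<le> T - s \<Longrightarrow> (F t z)\<^sup>2 \<le> G t z"
      using caloric_square_le[OF F, of "T - s"] by blast
    have J_le: "real (J n \<omega>) * \<delta> n \<le> T - s" for n \<omega>
    proof -
      have "J n \<omega> \<le> card {..<Suc n}" unfolding J_def by (intro card_mono) auto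
      then have "real (J n \<omega>) * \<delta> n \<le> real (Suc n) * \<delta> n"
        using \<delta>(1)[of n] by (intro mult_right_mono) auto
      then show ?thesis using \<delta>(2) by simp
    qed
    have sq: "(W F n \<omega>)\<^sup>2 \<le> W G n \<omega>" for n \<omega>
      unfolding W_def using \<delta>(1)[of n] J_le[of n \<omega>] by (auto simp: indicator_def intro!: FG)
    have W2: "integrable M (\<lambda>\<omega>. (W F n \<omega>)\<^sup>2)" for n
    proof (rule Bochner_Integration.integrable_bound)
      show "integrable M (W G n)" using ost[OF G(1)] by blast
      have "W F n \<in> borel_measurable M" using ost[OF F] by blast
      then show "(\<lambda>\<omega>. (W F n \<omega>)\<^sup>2) \<in> borel_measurable M" by simp
      show "AE \<omega> in M. norm ((W F n \<omega>)\<^sup>2) \<le> norm (W G n \<omega>)"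
        using order.trans[OF sq abs_ge_self] by (intro AE_I2) simp
    qed
    \<comment> \<open>The mean of \<open>W G n\<close> is conserved, so the bound does not depend on
      the grid.\<close>
    have W2_le: "expectation (\<lambda>\<omega>. (W F n \<omega>)\<^sup>2) \<le> G 0 z" for n
    proof -
      have "expectation (\<lambda>\<omega>. (W F n \<omega>)\<^sup>2) \<le> expectation (W G n)"
        using W2 ost[OF G(1)] sq by (intro integral_mono) auto
      also have "\<dots> \<le> 1 * G 0 z"
        using ost[OF G(1)] G(2) by (simp add: mult_left_le_one_le)
      finally show ?thesis by simp
    qed
    have lim: "(\<lambda>n. W F n \<omega>) \<longlonglongrightarrow> U \<omega>" if \<omega>: "\<omega> \<in> space M" for \<omega>
    proof (cases "\<omega> \<in> survives D p s")
      case False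
      then show ?thesis by (simp add: W_def U_def E0)
    next
      case True
      let ?\<tau> = "stop D p T \<omega>"
      have s\<tau>: "s < ?\<tau>" using True \<omega> D sT False survives_iff_less_stop by (meson order.not_eq_order_implies_strict assms \<open>s \<noteq> T\<close>)
      have J: "J n \<omega> = card {k. k < Suc n \<and> s + real k * \<delta> n < ?\<tau>}" for n
      proof -
        have "\<omega> \<in> E n k \<longleftrightarrow> s + real k * \<delta> n < ?\<tau>" if "k < Suc n" for k
          unfolding E_def
        proof (rule survives_iff_less_stop[OF D \<omega>])
          have "real k * \<delta> n < real (Suc n) * \<delta> n"
            using that \<delta>(1)[of n] by (intro mult_strict_right_mono) auto
          then show "s + real k * \<delta> n < T" using \<delta>(2)[of n] by simp
        qed (use sT \<delta>(1)[of n] in auto)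
        then show ?thesis unfolding J_def by (intro arg_cong[where f = card]) blast
      qed
      have close: "\<bar>s + real (J n \<omega>) * \<delta> n - ?\<tau>\<bar> \<le> \<delta> n" for n
        unfolding J using s\<tau> \<delta>[of n] stop_le[of T D p \<omega>] sT by (intro card_grid) auto
      have \<delta>0: "\<delta> \<longlonglongrightarrow> 0" unfolding \<delta>_def by (rule LIMSEQ_Suc[OF lim_const_over_n])
      have "(\<lambda>n. s + real (J n \<omega>) * \<delta> n - ?\<tau>) \<longlonglongrightarrow> 0"
        by (rule tendsto_rabs_zero_cancel, rule tendsto_sandwich[OF _ _ tendsto_const \<delta>0])
           (auto simp: close)
      then have conv: "(\<lambda>n. s + real (J n \<omega>) * \<delta> n) \<longlonglongrightarrow> ?\<tau>" by (simp add: LIM_zero_iff)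
      have B_conv: "(\<lambda>n. B (s + real (J n \<omega>) * \<delta> n) \<omega>) \<longlonglongrightarrow> B ?\<tau> \<omega>"
        using \<delta>(1) sT s\<tau>
        by (intro continuous_on_tendsto_compose[OF continuous_paths[OF \<omega>] conv] always_eventually)
           (auto intro!: add_nonneg_nonneg mult_nonneg_nonneg intro: less_imp_le)
      have conv': "(\<lambda>n. real (J n \<omega>) * \<delta> n) \<longlonglongrightarrow> ?\<tau> - s"
        using tendsto_diff[OF conv tendsto_const[of s]] by simp
      have "(\<lambda>n. (\<lambda>(t, z). F t z) (real (J n \<omega>) * \<delta> n, z + sqrt 2 *\<^sub>R (B (s + real (J n \<omega>) * \<delta> n) \<omega> - B s \<omega>)))
        \<longlonglongrightarrow> (\<lambda>(t, z). F t z) (?\<tau> - s, z + sqrt 2 *\<^sub>R (B ?\<tau> \<omega> - B s \<omega>))"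
        by (rule continuous_on_tendsto_compose[OF caloric_continuous[OF F]])
           (auto intro!: tendsto_intros conv' B_conv)
      then show ?thesis using True by (simp add: W_def U_def E0)
    qed
    show ?thesis
    proof
      have W: "integrable M (W F n)" "expectation (W F n) = prob (survives D p s) * F 0 z" for n
        using ost[OF F, of n] E0 by auto
      show "integrable M U" "expectation U = prob (survives D p s) * F 0 z"
        by (rule integral_limit_L2_bounded[OF W(1) W2 W2_le W(2) lim]; assumption)+
    qed
  qed
  then show "integrable M U" "expectation U = prob (survives D p s) * F 0 z" by auto
qed


section \<open>Exit time moments as limits of capped moments\<close>

lemma brownian_from_0: "\<omega> \<in> space M \<Longrightarrow> brownian_from B p 0 \<omega> = p"
  by (simp add: brownian_from_def start)

lemma survives_0: "p \<in> D \<Longrightarrow> survives D p 0 = space M"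
  by (auto simp: survives_def brownian_from_0)

lemma measurable_stop:
  assumes D: "open D" and T: "0 \<le> T"
  shows "stop D p T \<in> borel_measurable M"
  unfolding borel_measurable_iff_greater
proof
  fix a
  consider "a < 0" | "0 \<le> a" "a < T" | "T \<le> a" by linarith
  then show "{\<omega> \<in> space M. a < stop D p T \<omega>} \<in> events"
  proof cases
    case 1
    then have "{\<omega> \<in> space M. a < stop D p T \<omega>} = space M"
      using stop_nonneg[OF T, of D p] by (auto intro: less_le_trans)
    then show ?thesis by simp
  next
    case 2
    have "survives D p a \<subseteq> space M" by (auto simp: survives_def)
    then have "{\<omega> \<in> space M. a < stop D p T \<omega>} = survives D p a"
      using survives_iff_less_stop[OF D _ 2, of _ p] by blast
    then show ?thesis using survives_events[OF D] 2 by simp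
  next
    case 3
    then have "{\<omega> \<in> space M. a < stop D p T \<omega>} = {}"
      using stop_le[OF T, of D p] by (auto simp: not_less intro: order.trans)
    then show ?thesis by (simp only: sets.empty_sets)
  qed
qed

text \<open>The bridge between the extended exit time of the statement and the real capped one of
  the proof.\<close>

lemma min_exit_time:
  assumes D: "open D" and \<omega>: "\<omega> \<in> space M" and T: "0 \<le> T"
  shows "min (exit_time D (brownian_from B p) \<omega>) (ennreal T) = ennreal (stop D p T \<omega>)"
proof (rule antisym)
  show "ennreal (stop D p T \<omega>) \<le> min (exit_time D (brownian_from B p) \<omega>) (ennreal T)"
  proof (rule min.boundedI)
    show "ennreal (stop D p T \<omega>) \<le> exit_time D (brownian_from B p) \<omega>"
      unfolding exit_time_def
    proof (rule Inf_greatest)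
      fix e assume "e \<in> {ennreal t |t. 0 \<le> t \<and> brownian_from B p t \<omega> \<notin> D}"
      then obtain t where t: "e = ennreal t" "0 \<le> t" "brownian_from B p t \<omega> \<notin> D" by blast
      then have "stop D p T \<omega> \<le> t" using inside_before_stop[of t D p T \<omega>] T by (meson not_le)
      then show "ennreal (stop D p T \<omega>) \<le> e" using t by (simp add: ennreal_leI)
    qed
  qed (simp add: ennreal_leI stop_le T)
  show "min (exit_time D (brownian_from B p) \<omega>) (ennreal T) \<le> ennreal (stop D p T \<omega>)"
  proof (cases "stop D p T \<omega> < T")
    case True
    then have "exit_time D (brownian_from B p) \<omega> \<le> ennreal (stop D p T \<omega>)"
      unfolding exit_time_def using outside_at_stop[OF D \<omega> T] stop_nonneg[OF T]
      by (intro Inf_lower) blast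
    then show ?thesis by (rule min.coboundedI1)
  next
    case False
    then have "stop D p T \<omega> = T" using stop_le[OF T, of D p \<omega>] by simp
    then show ?thesis by simp
  qed
qed

lemma tendsto_min_power_ennreal:
  fixes e :: ennreal
  assumes "1 \<le> k"
  shows "(\<lambda>n. min e (ennreal (real n)) ^ k) \<longlonglongrightarrow> e ^ k"
proof (cases e)
  case (real r)
  obtain m :: nat where "r \<le> m" using real_arch_simple by blast
  then have "min e (ennreal (real n)) = e" if "m \<le> n" for n
    using real that by (intro min.absorb1) (simp add: ennreal_leI)
  then show ?thesis by (intro tendsto_eventually) (auto simp: eventually_sequentially intro!: exI[of _ m])
next
  case top
  have "(\<lambda>n. ennreal (real n) ^ k) \<longlonglongrightarrow> top"
  proof (rule tendsto_sandwich[OF _ _ _ tendsto_const])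
    show "(\<lambda>n. ennreal (real n)) \<longlonglongrightarrow> top"
      using of_nat_tendsto_top_ennreal by (simp add: ennreal_of_nat_eq_real_of_nat)
    show "\<forall>\<^sub>F n in sequentially. ennreal (real n) \<le> ennreal (real n) ^ k"
      using eventually_ge_at_top[of 1]
    proof eventually_elim
      case (elim n)
      have "real n ^ 1 \<le> real n ^ k" using elim assms by (intro power_increasing) auto
      then show ?case by (simp add: ennreal_power ennreal_leI)
    qed
  qed simp
  then show ?thesis using top assms by (simp add: power_0_left ennreal_top_eq_mult_iff top_power_ennreal)
qed

text \<open>Monotone convergence in the cap. No finiteness is assumed, so the limit also decides
  whether the moment is finite.\<close>

lemma exit_moment_limit:
  assumes D: "open D" and k: "1 \<le> k"
  shows "(\<lambda>n. ennreal (expectation (\<lambda>\<omega>. stop D p (real n) \<omega> ^ k))) \<longlonglongrightarrow> exit_moment M B D k p"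
proof -
  note [measurable] = measurable_stop[OF D]
  have int: "integrable M (\<lambda>\<omega>. stop D p (real n) \<omega> ^ k)" for n
    using stop_nonneg[of "real n" D p] stop_le[of "real n" D p]
    by (intro integrable_const_bound[of _ "real n ^ k"]) (auto simp: power_mono)
  have eq: "(\<integral>\<^sup>+\<omega>. ennreal (stop D p (real n) \<omega>) ^ k \<partial>M) = ennreal (expectation (\<lambda>\<omega>. stop D p (real n) \<omega> ^ k))" for n
    using int stop_nonneg[of "real n" D p] by (subst nn_integral_eq_integral[symmetric]) (auto simp: ennreal_power)
  have "(\<lambda>n. \<integral>\<^sup>+\<omega>. ennreal (stop D p (real n) \<omega>) ^ k \<partial>M) \<longlonglongrightarrow> (\<integral>\<^sup>+\<omega>. exit_time D (brownian_from B p) \<omega> ^ k \<partial>M)"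
  proof -
    have "(\<lambda>n. \<integral>\<^sup>+\<omega>. (min (exit_time D (brownian_from B p) \<omega>) (ennreal (real n))) ^ k * indicator (space M) \<omega> \<partial>M)
      \<longlonglongrightarrow> (\<integral>\<^sup>+\<omega>. exit_time D (brownian_from B p) \<omega> ^ k * indicator (space M) \<omega> \<partial>M)"
    proof (rule nn_integral_LIMSEQ)
      show "incseq (\<lambda>n \<omega>. (min (exit_time D (brownian_from B p) \<omega>) (ennreal (real n))) ^ k * indicator (space M) \<omega>)"
        by (auto simp: incseq_def le_fun_def indicator_def intro!: power_mono min.mono ennreal_leI)
      show "(\<lambda>\<omega>. (min (exit_time D (brownian_from B p) \<omega>) (ennreal (real n))) ^ k * indicator (space M) \<omega>) \<in> borel_measurable M" for n
      proof -
        have "(\<lambda>\<omega>. ennreal (stop D p (real n) \<omega>) ^ k) \<in> borel_measurable M" by measurable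
        then show ?thesis
          by (rule measurable_cong[THEN iffD1, rotated]) (simp add: min_exit_time[OF D])
      qed
      show "(\<lambda>n. (min (exit_time D (brownian_from B p) \<omega>) (ennreal (real n))) ^ k * indicator (space M) \<omega>)
          \<longlonglongrightarrow> exit_time D (brownian_from B p) \<omega> ^ k * indicator (space M) \<omega>" for \<omega>
        using tendsto_min_power_ennreal[OF k] by (cases "\<omega> \<in> space M") auto
    qed
    moreover have "(\<integral>\<^sup>+\<omega>. (min (exit_time D (brownian_from B p) \<omega>) (ennreal (real n))) ^ k * indicator (space M) \<omega> \<partial>M)
        = (\<integral>\<^sup>+\<omega>. ennreal (stop D p (real n) \<omega>) ^ k \<partial>M)" for n
      by (intro nn_integral_cong) (simp add: min_exit_time[OF D])
    moreover have "(\<integral>\<^sup>+\<omega>. exit_time D (brownian_from B p) \<omega> ^ k * indicator (space M) \<omega> \<partial>M)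
        = (\<integral>\<^sup>+\<omega>. exit_time D (brownian_from B p) \<omega> ^ k \<partial>M)"
      by (intro nn_integral_cong) simp
    ultimately show ?thesis by simp
  qed
  then show ?thesis unfolding eq exit_moment_def .
qed

lemma stop_in_closure:
  assumes D: "open D" and \<omega>: "\<omega> \<in> space M" and T: "0 \<le> T" and p: "p \<in> D"
  shows "brownian_from B p (stop D p T \<omega>) \<omega> \<in> closure D"
proof (cases "stop D p T \<omega> = 0")
  case True
  then show ?thesis using brownian_from_0[OF \<omega>] p closure_subset by auto
next
  case False
  then have pos: "0 < stop D p T \<omega>" using stop_nonneg[OF T, of D p \<omega>] by simp
  have cl: "closure {0..<stop D p T \<omega>} = {0..stop D p T \<omega>}" using pos by simp
  have "(\<lambda>t. brownian_from B p t \<omega>) ` closure {0..<stop D p T \<omega>} \<subseteq> closure D"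
  proof (rule image_closure_subset)
    show "continuous_on (closure {0..<stop D p T \<omega>}) (\<lambda>t. brownian_from B p t \<omega>)"
      unfolding cl by (rule continuous_on_subset[OF continuous_on_brownian_from[OF \<omega>]]) auto
    show "(\<lambda>t. brownian_from B p t \<omega>) ` {0..<stop D p T \<omega>} \<subseteq> closure D"
    proof (intro subsetI, elim imageE)
      fix x t assume "x = brownian_from B p t \<omega>" "t \<in> {0..<stop D p T \<omega>}"
      then have "x \<in> D" using inside_before_stop[of t D p T \<omega>] T by simp
      then show "x \<in> closure D" using closure_subset by blast
    qed
  qed simp
  then show ?thesis unfolding cl using pos by (simp add: image_subset_iff)
qed

text \<open>A path that exits by time \<open>T\<close> is stopped in the closure of \<open>D\<close>
  but outside \<open>D\<close>, where \<open>u\<close> vanishes; only paths surviving to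
  \<open>T\<close> contribute.\<close>

lemma vanishing_at_stop:
  fixes u :: "real \<times> real \<Rightarrow> real"
  assumes D: "open D" and \<omega>: "\<omega> \<in> space M" and T: "0 \<le> T" and p: "p \<in> D"
    and u: "\<And>z. z \<in> closure D \<Longrightarrow> z \<notin> D \<Longrightarrow> u z = 0"
  shows "u (brownian_from B p (stop D p T \<omega>) \<omega>) = indicator (survives D p T) \<omega> * u (brownian_from B p T \<omega>)"
proof (cases "\<omega> \<in> survives D p T")
  case True
  then show ?thesis using stop_eq_if_survives[OF True T] by simp
next
  case False
  have "brownian_from B p (stop D p T \<omega>) \<omega> \<notin> D"
  proof
    assume *: "brownian_from B p (stop D p T \<omega>) \<omega> \<in> D"
    then have "stop D p T \<omega> = T"
      using outside_at_stop[OF D \<omega> T] stop_le[OF T, of D p \<omega>] by (meson antisym not_le)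
    then have "\<omega> \<in> survives D p T"
      unfolding survives_def using * inside_before_stop[of _ D p T \<omega>] T \<omega>
      by (auto simp: le_less)
    with False show False by simp
  qed
  then show ?thesis using u[OF stop_in_closure[OF D \<omega> T p]] False by simp
qed

text \<open>Optional stopping with \<open>s = 0\<close> and \<open>z = p\<close>, rewritten in terms
  of the path itself.\<close>

lemma expectation_at_stop:
  fixes u :: "real \<times> real \<Rightarrow> real"
  assumes D: "open D" and T: "0 \<le> T" and p: "p \<in> D" and F: "caloric F"
  shows "integrable M (\<lambda>\<omega>. F (stop D p T \<omega>) (brownian_from B p (stop D p T \<omega>) \<omega>))"
    and "expectation (\<lambda>\<omega>. F (stop D p T \<omega>) (brownian_from B p (stop D p T \<omega>) \<omega>)) = F 0 p"
proof -
  let ?f = "\<lambda>\<omega>. indicator (survives D p 0) \<omega> *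
    F (stop D p T \<omega> - 0) (p + sqrt 2 *\<^sub>R (B (stop D p T \<omega>) \<omega> - B 0 \<omega>))"
  let ?g = "\<lambda>\<omega>. F (stop D p T \<omega>) (brownian_from B p (stop D p T \<omega>) \<omega>)"
  have eq: "?f \<omega> = ?g \<omega>" if "\<omega> \<in> space M" for \<omega>
    using that by (simp add: survives_0[OF p] start brownian_from_def)
  have f: "integrable M ?f" "expectation ?f = prob (survives D p 0) * F 0 p"
    using optional_stopping[OF F D order.refl T] by auto
  show "integrable M ?g"
    by (rule iffD1[OF Bochner_Integration.integrable_cong[OF refl eq] f(1)])
  have "expectation ?g = expectation ?f"
    by (rule Bochner_Integration.integral_cong[OF refl]) (simp only: eq)
  then show "expectation ?g = F 0 p"
    using f(2) by (simp add: survives_0[OF p] prob_space)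
qed

text \<open>A Burkholder type bound, to be applied to either coordinate. With \<theta> the time
  elapsed after \<open>s\<close>, the mean of
  \<open>d^4 - 12 * \<theta> * d^2 + 12 * \<theta>^2\<close> over survivors is zero, and half of the
  fourth power absorbs the cross term.\<close>

lemma fourth_moment_after:
  fixes c :: "real \<times> real \<Rightarrow> real" and p :: "real \<times> real"
  assumes D: "open D" and sT: "0 \<le> s" "s \<le> T"
    and caloric2: "caloric (\<lambda>t z. (c z)^2 - 2 * t)"
    and caloric4: "caloric (\<lambda>t z. (c z)^4 - 12 * t * (c z)^2 + 12 * t^2)"
    and c0: "c 0 = 0"
  defines "d \<equiv> \<lambda>\<omega>. c (sqrt 2 *\<^sub>R (B (stop D p T \<omega>) \<omega> - B s \<omega>))"
  shows "integrable M (\<lambda>\<omega>. indicator (survives D p s) \<omega> * d \<omega> ^ 4)"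
    and "expectation (\<lambda>\<omega>. indicator (survives D p s) \<omega> * d \<omega> ^ 4) \<le>
      120 * expectation (\<lambda>\<omega>. indicator (survives D p s) \<omega> * (stop D p T \<omega> - s)^2)"
proof -
  define i where "i = indicat_real (survives D p s)"
  define \<theta> where "\<theta> = (\<lambda>\<omega>. stop D p T \<omega> - s)"
  have T: "0 \<le> T" using sT by simp
  have [measurable]: "\<theta> \<in> borel_measurable M" unfolding \<theta>_def using measurable_stop[OF D T] by simp
  have [measurable]: "i \<in> borel_measurable M" unfolding i_def using survives_events[OF D sT(1)] by simp
  have \<theta>_le: "\<bar>\<theta> \<omega>\<bar> \<le> T" for \<omega>
    unfolding \<theta>_def using stop_nonneg[OF T, of D p \<omega>] stop_le[OF T, of D p \<omega>] sT by auto
  have i_le: "\<bar>i \<omega>\<bar> \<le> 1" for \<omega> by (simp add: i_def)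
  have i\<theta>: "integrable M (\<lambda>\<omega>. i \<omega> * \<theta> \<omega> ^ k)" for k
    using mult_mono[OF i_le power_mono[OF \<theta>_le]] T
    by (intro integrable_const_bound[of _ "1 * T ^ k"]) (auto simp: abs_mult power_abs)
  \<comment> \<open>The second power comes first: since \<theta> is bounded, its integrability
    carries over to the cross term, and that of the fourth power follows from there.\<close>
  have 2: "integrable M (\<lambda>\<omega>. i \<omega> * (d \<omega> ^ 2 - 2 * \<theta> \<omega>))"
    using optional_stopping(1)[OF caloric2 D sT, of p 0] by (simp add: i_def d_def \<theta>_def)
  have 4: "integrable M (\<lambda>\<omega>. i \<omega> * (d \<omega> ^ 4 - 12 * \<theta> \<omega> * d \<omega> ^ 2 + 12 * \<theta> \<omega> ^ 2))"
    "expectation (\<lambda>\<omega>. i \<omega> * (d \<omega> ^ 4 - 12 * \<theta> \<omega> * d \<omega> ^ 2 + 12 * \<theta> \<omega> ^ 2)) = 0"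
    using optional_stopping[OF caloric4 D sT, of p 0] c0 by (simp_all add: i_def d_def \<theta>_def)
  have d2: "integrable M (\<lambda>\<omega>. i \<omega> * d \<omega> ^ 2)"
    using Bochner_Integration.integrable_add[OF 2 integrable_mult_right[OF i\<theta>[of 1], of 2]] by (simp add: algebra_simps)
  have \<theta>d2: "integrable M (\<lambda>\<omega>. \<theta> \<omega> * (i \<omega> * d \<omega> ^ 2))"
  proof (rule Bochner_Integration.integrable_bound)
    show "integrable M (\<lambda>\<omega>. T * (i \<omega> * d \<omega> ^ 2))" using d2 by simp
    show "AE \<omega> in M. norm (\<theta> \<omega> * (i \<omega> * d \<omega> ^ 2)) \<le> norm (T * (i \<omega> * d \<omega> ^ 2))"
      using \<theta>_le T by (auto simp: abs_mult intro!: AE_I2 mult_right_mono)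
    show "(\<lambda>\<omega>. \<theta> \<omega> * (i \<omega> * d \<omega> ^ 2)) \<in> borel_measurable M"
      by (rule borel_measurable_times[OF _ borel_measurable_integrable[OF d2]]) measurable
  qed
  have "integrable M (\<lambda>\<omega>. i \<omega> * (d \<omega> ^ 4 - 12 * \<theta> \<omega> * d \<omega> ^ 2 + 12 * \<theta> \<omega> ^ 2) + 12 * (\<theta> \<omega> * (i \<omega> * d \<omega> ^ 2)) - 12 * (i \<omega> * \<theta> \<omega> ^ 2))"
    by (intro Bochner_Integration.integrable_add Bochner_Integration.integrable_diff integrable_mult_right 4 \<theta>d2 i\<theta>)
  then have d4: "integrable M (\<lambda>\<omega>. i \<omega> * d \<omega> ^ 4)"
    by (simp add: algebra_simps)
  then show "integrable M (\<lambda>\<omega>. indicator (survives D p s) \<omega> * d \<omega> ^ 4)" by (simp add: i_def)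
  have "0 = expectation (\<lambda>\<omega>. i \<omega> * d \<omega> ^ 4 - 12 * (\<theta> \<omega> * (i \<omega> * d \<omega> ^ 2)) + 12 * (i \<omega> * \<theta> \<omega> ^ 2))"
    unfolding 4(2)[symmetric] by (simp add: algebra_simps)
  also have "\<dots> \<ge> expectation (\<lambda>\<omega>. (1/2) * (i \<omega> * d \<omega> ^ 4) - 60 * (i \<omega> * \<theta> \<omega> ^ 2))"
  proof (intro integral_mono Bochner_Integration.integrable_add Bochner_Integration.integrable_diff integrable_mult_right d4 \<theta>d2 i\<theta>)
    fix \<omega>
    \<comment> \<open>Expanding the square gives
      \<open>12 * \<theta> * d^2 \<le> d^4 / 2 + 72 * \<theta>^2\<close>; the
      \<open>12 * \<theta>^2\<close> already present leaves \<open>60\<close>, and doubling gives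
      \<open>120\<close>.\<close>
    have "0 \<le> i \<omega> * (d \<omega> ^ 2 - 12 * \<theta> \<omega>) ^ 2" by (simp add: i_def)
    then show "(1/2) * (i \<omega> * d \<omega> ^ 4) - 60 * (i \<omega> * \<theta> \<omega> ^ 2) \<le>
        i \<omega> * d \<omega> ^ 4 - 12 * (\<theta> \<omega> * (i \<omega> * d \<omega> ^ 2)) + 12 * (i \<omega> * \<theta> \<omega> ^ 2)"
      by (simp add: power2_diff power_mult_distrib algebra_simps)
  qed
  also have "expectation (\<lambda>\<omega>. (1/2) * (i \<omega> * d \<omega> ^ 4) - 60 * (i \<omega> * \<theta> \<omega> ^ 2))
      = (1/2) * expectation (\<lambda>\<omega>. i \<omega> * d \<omega> ^ 4) - 60 * expectation (\<lambda>\<omega>. i \<omega> * \<theta> \<omega> ^ 2)"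
    using d4 i\<theta>[of 2] by simp
  finally have "expectation (\<lambda>\<omega>. i \<omega> * d \<omega> ^ 4) \<le> 120 * expectation (\<lambda>\<omega>. i \<omega> * \<theta> \<omega> ^ 2)" by simp
  then show "expectation (\<lambda>\<omega>. indicator (survives D p s) \<omega> * d \<omega> ^ 4) \<le>
      120 * expectation (\<lambda>\<omega>. indicator (survives D p s) \<omega> * (stop D p T \<omega> - s)^2)"
    by (simp add: i_def \<theta>_def)
qed

end


section \<open>Heat polynomials\<close>

text \<open>Monic Hermite polynomials scaled to variance \<open>2 * t\<close>: the probabilists'
  recurrence with \<open>n\<close> replaced by \<open>2 * t * n\<close>.\<close>

fun heat_poly :: "nat \<Rightarrow> real \<Rightarrow> real \<Rightarrow> real" where
  "heat_poly 0 t x = 1"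
| "heat_poly (Suc 0) t x = x"
| "heat_poly (Suc (Suc n)) t x = x * heat_poly (Suc n) t x - 2 * t * real (Suc n) * heat_poly n t x"

lemma heat_poly_simps:
  "heat_poly 1 t x = x"
  "heat_poly 2 t x = x^2 - 2 * t"
  "heat_poly 3 t x = x^3 - 6 * t * x"
  "heat_poly 4 t x = x^4 - 12 * t * x^2 + 12 * t^2"
  "heat_poly 5 t x = x^5 - 20 * t * x^3 + 60 * t^2 * x"
  by (simp_all add: eval_nat_numeral algebra_simps)

lemma caloric1_heat_poly:
  assumes "n \<le> 5"
  shows "caloric1 (heat_poly n)"
proof -
  have "n \<in> {0, 1, 2, 3, 4, 5}" using assms by auto
  then show ?thesis
  proof (elim insertE)
    assume "n = 0" then show ?thesis by (intro caloric1_quintic[of _ 1 0 0 0 0 0]) simp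
  next
    assume "n = 1" then show ?thesis by (intro caloric1_quintic[of _ 0 1 0 0 0 0]) simp
  next
    assume "n = 2" then show ?thesis by (intro caloric1_quintic[of _ 0 0 1 0 0 0]) (simp add: heat_poly_simps)
  next
    assume "n = 3" then show ?thesis by (intro caloric1_quintic[of _ 0 0 0 1 0 0]) (simp add: heat_poly_simps)
  next
    assume "n = 4" then show ?thesis by (intro caloric1_quintic[of _ 0 0 0 0 1 0]) (simp add: heat_poly_simps)
  next
    assume "n = 5" then show ?thesis by (intro caloric1_quintic[of _ 0 0 0 0 0 1]) (simp add: heat_poly_simps)
  qed auto
qed

lemma caloric_heat_poly_sum:
  assumes "\<forall>(a, i, j)\<in>set l. i \<le> 5 \<and> j \<le> 5"
  shows "caloric (\<lambda>t z. \<Sum>(a, i, j)\<leftarrow>l. a * (heat_poly i t (fst z) * heat_poly j t (snd z)))"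
  using assms
proof (induction l)
  case Nil
  show ?case using caloric_cmult[OF caloric_mult[OF caloric1_heat_poly[of 0] caloric1_heat_poly[of 0]], of 0] by simp
next
  case (Cons q l)
  obtain a i j where q: "q = (a, i, j)" by (cases q)
  have "caloric (\<lambda>t z. a * (heat_poly i t (fst z) * heat_poly j t (snd z)))"
    using Cons.prems q by (intro caloric_cmult caloric_mult caloric1_heat_poly) auto
  from caloric_add[OF this Cons.IH] show ?case using Cons.prems q by simp
qed

text \<open>Heat polynomials are monomials at \<open>t = 0\<close>, so the list can only be the
  coefficient list of \<open>F 0\<close>, and being caloric becomes a polynomial identity to
  check.\<close>

lemma caloric_polynomial:
  assumes "\<And>t x y. F t (x, y) = (\<Sum>(a, i, j)\<leftarrow>l. a * (heat_poly i t x * heat_poly j t y))"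
    and "\<forall>(a, i, j)\<in>set l. i \<le> 5 \<and> j \<le> 5"
  shows "caloric F"
proof -
  have "F = (\<lambda>t z. \<Sum>(a, i, j)\<leftarrow>l. a * (heat_poly i t (fst z) * heat_poly j t (snd z)))"
    by (intro ext) (metis assms(1) prod.collapse)
  then show ?thesis using caloric_heat_poly_sum[OF assms(2)] by simp
qed

lemma caloric_coordinates:
  "caloric (\<lambda>t z. (fst z)^2 - 2 * t)" "caloric (\<lambda>t z. (fst z)^4 - 12 * t * (fst z)^2 + 12 * t^2)"
  "caloric (\<lambda>t z. (snd z)^2 - 2 * t)" "caloric (\<lambda>t z. (snd z)^4 - 12 * t * (snd z)^2 + 12 * t^2)"
  using caloric_polynomial[of "\<lambda>t z. (fst z)^2 - 2 * t" "[(1, 2, 0)]"]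
    caloric_polynomial[of "\<lambda>t z. (fst z)^4 - 12 * t * (fst z)^2 + 12 * t^2" "[(1, 4, 0)]"]
    caloric_polynomial[of "\<lambda>t z. (snd z)^2 - 2 * t" "[(1, 0, 2)]"]
    caloric_polynomial[of "\<lambda>t z. (snd z)^4 - 12 * t * (snd z)^2 + 12 * t^2" "[(1, 0, 4)]"]
  by (simp_all add: heat_poly_simps)

text \<open>At \<open>t = c\<close> the expression collapses to the pure fourth power; taking
  \<open>c = s\<close> makes the fourth power of the path at time \<open>s\<close>
  integrable.\<close>

lemma caloric_fourth_powers:
  "caloric (\<lambda>t z. ((fst z)^4 - 12 * t * (fst z)^2 + 12 * t^2) + 12 * c * ((fst z)^2 - 2 * t) + 12 * c^2)"
  "caloric (\<lambda>t z. ((snd z)^4 - 12 * t * (snd z)^2 + 12 * t^2) + 12 * c * ((snd z)^2 - 2 * t) + 12 * c^2)"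
  by (rule caloric_polynomial[of _ "[(1, 4, 0), (12 * c, 2, 0), (12 * c^2, 0, 0)]"], simp_all add: heat_poly_simps)
     (rule caloric_polynomial[of _ "[(1, 0, 4), (12 * c, 0, 2), (12 * c^2, 0, 0)]"], simp_all add: heat_poly_simps)

context standard_planar_brownian_motion
begin

lemma integrable_fourth_powers:
  assumes "0 \<le> s"
  shows "integrable M (\<lambda>\<omega>. fst (brownian_from B p s \<omega>) ^ 4)"
    and "integrable M (\<lambda>\<omega>. snd (brownian_from B p s \<omega>) ^ 4)"
proof -
  have eq: "p + sqrt 2 *\<^sub>R (B s \<omega> - B 0 \<omega>) = brownian_from B p s \<omega>" if "\<omega> \<in> space M" for \<omega>
    using that by (simp add: brownian_from_def start)
  have id: "(a^4 - 12 * s * a^2 + 12 * s^2) + 12 * s * (a^2 - 2 * s) + 12 * s^2 = a^4" for a :: real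
    by (simp add: algebra_simps power2_eq_square)
  have "integrable M (\<lambda>\<omega>. fst (p + sqrt 2 *\<^sub>R (B s \<omega> - B 0 \<omega>)) ^ 4)"
    using integrable_caloric_increment[OF caloric_fourth_powers(1)[of s] order.refl assms, of p] by (simp add: id)
  then show "integrable M (\<lambda>\<omega>. fst (brownian_from B p s \<omega>) ^ 4)"
    by (rule iffD1[OF Bochner_Integration.integrable_cong[OF refl], rotated]) (simp only: eq)
  have "integrable M (\<lambda>\<omega>. snd (p + sqrt 2 *\<^sub>R (B s \<omega> - B 0 \<omega>)) ^ 4)"
    using integrable_caloric_increment[OF caloric_fourth_powers(2)[of s] order.refl assms, of p] by (simp add: id)
  then show "integrable M (\<lambda>\<omega>. snd (brownian_from B p s \<omega>) ^ 4)"
    by (rule iffD1[OF Bochner_Integration.integrable_cong[OF refl], rotated]) (simp only: eq)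
qed

lemma stop_eq_if_not_survives:
  assumes "open D" "\<omega> \<in> space M" "\<omega> \<notin> survives D p s" "0 \<le> s" "s \<le> T"
  shows "stop D p T \<omega> = stop D p s \<omega>"
proof (cases "s = T")
  case False
  then have "stop D p T \<omega> \<le> s"
    using survives_iff_less_stop[of D \<omega> s T p] assms by auto
  have "ennreal (stop D p s \<omega>) = min (exit_time D (brownian_from B p) \<omega>) (ennreal s)"
    using min_exit_time assms by simp
  also have "\<dots> = min (min (exit_time D (brownian_from B p) \<omega>) (ennreal T)) (ennreal s)"
    using assms by (simp add: min.assoc min.absorb2 ennreal_leI)
  also have "\<dots> = min (ennreal (stop D p T \<omega>)) (ennreal s)"
    using min_exit_time[of D \<omega> T p] assms by simp
  also have "\<dots> = ennreal (stop D p T \<omega>)"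
    using \<open>stop D p T \<omega> \<le> s\<close> by (simp add: min.absorb1 ennreal_leI)
  finally show ?thesis
    using stop_nonneg[of s D p \<omega>] stop_nonneg[of T D p \<omega>] assms by simp
qed simp

lemma integrable_stop_power:
  assumes "open D" "0 \<le> T" "E \<in> events"
  shows "integrable M (\<lambda>\<omega>. indicator E \<omega> * stop D p T \<omega> ^ k)" "integrable M (\<lambda>\<omega>. stop D p T \<omega> ^ k)"
proof -
  note [measurable] = measurable_stop[OF assms(1,2)]
  show "integrable M (\<lambda>\<omega>. stop D p T \<omega> ^ k)"
    using stop_nonneg[of T D p] stop_le[of T D p] assms
    by (intro integrable_const_bound[of _ "T ^ k"]) (auto simp: power_mono)
  from integrable_mult_indicator[OF assms(3) this]
  show "integrable M (\<lambda>\<omega>. indicator E \<omega> * stop D p T \<omega> ^ k)" by simp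
qed

end

lemma power4_add_le: "(a + b) ^ 4 \<le> 8 * a ^ 4 + 8 * b ^ 4" for a b :: real
proof -
  have "(a + b)^2 \<le> 2 * (a^2 + b^2)" by (smt (verit) power2_sum sum_squares_bound)
  then have "((a + b)^2)^2 \<le> (2 * (a^2 + b^2))^2" by (intro power_mono) auto
  also have "\<dots> \<le> 8 * (a^2)^2 + 8 * (b^2)^2"
    using sum_squares_bound[of "a^2" "b^2"] by (simp add: power_mult_distrib power2_sum)
  finally show ?thesis by simp
qed


section \<open>Identification of the first two moments\<close>

context standard_planar_brownian_motion
begin

lemma stop_mono:
  assumes "open D" "\<omega> \<in> space M" "0 \<le> s" "s \<le> T"
  shows "stop D p s \<omega> \<le> stop D p T \<omega>"
proof (cases "\<omega> \<in> survives D p s")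
  case True
  then have "stop D p s \<omega> = s" using assms stop_eq_if_survives by blast
  then show ?thesis using survives_iff_less_stop[of D \<omega> s T p] assms True by (cases "s = T") auto
next
  case False
  then show ?thesis using stop_eq_if_not_survives[OF assms(1,2) False assms(3,4)] by simp
qed

text \<open>Stopping at \<open>n\<close> leaves the remainder \<open>E[2 n u1 (X n) + u2 (X n); \<tau> > n]\<close>, which has to vanish
  in the limit. It is compared with \<open>E[\<tau>\<^sup>2; \<tau> > s]\<close> by bounding the increment of the
  path after time \<open>s\<close> in \<open>L\<^sup>4\<close>.\<close>

theorem exit_moments_eqI:
  fixes u1 u2 :: "real \<times> real \<Rightarrow> real" and p :: "real \<times> real"
  assumes D: "open D" and p: "p \<in> D"
    and c1: "caloric (\<lambda>t z. t + u1 z)" and c2: "caloric (\<lambda>t z. t^2 + 2 * t * u1 z + u2 z)"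
    and pos: "\<And>z. z \<in> D \<Longrightarrow> 0 \<le> u1 z" "\<And>z. z \<in> D \<Longrightarrow> 0 \<le> u2 z"
    and bd: "\<And>z. z \<in> closure D \<Longrightarrow> z \<notin> D \<Longrightarrow> u1 z = 0" "\<And>z. z \<in> closure D \<Longrightarrow> z \<notin> D \<Longrightarrow> u2 z = 0"
    and C: "\<And>z. z \<in> D \<Longrightarrow> (u1 z)^2 + u2 z \<le> C * (1 + fst z ^ 4 + snd z ^ 4)" "0 \<le> C"
  shows "exit_moment M B D 1 p = ennreal (u1 p)" "exit_moment M B D 2 p = ennreal (u2 p)"
proof -
  define S where "S n = survives D p (real n)" for n :: nat
  define \<sigma> where "\<sigma> n = stop D p (real n)" for n :: nat
  define X where "X n = brownian_from B p (real n)" for n :: nat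
  define e where "e n = expectation (\<lambda>\<omega>. \<sigma> n \<omega> ^ 2)" for n
  \<comment> \<open>What \<open>t^2 + 2 * t * u1 + u2\<close> leaves, apart from the squared time,
    on paths still alive at time \<open>n\<close>. It is nonnegative; the task is to show that its
    mean tends to zero.\<close>
  define R where "R n \<omega> = indicator (S n) \<omega> * (2 * real n * u1 (X n \<omega>) + u2 (X n \<omega>))" for n \<omega>
  have S_ev [measurable]: "S n \<in> events" for n unfolding S_def by (intro survives_events D) simp
  have S_sub: "S n \<subseteq> space M" for n using S_ev by (rule sets.sets_into_space)
  have S_anti: "S n \<subseteq> S m" if "m \<le> n" for m n unfolding S_def using that by (intro survives_antimono) simp
  have S_in: "X n \<omega> \<in> D" if "\<omega> \<in> S n" for n \<omega> using that by (auto simp: S_def X_def survives_def)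
  have \<sigma>_S: "\<sigma> n \<omega> = n" if "\<omega> \<in> S n" for n \<omega>
    using stop_eq_if_survives that by (simp add: S_def \<sigma>_def)
  have \<sigma>_not_S: "\<sigma> n \<omega> = \<sigma> m \<omega>" if "\<omega> \<in> space M" "\<omega> \<notin> S m" "m \<le> n" for m n \<omega>
    unfolding \<sigma>_def using that by (intro stop_eq_if_not_survives D) (simp_all add: S_def)
  have \<sigma>0: "0 \<le> \<sigma> n \<omega>" "\<sigma> n \<omega> \<le> n" for n \<omega> using stop_nonneg stop_le by (simp_all add: \<sigma>_def)
  have \<sigma>_mono: "\<sigma> m \<omega> \<le> \<sigma> n \<omega>" if "\<omega> \<in> space M" "m \<le> n" for m n \<omega>
    unfolding \<sigma>_def using that by (intro stop_mono D) auto
  have i\<sigma>: "integrable M (\<lambda>\<omega>. indicator (S m) \<omega> * \<sigma> n \<omega> ^ k)" "integrable M (\<lambda>\<omega>. \<sigma> n \<omega> ^ k)" for m n k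
    using integrable_stop_power[OF D _ S_ev] by (simp_all add: \<sigma>_def)
  have iS: "integrable M (indicat_real (S n))" for n
    by (intro integrable_real_indicator) (auto simp: emeasure_eq_measure)

  have u1_at: "u1 (brownian_from B p (\<sigma> n \<omega>) \<omega>) = indicator (S n) \<omega> * u1 (X n \<omega>)" if "\<omega> \<in> space M" for n \<omega>
    unfolding \<sigma>_def S_def X_def using that by (intro vanishing_at_stop D p bd) auto
  have u2_at: "u2 (brownian_from B p (\<sigma> n \<omega>) \<omega>) = indicator (S n) \<omega> * u2 (X n \<omega>)" if "\<omega> \<in> space M" for n \<omega>
    unfolding \<sigma>_def S_def X_def using that by (intro vanishing_at_stop D p bd) auto
  have first: "integrable M (\<lambda>\<omega>. indicator (S n) \<omega> * u1 (X n \<omega>))"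
    "expectation (\<sigma> n) + expectation (\<lambda>\<omega>. indicator (S n) \<omega> * u1 (X n \<omega>)) = u1 p" for n
  proof -
    have eq: "\<sigma> n \<omega> + u1 (brownian_from B p (\<sigma> n \<omega>) \<omega>) = \<sigma> n \<omega> + indicator (S n) \<omega> * u1 (X n \<omega>)" if "\<omega> \<in> space M" for \<omega>
      by (simp add: u1_at[OF that])
    note F = expectation_at_stop[OF D of_nat_0_le_iff p c1, of n, folded \<sigma>_def]
    have 1: "integrable M (\<lambda>\<omega>. \<sigma> n \<omega> + indicator (S n) \<omega> * u1 (X n \<omega>))"
      by (rule iffD1[OF Bochner_Integration.integrable_cong[OF refl eq] F(1)])
    have 2: "expectation (\<lambda>\<omega>. \<sigma> n \<omega> + indicator (S n) \<omega> * u1 (X n \<omega>)) = u1 p"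
      using F(2) Bochner_Integration.integral_cong[OF refl eq, of M] by simp
    have 3: "integrable M (\<sigma> n)" using i\<sigma>(2)[of n 1] by simp
    show 4: "integrable M (\<lambda>\<omega>. indicator (S n) \<omega> * u1 (X n \<omega>))"
      using Bochner_Integration.integrable_diff[OF 1 3] by simp
    show "expectation (\<sigma> n) + expectation (\<lambda>\<omega>. indicator (S n) \<omega> * u1 (X n \<omega>)) = u1 p"
      using 2 Bochner_Integration.integral_add[OF 3 4] by simp
  qed
  have second: "integrable M (R n)" "e n + expectation (R n) = u2 p" for n
  proof -
    have eq: "\<sigma> n \<omega> ^ 2 + 2 * \<sigma> n \<omega> * u1 (brownian_from B p (\<sigma> n \<omega>) \<omega>) + u2 (brownian_from B p (\<sigma> n \<omega>) \<omega>)
        = \<sigma> n \<omega> ^ 2 + R n \<omega>" if "\<omega> \<in> space M" for \<omega>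
      using \<sigma>_S[of \<omega> n] by (simp add: u1_at[OF that] u2_at[OF that] R_def indicator_def)
    note F = expectation_at_stop[OF D of_nat_0_le_iff p c2, of n, folded \<sigma>_def]
    have 1: "integrable M (\<lambda>\<omega>. \<sigma> n \<omega> ^ 2 + R n \<omega>)"
      by (rule iffD1[OF Bochner_Integration.integrable_cong[OF refl eq] F(1)])
    have 2: "expectation (\<lambda>\<omega>. \<sigma> n \<omega> ^ 2 + R n \<omega>) = u2 p"
      using F(2) Bochner_Integration.integral_cong[OF refl eq, of M] by simp
    show 4: "integrable M (R n)"
      using Bochner_Integration.integrable_diff[OF 1 i\<sigma>(2)[of n 2]] by simp
    show "e n + expectation (R n) = u2 p"
      using 2 Bochner_Integration.integral_add[OF i\<sigma>(2)[of n 2] 4] by (simp add: e_def)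
  qed
  have R0: "0 \<le> R n \<omega>" for n \<omega>
    unfolding R_def using S_in pos by (auto simp: indicator_def intro!: add_nonneg_nonneg)
  have ER0: "0 \<le> expectation (R n)" for n by (rule Bochner_Integration.integral_nonneg) (rule R0)
  have e_le: "e n \<le> u2 p" for n using second(2)[of n] ER0[of n] by simp
  \<comment> \<open>Dropping the remainder gives \<open>e n \<le> u2 p\<close>, so the capped second
    moments converge to a limit still to be identified.\<close>
  have "incseq e"
    unfolding incseq_def e_def using \<sigma>_mono \<sigma>0 by (auto intro!: integral_mono i\<sigma> power_mono)
  then obtain L where L: "e \<longlonglongrightarrow> L" and eL: "\<And>n. e n \<le> L"
    using incseq_convergent[of e "u2 p"] e_le by auto

  \<comment> \<open>Paths that have left by time \<open>m\<close> have the same capped exit time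
    under both caps.\<close>
  have tail: "expectation (\<lambda>\<omega>. indicator (S m) \<omega> * \<sigma> n \<omega> ^ 2) = e n - e m + real m^2 * prob (S m)" if "m \<le> n" for m n
  proof -
    have "expectation (\<lambda>\<omega>. indicator (S m) \<omega> * \<sigma> n \<omega> ^ 2)
        = expectation (\<lambda>\<omega>. \<sigma> n \<omega> ^ 2 - \<sigma> m \<omega> ^ 2 + real m^2 * indicator (S m) \<omega>)"
      using \<sigma>_S[of _ m] \<sigma>_not_S[OF _ _ that]
      by (intro Bochner_Integration.integral_cong) (auto simp: indicator_def)
    also have "\<dots> = e n - e m + real m^2 * prob (S m)"
      unfolding e_def using i\<sigma>(2) iS by simp
    finally show ?thesis .
  qed
  \<comment> \<open>A survivor to \<open>2 * m\<close> has capped times \<open>m\<close> and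
    \<open>2 * m\<close>, contributing \<open>4 * m^2 - m^2\<close>. Boundedness of \<open>e\<close>
    alone would merely keep \<open>m^2 * prob (S (2 * m))\<close> bounded; the difference at two
    caps sends it to zero.\<close>
  have double: "3 * real m^2 * prob (S (2 * m)) \<le> e (2 * m) - e m" for m
  proof -
    have "expectation (\<lambda>\<omega>. 3 * real m^2 * indicator (S (2 * m)) \<omega>) \<le> expectation (\<lambda>\<omega>. \<sigma> (2 * m) \<omega> ^ 2 - \<sigma> m \<omega> ^ 2)"
    proof (intro integral_mono integrable_mult_right iS Bochner_Integration.integrable_diff i\<sigma>)
      fix \<omega> assume \<omega>: "\<omega> \<in> space M"
      show "3 * real m^2 * indicator (S (2 * m)) \<omega> \<le> \<sigma> (2 * m) \<omega> ^ 2 - \<sigma> m \<omega> ^ 2"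
      proof (cases "\<omega> \<in> S (2 * m)")
        case True
        then have "\<omega> \<in> S m" using S_anti[of m "2 * m"] by auto
        then show ?thesis using True \<sigma>_S by (simp add: power_mult_distrib)
      next
        case False
        have "\<sigma> m \<omega> ^ 2 \<le> \<sigma> (2 * m) \<omega> ^ 2" using \<sigma>_mono[OF \<omega>] \<sigma>0 by (intro power_mono) auto
        then show ?thesis using False by simp
      qed
    qed
    then show ?thesis unfolding e_def using i\<sigma>(2) iS by simp
  qed
  \<comment> \<open>The factor \<open>4 / 3\<close> converts the \<open>3 * m^2\<close> of
    \<open>double\<close> into the \<open>(2 * m)^2\<close> that \<open>tail\<close> produces at
    \<open>2 * m\<close>.\<close>
  define \<beta> where "\<beta> m = (L - e (2 * m)) + 4 / 3 * (e (2 * m) - e m)" for m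
  have "(\<lambda>m. e (2 * m)) \<longlonglongrightarrow> L"
    using LIMSEQ_subseq_LIMSEQ[OF L, of "\<lambda>m. 2 * m"] by (simp add: strict_mono_def o_def)
  then have "\<beta> \<longlonglongrightarrow> (L - L) + 4 / 3 * (L - L)" unfolding \<beta>_def by (intro tendsto_intros L)
  then have \<beta>0: "\<beta> \<longlonglongrightarrow> 0" by simp
  have tail_le: "expectation (\<lambda>\<omega>. indicator (S (2 * m)) \<omega> * \<sigma> n \<omega> ^ 2) \<le> \<beta> m" if "2 * m \<le> n" for m n
  proof -
    define q where "q = 3 * real m ^ 2 * prob (S (2 * m))"
    have "(real (2 * m))^2 * prob (S (2 * m)) = 4 / 3 * q"
      by (simp add: q_def power_mult_distrib)
    then have "expectation (\<lambda>\<omega>. indicator (S (2 * m)) \<omega> * \<sigma> n \<omega> ^ 2) = e n - e (2 * m) + 4 / 3 * q"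
      using tail[OF that] by simp
    moreover have "q \<le> e (2 * m) - e m" using double[of m] by (simp add: q_def)
    then have "e n - e (2 * m) + 4 / 3 * q \<le> L - e (2 * m) + 4 / 3 * (e (2 * m) - e m)"
      using eL[of n] by (intro add_mono diff_right_mono mult_left_mono) auto
    ultimately show ?thesis by (simp add: \<beta>_def)
  qed

  \<comment> \<open>Chebyshev: \<open>n^2 * prob (S n)\<close> is at most \<open>u2 p\<close>, so
    almost every path leaves \<open>D\<close>.\<close>
  have AE_dies: "AE \<omega> in M. (\<lambda>n. indicat_real (S n) \<omega>) \<longlonglongrightarrow> 0"
  proof -
    have S_le: "real n^2 * prob (S n) \<le> u2 p" for n
    proof -
      have "expectation (\<lambda>\<omega>. real n^2 * indicator (S n) \<omega>) \<le> e n"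
        unfolding e_def using \<sigma>_S[of _ n]
        by (intro integral_mono integrable_mult_right iS i\<sigma>) (auto simp: indicator_def)
      then show ?thesis using e_le[of n] by simp
    qed
    have "prob (\<Inter>n. S n) \<le> u2 p / real (Suc n)" for n
    proof -
      have "prob (\<Inter>n. S n) \<le> prob (S (Suc n))" by (intro finite_measure_mono) auto
      also have "\<dots> \<le> u2 p / (real (Suc n))^2" using S_le[of "Suc n"] by (simp add: field_simps)
      also have "\<dots> \<le> u2 p / real (Suc n)"
        using pos(2)[OF p] by (intro divide_left_mono) (auto simp: power2_eq_square)
      finally show ?thesis .
    qed
    then have "prob (\<Inter>n. S n) \<le> 0"
      by (intro LIMSEQ_le_const[OF LIMSEQ_Suc[OF lim_const_over_n[of "u2 p"]]]) auto
    then have "prob (\<Inter>n. S n) = 0" using measure_nonneg[of M "\<Inter>n. S n"] by linarith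
    then have "AE \<omega> in M. \<omega> \<notin> (\<Inter>n. S n)"
      by (intro AE_not_in) (auto simp: null_sets_def emeasure_eq_measure)
    then show ?thesis
    proof eventually_elim
      case (elim \<omega>)
      then obtain m where "\<omega> \<notin> S m" by blast
      then have "indicat_real (S n) \<omega> = 0" if "m \<le> n" for n using S_anti[OF that] by (auto simp: indicator_def)
      then show ?case by (intro tendsto_eventually) (auto simp: eventually_sequentially intro!: exI[of _ m])
    qed
  qed

  \<comment> \<open>The factor \<open>8\<close> anticipates \<open>power4_add_le\<close>, which
    splits a late position into the one at an intermediate time and the displacement since
    then.\<close>
  define g where "g m \<omega> = 1 + 8 * fst (X m \<omega>) ^ 4 + 8 * snd (X m \<omega>) ^ 4" for m \<omega>
  have g: "integrable M (g m)" "\<And>\<omega>. 0 \<le> g m \<omega>" for m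
    unfolding g_def[abs_def] X_def using integrable_fourth_powers[of "real m" p] by (auto intro!: add_nonneg_nonneg)
  define \<gamma> where "\<gamma> m n = expectation (\<lambda>\<omega>. indicator (S n) \<omega> * g m \<omega>)" for m n
  have ig: "integrable M (\<lambda>\<omega>. indicator (S n) \<omega> * g m \<omega>)" for m n
    using integrable_mult_indicator[OF S_ev g(1)] by simp
  have \<gamma>0: "(\<lambda>n. \<gamma> m n) \<longlonglongrightarrow> 0" for m
  proof -
    have "(\<lambda>n. \<gamma> m n) \<longlonglongrightarrow> expectation (\<lambda>\<omega>. 0 * g m \<omega>)"
      unfolding \<gamma>_def
    proof (rule integral_dominated_convergence)
      show "integrable M (g m)" by (rule g)
      show "AE \<omega> in M. (\<lambda>n. indicator (S n) \<omega> * g m \<omega>) \<longlonglongrightarrow> 0 * g m \<omega>"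
        using AE_dies by eventually_elim (intro tendsto_intros)
      show "AE \<omega> in M. norm (indicator (S n) \<omega> * g m \<omega>) \<le> g m \<omega>" for n
        using g(2)[of m] by (intro AE_I2) (auto simp: indicator_def)
      show "(\<lambda>\<omega>. indicator (S n) \<omega> * g m \<omega>) \<in> borel_measurable M" for n using ig by (rule borel_measurable_integrable)
    qed simp
    then show ?thesis by simp
  qed

  \<comment> \<open>\<open>1920 = 2 * 8 * 120\<close>: two coordinates, the factor of
    \<open>power4_add_le\<close> and that of \<open>fourth_moment_after\<close>. The first summand
    is uniform in \<open>n\<close>, the second vanishes as \<open>n\<close> grows with
    \<open>m\<close> fixed.\<close>
  have ER_le: "expectation (R n) \<le> (1 + 1920 * C) * \<beta> m + C * \<gamma> (2 * m) n" if mn: "2 * m \<le> n" for m n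
  proof -
    define d where "d \<omega> = sqrt 2 *\<^sub>R (B (\<sigma> n \<omega>) \<omega> - B (real (2 * m)) \<omega>)" for \<omega>
    have m0: "0 \<le> real (2 * m)" "real (2 * m) \<le> real n" using mn by simp_all
    define b where "b = expectation (\<lambda>\<omega>. indicator (S (2 * m)) \<omega> * \<sigma> n \<omega> ^ 2)"
    define b' where "b' = expectation (\<lambda>\<omega>. indicator (S (2 * m)) \<omega> * (\<sigma> n \<omega> - real (2 * m)) ^ 2)"
    have b': "b' \<le> b"
      unfolding b_def b'_def
    proof (intro integral_mono)
      have "integrable M (\<lambda>\<omega>. indicator (S (2 * m)) \<omega> * \<sigma> n \<omega> ^ 2 - 2 * real (2 * m) * (indicator (S (2 * m)) \<omega> * \<sigma> n \<omega> ^ 1)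
          + (real (2 * m))^2 * indicator (S (2 * m)) \<omega>)"
        by (intro Bochner_Integration.integrable_add Bochner_Integration.integrable_diff integrable_mult_right i\<sigma> iS)
      then show "integrable M (\<lambda>\<omega>. indicator (S (2 * m)) \<omega> * (\<sigma> n \<omega> - real (2 * m)) ^ 2)"
        by (simp add: power2_diff algebra_simps)
      show "indicator (S (2 * m)) \<omega> * (\<sigma> n \<omega> - real (2 * m)) ^ 2 \<le> indicator (S (2 * m)) \<omega> * \<sigma> n \<omega> ^ 2"
        if "\<omega> \<in> space M" for \<omega>
        using \<sigma>_mono[OF that mn] \<sigma>_S[of \<omega> "2 * m"] by (auto simp: indicator_def intro!: power_mono)
    qed (rule i\<sigma>)
    note f1 = fourth_moment_after[OF D m0, of fst p] and f2 = fourth_moment_after[OF D m0, of snd p]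
    have d1: "integrable M (\<lambda>\<omega>. indicator (S (2 * m)) \<omega> * fst (d \<omega>) ^ 4)"
      "expectation (\<lambda>\<omega>. indicator (S (2 * m)) \<omega> * fst (d \<omega>) ^ 4) \<le> 120 * b'"
      using f1[OF caloric_coordinates(1,2)] unfolding d_def \<sigma>_def S_def b'_def by simp_all
    have d2: "integrable M (\<lambda>\<omega>. indicator (S (2 * m)) \<omega> * snd (d \<omega>) ^ 4)"
      "expectation (\<lambda>\<omega>. indicator (S (2 * m)) \<omega> * snd (d \<omega>) ^ 4) \<le> 120 * b'"
      using f2[OF caloric_coordinates(3,4)] unfolding d_def \<sigma>_def S_def b'_def by simp_all
    have "expectation (R n) \<le> expectation (\<lambda>\<omega>. indicator (S (2 * m)) \<omega> * \<sigma> n \<omega> ^ 2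
        + C * (indicator (S n) \<omega> * g (2 * m) \<omega>)
        + 8 * C * (indicator (S (2 * m)) \<omega> * fst (d \<omega>) ^ 4) + 8 * C * (indicator (S (2 * m)) \<omega> * snd (d \<omega>) ^ 4))"
    proof (intro integral_mono second Bochner_Integration.integrable_add integrable_mult_right i\<sigma> ig d1 d2)
      fix \<omega> assume \<omega>: "\<omega> \<in> space M"
      show "R n \<omega> \<le> indicator (S (2 * m)) \<omega> * \<sigma> n \<omega> ^ 2 + C * (indicator (S n) \<omega> * g (2 * m) \<omega>)
        + 8 * C * (indicator (S (2 * m)) \<omega> * fst (d \<omega>) ^ 4) + 8 * C * (indicator (S (2 * m)) \<omega> * snd (d \<omega>) ^ 4)"
      proof (cases "\<omega> \<in> S n")
        case True
        then have S2: "\<omega> \<in> S (2 * m)" using S_anti[OF mn] by auto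
        have Xd: "X n \<omega> = X (2 * m) \<omega> + d \<omega>"
          using \<sigma>_S[OF True] by (simp add: X_def d_def brownian_from_def scaleR_diff_right)
        \<comment> \<open>Completing the square removes the factor \<open>n\<close> from
          \<open>u1\<close>: what remains is \<open>n^2\<close>, the squared capped time of a
          survivor, and \<open>u1^2 + u2\<close>, which grows at most quartically.\<close>
        have "2 * real n * u1 (X n \<omega>) \<le> real n ^ 2 + u1 (X n \<omega>) ^ 2"
          using sum_squares_bound[of "real n" "u1 (X n \<omega>)"] by simp
        then have "R n \<omega> \<le> real n ^ 2 + (u1 (X n \<omega>) ^ 2 + u2 (X n \<omega>))" using True by (simp add: R_def)
        also have "\<dots> \<le> real n ^ 2 + C * (1 + fst (X n \<omega>) ^ 4 + snd (X n \<omega>) ^ 4)"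
          using C(1)[OF S_in[OF True]] by simp
        also have "\<dots> \<le> real n ^ 2 + C * (1 + (8 * fst (X (2 * m) \<omega>) ^ 4 + 8 * fst (d \<omega>) ^ 4)
            + (8 * snd (X (2 * m) \<omega>) ^ 4 + 8 * snd (d \<omega>) ^ 4))"
          unfolding Xd using C(2) power4_add_le by (intro add_left_mono mult_left_mono add_mono) auto
        finally show ?thesis using True S2 \<sigma>_S[OF True] by (simp add: g_def algebra_simps)
      next
        case False
        then show ?thesis using C(2) by (simp add: R_def)
      qed
    qed
    also have "\<dots> = b + C * \<gamma> (2 * m) n + 8 * C * expectation (\<lambda>\<omega>. indicator (S (2 * m)) \<omega> * fst (d \<omega>) ^ 4)
        + 8 * C * expectation (\<lambda>\<omega>. indicator (S (2 * m)) \<omega> * snd (d \<omega>) ^ 4)"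
      using i\<sigma>(1) ig d1(1) d2(1) by (simp add: b_def \<gamma>_def)
    also have "\<dots> \<le> b + C * \<gamma> (2 * m) n + 8 * C * (120 * b) + 8 * C * (120 * b)"
      using d1(2) d2(2) b' C(2) by (intro add_mono mult_left_mono) auto
    also have "\<dots> = (1 + 1920 * C) * b + C * \<gamma> (2 * m) n" by (simp add: algebra_simps)
    also have "\<dots> \<le> (1 + 1920 * C) * \<beta> m + C * \<gamma> (2 * m) n"
      using tail_le[OF mn] C(2) unfolding b_def by (intro add_mono mult_left_mono) auto
    finally show ?thesis .
  qed
  \<comment> \<open>The order of choice matters: \<open>m\<close> first, to make the uniform part
    small, then \<open>n\<close> depending on \<open>m\<close>.\<close>
  have ER: "(\<lambda>n. expectation (R n)) \<longlonglongrightarrow> 0"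
  proof (rule LIMSEQ_I)
    fix r :: real assume "0 < r"
    have "(\<lambda>m. (1 + 1920 * C) * \<beta> m) \<longlonglongrightarrow> (1 + 1920 * C) * 0" by (intro tendsto_intros \<beta>0)
    then have "\<forall>\<^sub>F m in sequentially. (1 + 1920 * C) * \<beta> m < r / 2"
      using \<open>0 < r\<close> by (intro order_tendstoD) auto
    then obtain m where m: "(1 + 1920 * C) * \<beta> m < r / 2" by (auto simp: eventually_sequentially)
    have "(\<lambda>n. C * \<gamma> (2 * m) n) \<longlonglongrightarrow> C * 0" by (intro tendsto_intros \<gamma>0)
    then have "\<forall>\<^sub>F n in sequentially. C * \<gamma> (2 * m) n < r / 2"
      using \<open>0 < r\<close> by (intro order_tendstoD) auto
    then obtain N where N: "\<And>n. N \<le> n \<Longrightarrow> C * \<gamma> (2 * m) n < r / 2" by (auto simp: eventually_sequentially)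
    have "norm (expectation (R n) - 0) < r" if "max N (2 * m) \<le> n" for n
      using ER_le[of m n] N[of n] m that ER0[of n] by simp
    then show "\<exists>n0. \<forall>n\<ge>n0. norm (expectation (R n) - 0) < r" by blast
  qed
  have "(\<lambda>n. u2 p - expectation (R n)) \<longlonglongrightarrow> u2 p - 0" by (intro tendsto_intros ER)
  moreover have "e = (\<lambda>n. u2 p - expectation (R n))" using second(2) by (auto simp: fun_eq_iff algebra_simps)
  ultimately have "e \<longlonglongrightarrow> u2 p" by simp
  then have "(\<lambda>n. ennreal (expectation (\<lambda>\<omega>. stop D p (real n) \<omega> ^ 2))) \<longlonglongrightarrow> ennreal (u2 p)"
    unfolding e_def \<sigma>_def by (rule tendsto_ennrealI)
  then show "exit_moment M B D 2 p = ennreal (u2 p)"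
    using exit_moment_limit[OF D, of 2 p] LIMSEQ_unique by auto
  \<comment> \<open>For \<open>n \<ge> 1\<close> the remainder of the first moment is at most
    \<open>R n\<close>, so nothing new has to be estimated.\<close>
  have rem: "(\<lambda>n. expectation (\<lambda>\<omega>. indicator (S n) \<omega> * u1 (X n \<omega>))) \<longlonglongrightarrow> 0"
  proof (rule tendsto_sandwich[OF _ _ tendsto_const ER])
    show "\<forall>\<^sub>F n in sequentially. 0 \<le> expectation (\<lambda>\<omega>. indicator (S n) \<omega> * u1 (X n \<omega>))"
      using S_in pos(1) by (intro always_eventually allI Bochner_Integration.integral_nonneg) (auto simp: indicator_def)
    show "\<forall>\<^sub>F n in sequentially. expectation (\<lambda>\<omega>. indicator (S n) \<omega> * u1 (X n \<omega>)) \<le> expectation (R n)"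
      using eventually_ge_at_top[of 1]
    proof eventually_elim
      case (elim n)
      show ?case
      proof (intro integral_mono first second)
        fix \<omega>
        show "indicator (S n) \<omega> * u1 (X n \<omega>) \<le> R n \<omega>"
        proof (cases "\<omega> \<in> S n")
          case True
          have "1 * u1 (X n \<omega>) \<le> 2 * real n * u1 (X n \<omega>)"
            using elim pos(1)[OF S_in[OF True]] by (intro mult_right_mono) auto
          then show ?thesis using True pos(2)[OF S_in[OF True]] by (simp add: R_def)
        qed (simp add: R_def)
      qed
    qed
  qed
  have "(\<lambda>n. u1 p - expectation (\<lambda>\<omega>. indicator (S n) \<omega> * u1 (X n \<omega>))) \<longlonglongrightarrow> u1 p - 0" by (intro tendsto_intros rem)
  moreover have "(\<lambda>n. expectation (\<sigma> n)) = (\<lambda>n. u1 p - expectation (\<lambda>\<omega>. indicator (S n) \<omega> * u1 (X n \<omega>)))"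
    using first(2) by (auto simp: fun_eq_iff algebra_simps)
  ultimately have "(\<lambda>n. expectation (\<sigma> n)) \<longlonglongrightarrow> u1 p" by simp
  then have "(\<lambda>n. ennreal (expectation (\<lambda>\<omega>. stop D p (real n) \<omega> ^ 1))) \<longlonglongrightarrow> ennreal (u1 p)"
    unfolding \<sigma>_def power_one_right by (rule tendsto_ennrealI)
  then show "exit_moment M B D 1 p = ennreal (u1 p)"
    using exit_moment_limit[OF D, of 1 p] LIMSEQ_unique by auto
qed

end


section \<open>Domains bounded by conics\<close>

lemma symmetry_ofI:
  assumes "\<And>u v. dist (g u) (g v) = dist u v" "\<And>z. g z \<in> D \<longleftrightarrow> z \<in> D" "surj g"
  shows "symmetry_of D g"
  unfolding symmetry_of_def
proof (intro conjI allI assms(1))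
  show "g ` D = D"
  proof (intro equalityI subsetI)
    fix z assume "z \<in> D"
    obtain w where "z = g w" using assms(3) by (metis surjD)
    then show "z \<in> g ` D" using assms(2) \<open>z \<in> D\<close> by auto
  qed (use assms(2) in auto)
qed

text \<open>Covers the sign changes of the conics, one reflection of the triangle and, through the
  offsets \<open>c\<close> and \<open>d\<close>, the reflections of the rectangle in its
  midlines.\<close>

lemma symmetry_of_axis_maps:
  assumes "\<bar>a\<bar> = 1" "\<bar>b\<bar> = 1" "\<And>x y. (c + a * x, d + b * y) \<in> D \<longleftrightarrow> (x, y) \<in> D"
  shows "symmetry_of D (\<lambda>z. (c + a * fst z, d + b * snd z))"
proof (rule symmetry_ofI)
  have sq: "a^2 = 1" "b^2 = 1" using assms(1,2) by (metis power2_abs one_power2)+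
  then have aa: "a * a = 1" "b * b = 1" by (simp_all add: power2_eq_square)
  show "dist (c + a * fst u, d + b * snd u) (c + a * fst v, d + b * snd v) = dist u v" for u v
    by (cases u; cases v) (simp add: dist_prod_def dist_real_def right_diff_distrib[symmetric] abs_mult assms(1,2))
  show "(c + a * fst z, d + b * snd z) \<in> D \<longleftrightarrow> z \<in> D" for z
    using assms(3)[of "fst z" "snd z"] by simp
  show "surj (\<lambda>z. (c + a * fst z, d + b * snd z))"
    using aa by (intro surjI[of _ "\<lambda>z. (a * (fst z - c), b * (snd z - d))"]) (simp add: mult.assoc[symmetric])
qed

lemma symmetry_of_signs:
  fixes x y :: real
  assumes "x' = x \<or> x' = - x \<and> (\<forall>x y. (- x, y) \<in> D \<longleftrightarrow> (x, y) \<in> D)"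
    and "y' = y \<or> y' = - y \<and> (\<forall>x y. (x, - y) \<in> D \<longleftrightarrow> (x, y) \<in> D)"
  shows "\<exists>g. symmetry_of D g \<and> (x', y') = g (x, y)"
proof -
  obtain a where a: "\<bar>a\<bar> = 1" "x' = 0 + a * x" "\<And>x y. (a * x, y) \<in> D \<longleftrightarrow> (x, y) \<in> D"
    using assms(1) that[of 1] that[of "-1"] by auto
  obtain b where b: "\<bar>b\<bar> = 1" "y' = 0 + b * y" "\<And>x y. (x, b * y) \<in> D \<longleftrightarrow> (x, y) \<in> D"
    using assms(2) that[of 1] that[of "-1"] by auto
  have "symmetry_of D (\<lambda>z. (0 + a * fst z, 0 + b * snd z))"
    using a b by (intro symmetry_of_axis_maps) auto
  then show ?thesis using a b by auto
qed

section \<open>Poisson equations for a conic\<close>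

text \<open>\<open>eK\<close> says that \<open>K * w\<close> has Laplacian -1. The other equations
  compare the coefficients of \<open>x^2\<close>, \<open>y^2\<close>, \<open>y\<close> and
  \<open>1\<close> in the requirement that the Laplacian of \<open>w * q\<close> be
  \<open>- 2 * K * w\<close>. For given \<open>w\<close> and \<open>K\<close> they are linear in the
  coefficients of \<open>q\<close>.\<close>

lemma caloric_conic:
  fixes k0 k1 k2 k3 K A0 A1 A2 A3 :: real
  defines "w \<equiv> \<lambda>z. k0 + k1 * (fst z)^2 + k2 * (snd z)^2 + k3 * snd z"
    and "q \<equiv> \<lambda>z. A0 + A1 * (fst z)^2 + A2 * (snd z)^2 + A3 * snd z"
  assumes eK: "2 * K * (k1 + k2) = -1"
    and e1: "12 * k1 * A1 + 2 * (k1 * A2 + k2 * A1) = - 2 * K * k1"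
    and e2: "12 * k2 * A2 + 2 * (k1 * A2 + k2 * A1) = - 2 * K * k2"
    and e3: "2 * (k1 * A3 + k3 * A1) + 6 * (k2 * A3 + k3 * A2) = - 2 * K * k3"
    and e0: "2 * (k0 * A1 + k1 * A0) + 2 * (k0 * A2 + k2 * A0 + k3 * A3) = - 2 * K * k0"
  shows "caloric (\<lambda>t z. t + K * w z)" "caloric (\<lambda>t z. t^2 + 2 * t * (K * w z) + w z * q z)"
proof -
  show "caloric (\<lambda>t z. t + K * w z)"
  proof (rule caloric_polynomial[of _ "[(K * k0, 0, 0), (K * k1, 2, 0), (K * k2, 0, 2), (K * k3, 0, 1)]"])
    fix t x y
    have "t + K * w (x, y) = (\<Sum>(a, i, j)\<leftarrow>[(K * k0, 0, 0), (K * k1, 2, 0), (K * k2, 0, 2), (K * k3, 0, 1)].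
        a * (heat_poly i t x * heat_poly j t y)) + t * (2 * K * (k1 + k2) + 1)"
      by (simp add: w_def heat_poly_simps algebra_simps)
    then show "t + K * w (x, y) = (\<Sum>(a, i, j)\<leftarrow>[(K * k0, 0, 0), (K * k1, 2, 0), (K * k2, 0, 2), (K * k3, 0, 1)].
        a * (heat_poly i t x * heat_poly j t y))" using eK by simp
  qed simp
  let ?l = "[(k1 * A1, 4, 0), (k1 * A2 + k2 * A1, 2, 2), (k2 * A2, 0, 4), (k1 * A3 + k3 * A1, 2, 1),
    (k2 * A3 + k3 * A2, 0, 3), (k0 * A1 + k1 * A0, 2, 0), (k0 * A2 + k2 * A0 + k3 * A3, 0, 2),
    (k0 * A3 + k3 * A0, 0, 1), (k0 * A0, 0, 0)] :: (real \<times> nat \<times> nat) list"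
  show "caloric (\<lambda>t z. t^2 + 2 * t * (K * w z) + w z * q z)"
  proof (rule caloric_polynomial[of _ ?l])
    fix t x y
    \<comment> \<open>All terms after the sum carry a defect of one of the five equations, and so
      vanish.\<close>
    have "t^2 + 2 * t * (K * w (x, y)) + w (x, y) * q (x, y)
      = (\<Sum>(a, i, j)\<leftarrow>?l. a * (heat_poly i t x * heat_poly j t y))
        + t * x^2 * ((12 * k1 * A1 + 2 * (k1 * A2 + k2 * A1)) + 2 * K * k1)
        + t * y^2 * ((12 * k2 * A2 + 2 * (k1 * A2 + k2 * A1)) + 2 * K * k2)
        + t * y * ((2 * (k1 * A3 + k3 * A1) + 6 * (k2 * A3 + k3 * A2)) + 2 * K * k3)
        + t * ((2 * (k0 * A1 + k1 * A0) + 2 * (k0 * A2 + k2 * A0 + k3 * A3)) + 2 * K * k0)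
        - t^2 * ((12 * k1 * A1 + 2 * (k1 * A2 + k2 * A1)) + 2 * K * k1)
        - t^2 * ((12 * k2 * A2 + 2 * (k1 * A2 + k2 * A1)) + 2 * K * k2)
        + t^2 * (2 * K * (k1 + k2) + 1)"
      by (simp add: w_def q_def heat_poly_simps power_numeral_reduce algebra_simps)
    then show "t^2 + 2 * t * (K * w (x, y)) + w (x, y) * q (x, y)
      = (\<Sum>(a, i, j)\<leftarrow>?l. a * (heat_poly i t x * heat_poly j t y))"
      unfolding e0 e1 e2 e3 eK by simp
  qed simp
qed

lemma conic_growth:
  fixes k0 k1 k2 k3 :: real
  shows "\<bar>k0 + k1 * x^2 + k2 * y^2 + k3 * y\<bar> \<le> (\<bar>k0\<bar> + \<bar>k1\<bar> + \<bar>k2\<bar> + \<bar>k3\<bar>) * (1 + x^2 + y^2)"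
proof -
  have "\<bar>y\<bar> \<le> 1 + y^2" using sum_squares_bound[of 1 "\<bar>y\<bar>"] zero_le_power2[of y] by simp
  then have "\<bar>y\<bar> \<le> 1 + x^2 + y^2" using zero_le_power2[of x] by linarith
  then have "\<bar>k3 * y\<bar> \<le> \<bar>k3\<bar> * (1 + x^2 + y^2)" unfolding abs_mult by (intro mult_left_mono) auto
  moreover have "\<bar>k0\<bar> \<le> \<bar>k0\<bar> * (1 + x^2 + y^2)" by (simp add: mult_le_cancel_left1)
  moreover have "\<bar>k1 * x^2\<bar> \<le> \<bar>k1\<bar> * (1 + x^2 + y^2)" unfolding abs_mult by (intro mult_left_mono) auto
  moreover have "\<bar>k2 * y^2\<bar> \<le> \<bar>k2\<bar> * (1 + x^2 + y^2)" unfolding abs_mult by (intro mult_left_mono) auto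
  ultimately have "\<bar>k0\<bar> + \<bar>k1 * x^2\<bar> + \<bar>k2 * y^2\<bar> + \<bar>k3 * y\<bar>
      \<le> \<bar>k0\<bar> * (1 + x^2 + y^2) + \<bar>k1\<bar> * (1 + x^2 + y^2) + \<bar>k2\<bar> * (1 + x^2 + y^2) + \<bar>k3\<bar> * (1 + x^2 + y^2)"
    by (intro add_mono)
  moreover have "\<bar>p + q + r + s\<bar> \<le> \<bar>p\<bar> + \<bar>q\<bar> + \<bar>r\<bar> + \<bar>s\<bar>" for p q r s :: real by linarith
  ultimately show ?thesis unfolding distrib_right by (rule order.trans[rotated])
qed

text \<open>The factor \<open>w\<close> makes both candidates vanish on the boundary. As
  \<open>w\<close> and \<open>q\<close> grow quadratically, \<open>u1^2 + u2\<close> stays within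
  the quartic growth that \<open>exit_moments_eqI\<close> allows, also on unbounded domains.\<close>

lemma (in standard_planar_brownian_motion) exit_moments_conic:
  fixes k0 k1 k2 k3 K A0 A1 A2 A3 :: real and p :: "real \<times> real"
  defines "w \<equiv> \<lambda>z. k0 + k1 * (fst z)^2 + k2 * (snd z)^2 + k3 * snd z"
    and "q \<equiv> \<lambda>z. A0 + A1 * (fst z)^2 + A2 * (snd z)^2 + A3 * snd z"
  assumes eqs: "2 * K * (k1 + k2) = -1"
      "12 * k1 * A1 + 2 * (k1 * A2 + k2 * A1) = - 2 * K * k1"
      "12 * k2 * A2 + 2 * (k1 * A2 + k2 * A1) = - 2 * K * k2"
      "2 * (k1 * A3 + k3 * A1) + 6 * (k2 * A3 + k3 * A2) = - 2 * K * k3"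
      "2 * (k0 * A1 + k1 * A0) + 2 * (k0 * A2 + k2 * A0 + k3 * A3) = - 2 * K * k0"
    and D: "open D" "p \<in> D" and K: "0 \<le> K"
    and w: "\<And>z. z \<in> D \<Longrightarrow> 0 < w z" "\<And>z. z \<in> closure D \<Longrightarrow> z \<notin> D \<Longrightarrow> w z = 0"
    and q: "\<And>z. z \<in> D \<Longrightarrow> 0 \<le> q z"
  shows "exit_moment M B D 1 p = ennreal (K * w p)" "exit_moment M B D 2 p = ennreal (w p * q p)"
proof -
  define c where "c = \<bar>k0\<bar> + \<bar>k1\<bar> + \<bar>k2\<bar> + \<bar>k3\<bar>"
  define d where "d = \<bar>A0\<bar> + \<bar>A1\<bar> + \<bar>A2\<bar> + \<bar>A3\<bar>"
  have c0: "0 \<le> c" and d0: "0 \<le> d" by (auto simp: c_def d_def)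
  have bound: "(K * w z)^2 + w z * q z \<le> 3 * (K^2 * c^2 + c * d) * (1 + fst z ^ 4 + snd z ^ 4)"
    if "z \<in> D" for z
  proof -
    define n where "n = 1 + (fst z)^2 + (snd z)^2"
    have n0: "0 \<le> n" by (simp add: n_def add_nonneg_nonneg)
    have wn: "\<bar>w z\<bar> \<le> c * n" and qn: "\<bar>q z\<bar> \<le> d * n"
      unfolding w_def q_def c_def d_def n_def by (rule conic_growth)+
    have "(w z)^2 \<le> (c * n)^2" using power_mono[OF wn abs_ge_zero, of 2] by simp
    then have "K^2 * (w z)^2 \<le> K^2 * (c * n)^2" by (rule mult_left_mono) simp
    moreover have "w z * q z \<le> (c * n) * (d * n)"
    proof -
      have "w z * q z \<le> \<bar>w z\<bar> * \<bar>q z\<bar>" by (metis abs_ge_self abs_mult)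
      also have "\<dots> \<le> (c * n) * (d * n)" using wn qn c0 n0 by (intro mult_mono) auto
      finally show ?thesis .
    qed
    ultimately have "(K * w z)^2 + w z * q z \<le> (K^2 * c^2 + c * d) * n^2"
      by (simp add: power_mult_distrib power2_eq_square algebra_simps)
    also have "\<dots> \<le> (K^2 * c^2 + c * d) * (3 * (1 + fst z ^ 4 + snd z ^ 4))"
    proof (rule mult_left_mono)
      have "(1 + a + b)^2 \<le> 3 * (1 + a^2 + b^2)" for a b :: real
        using sum_squares_bound[of 1 a] sum_squares_bound[of 1 b] sum_squares_bound[of a b]
        by (simp add: power2_eq_square algebra_simps)
      from this[of "(fst z)^2" "(snd z)^2"] show "n^2 \<le> 3 * (1 + fst z ^ 4 + snd z ^ 4)"
        by (simp add: n_def)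
    qed (use c0 d0 in auto)
    finally show ?thesis by (simp only: mult_ac)
  qed
  have pos: "0 \<le> K * w z" "0 \<le> w z * q z" if "z \<in> D" for z
    using w(1)[OF that] q[OF that] K by simp_all
  have bd: "K * w z = 0" "w z * q z = 0" if "z \<in> closure D" "z \<notin> D" for z
    using w(2)[OF that] by simp_all
  have C: "0 \<le> 3 * (K^2 * c^2 + c * d)" using c0 d0 by simp
  have cal: "caloric (\<lambda>t z. t + K * w z)" "caloric (\<lambda>t z. t^2 + 2 * t * (K * w z) + w z * q z)"
    unfolding w_def q_def by (rule caloric_conic[OF eqs])+
  note rule = exit_moments_eqI[OF D cal pos bd bound C]
  show "exit_moment M B D 1 p = ennreal (K * w p)" by (rule rule(1))
  show "exit_moment M B D 2 p = ennreal (w p * q p)" by (rule rule(2))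
qed

definition determined_by_two_moments :: "'w measure \<Rightarrow> (real \<Rightarrow> 'w \<Rightarrow> real \<times> real) \<Rightarrow> (real \<times> real) set \<Rightarrow> bool" where
  "determined_by_two_moments M B D \<longleftrightarrow>
    (\<forall>p\<in>D. \<forall>q\<in>D. exit_moment M B D 1 p = exit_moment M B D 1 q \<and>
      exit_moment M B D 2 p = exit_moment M B D 2 q \<longrightarrow> (\<exists>g. symmetry_of D g \<and> q = g p)) \<and>
    (\<forall>p\<in>D. \<forall>q\<in>D. exit_moment M B D 1 p = exit_moment M B D 1 q \<and>
      exit_variance M B D p = exit_variance M B D q \<longrightarrow> (\<exists>g. symmetry_of D g \<and> q = g p))"

text \<open>As both moments are finite, equality of the first moments turns equality of variances
  into equality of second moments.\<close>

lemma two_moments_determine: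
  assumes u: "\<And>z. z \<in> D \<Longrightarrow> exit_moment M B D 1 z = ennreal (u1 z)" "\<And>z. z \<in> D \<Longrightarrow> exit_moment M B D 2 z = ennreal (u2 z)"
    and pos: "\<And>z. z \<in> D \<Longrightarrow> 0 \<le> u1 z" "\<And>z. z \<in> D \<Longrightarrow> 0 \<le> u2 z"
    and sym: "\<And>p q. p \<in> D \<Longrightarrow> q \<in> D \<Longrightarrow> u1 p = u1 q \<Longrightarrow> u2 p = u2 q \<Longrightarrow> \<exists>g. symmetry_of D g \<and> q = g p"
  shows "determined_by_two_moments M B D"
  unfolding determined_by_two_moments_def
proof (intro conjI ballI impI; elim conjE)
  fix p q assume pq: "p \<in> D" "q \<in> D"
    and 1: "exit_moment M B D 1 p = exit_moment M B D 1 q"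
  have u1: "u1 p = u1 q" using 1 u(1) pq pos(1) by simp
  { assume "exit_moment M B D 2 p = exit_moment M B D 2 q"
    then have "u2 p = u2 q" using u(2) pq pos(2) by simp
    then show "\<exists>g. symmetry_of D g \<and> q = g p" using sym pq u1 by blast }
  assume var: "exit_variance M B D p = exit_variance M B D q"
  have "exit_variance M B D z = ereal (u2 z - (u1 z)^2)" if "z \<in> D" for z
    using that unfolding exit_variance_def u[OF that]
    by (simp add: pos enn2ereal_ennreal power2_eq_square)
  then have "u2 p = u2 q" using var pq u1 by simp
  then show "\<exists>g. symmetry_of D g \<and> q = g p" using sym pq u1 by blast
qed


section \<open>Ellipse, hyperbola, parabola and wedge\<close>

context standard_planar_brownian_motion
begin

text \<open>Since \<open>w > 0\<close>, equal moments mean equal \<open>w\<close> and equal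
  \<open>q\<close>. Without linear terms both are affine in the squares of the coordinates; a
  nonzero determinant recovers these squares, and reflections account for the signs. In a domain
  within the right half plane the sign of \<open>x\<close> is known.\<close>

lemma centred_conic_determined:
  fixes k0 k1 k2 K A0 A1 A2 :: real
  defines "w \<equiv> \<lambda>z. k0 + k1 * (fst z)^2 + k2 * (snd z)^2 + 0 * snd z"
    and "q \<equiv> \<lambda>z. A0 + A1 * (fst z)^2 + A2 * (snd z)^2 + 0 * snd z"
  assumes eqs: "2 * K * (k1 + k2) = -1"
      "12 * k1 * A1 + 2 * (k1 * A2 + k2 * A1) = - 2 * K * k1"
      "12 * k2 * A2 + 2 * (k1 * A2 + k2 * A1) = - 2 * K * k2"
      "2 * (k0 * A1 + k1 * A0) + 2 * (k0 * A2 + k2 * A0) = - 2 * K * k0"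
    and D: "open D" and K: "0 < K" and det: "k1 * A2 \<noteq> k2 * A1" "k1 \<noteq> 0" "k2 \<noteq> 0"
    and w: "\<And>z. z \<in> D \<Longrightarrow> 0 < w z" "\<And>z. z \<in> closure D \<Longrightarrow> z \<notin> D \<Longrightarrow> w z = 0"
    and q: "\<And>z. z \<in> D \<Longrightarrow> 0 \<le> q z"
    and sym: "\<And>x y. (x, - y) \<in> D \<longleftrightarrow> (x, y) \<in> D"
      "(\<forall>x y. (- x, y) \<in> D \<longleftrightarrow> (x, y) \<in> D) \<or> (\<forall>z\<in>D. 0 < fst z)"
  shows "determined_by_two_moments M B D"
proof (rule two_moments_determine)
  fix z assume z: "z \<in> D"
  have eqs': "2 * (k1 * 0 + 0 * A1) + 6 * (k2 * 0 + 0 * A2) = - 2 * K * 0"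
    "2 * (k0 * A1 + k1 * A0) + 2 * (k0 * A2 + k2 * A0 + 0 * 0) = - 2 * K * k0"
    using eqs(4) by simp_all
  show "exit_moment M B D 1 z = ennreal (K * w z)" "exit_moment M B D 2 z = ennreal (w z * q z)"
    unfolding w_def q_def
    by (rule exit_moments_conic[OF eqs(1-3) eqs' D z less_imp_le[OF K]];
        use w q in \<open>simp add: w_def q_def\<close>)+
  show "0 \<le> K * w z" "0 \<le> w z * q z" using w(1)[OF z] q[OF z] K by simp_all
next
  fix z z' assume z: "z \<in> D" "z' \<in> D" and "K * w z = K * w z'" "w z * q z = w z' * q z'"
  then have "w z = w z'" "q z = q z'" using K w(1)[OF z(1)] by auto
  then have 1: "k1 * ((fst z)^2 - (fst z')^2) + k2 * ((snd z)^2 - (snd z')^2) = 0"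
    and 2: "A1 * ((fst z)^2 - (fst z')^2) + A2 * ((snd z)^2 - (snd z')^2) = 0"
    by (simp_all add: w_def q_def algebra_simps)
  have "(k1 * A2 - k2 * A1) * ((fst z)^2 - (fst z')^2)
      = A2 * (k1 * ((fst z)^2 - (fst z')^2) + k2 * ((snd z)^2 - (snd z')^2))
        - k2 * (A1 * ((fst z)^2 - (fst z')^2) + A2 * ((snd z)^2 - (snd z')^2))"
    by (simp add: algebra_simps)
  then have x: "(fst z')^2 = (fst z)^2" using 1 2 det by simp
  then have y: "(snd z')^2 = (snd z)^2" using 1 det by simp
  have "\<exists>g. symmetry_of D g \<and> (fst z', snd z') = g (fst z, snd z)"
  proof (rule symmetry_of_signs)
    show "fst z' = fst z \<or> fst z' = - fst z \<and> (\<forall>x y. (- x, y) \<in> D \<longleftrightarrow> (x, y) \<in> D)"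
      using sym(2)
    proof
      assume "\<forall>z\<in>D. 0 < fst z"
      then have "0 < fst z" "0 < fst z'" using z by auto
      then show ?thesis using x by (simp add: power2_eq_iff)
    qed (use x in \<open>simp add: power2_eq_iff\<close>)
    show "snd z' = snd z \<or> snd z' = - snd z \<and> (\<forall>x y. (x, - y) \<in> D \<longleftrightarrow> (x, y) \<in> D)"
      using y sym(1) by (auto simp: power2_eq_iff)
  qed
  then show "\<exists>g. symmetry_of D g \<and> z' = g z" by simp
qed

text \<open>For a disc \<open>q\<close> would be a function of \<open>w\<close> and carry no further
  information; this shows in the factor \<open>\<alpha> - \<beta>\<close> of the
  determinant.\<close>

lemma elliptic_determined:
  assumes ab: "0 < a" "0 < b" "a \<noteq> b"
  shows "determined_by_two_moments M B (elliptic_domain a b)"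
proof -
  define \<alpha> where "\<alpha> = 1 / a^2"
  define \<beta> where "\<beta> = 1 / b^2"
  have pos: "0 < \<alpha>" "0 < \<beta>" using ab by (simp_all add: \<alpha>_def \<beta>_def)
  have ne: "\<alpha> \<noteq> \<beta>" using ab by (simp add: \<alpha>_def \<beta>_def power2_eq_iff_nonneg)
  define K where "K = 1 / (2 * (\<alpha> + \<beta>))"
  define Q where "Q = \<alpha>^2 + 6 * \<alpha> * \<beta> + \<beta>^2"
  \<comment> \<open>Cramer's rule: after division by -2, the system for the \<open>x^2\<close> and
    \<open>y^2\<close> coefficients of \<open>q\<close> has determinant \<open>6 * Q\<close>. The
    number \<open>P\<close> then comes from the equation for the constant term.\<close>
  define c where "c = K / (6 * Q)"
  define P where "P = c * (5 * \<alpha>^2 + 26 * \<alpha> * \<beta> + 5 * \<beta>^2)"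
  have Q: "0 < Q" using pos by (simp add: Q_def add_pos_pos)
  have K: "0 < K" using pos by (simp add: K_def)
  have hS: "2 * K * (\<alpha> + \<beta>) = 1" using pos by (simp add: K_def)
  have hK: "K = 6 * c * Q" using Q by (simp add: c_def)
  have c: "0 < c" using K Q by (simp add: c_def)
  have D: "elliptic_domain a b = {z. 0 < 1 - \<alpha> * (fst z)^2 - \<beta> * (snd z)^2}"
    by (auto simp: elliptic_domain_def \<alpha>_def \<beta>_def power_divide)
  have cl: "closure (elliptic_domain a b) \<subseteq> {z. 0 \<le> 1 - \<alpha> * (fst z)^2 - \<beta> * (snd z)^2}"
    unfolding D by (intro closure_minimal closed_Collect_le continuous_intros) auto
  show ?thesis
  proof (rule centred_conic_determined[where K = K and ?k0.0 = 1 and ?k1.0 = "-\<alpha>" and ?k2.0 = "-\<beta>"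
        and ?A0.0 = "2 * K * P" and ?A1.0 = "- c * \<alpha> * (\<alpha> + 5 * \<beta>)" and ?A2.0 = "- c * \<beta> * (5 * \<alpha> + \<beta>)"])
    show "2 * K * (- \<alpha> + - \<beta>) = - 1" using hS by (simp add: algebra_simps)
    show "12 * - \<alpha> * (- c * \<alpha> * (\<alpha> + 5 * \<beta>)) + 2 * (- \<alpha> * (- c * \<beta> * (5 * \<alpha> + \<beta>)) + - \<beta> * (- c * \<alpha> * (\<alpha> + 5 * \<beta>))) = - 2 * K * - \<alpha>"
      unfolding hK Q_def by (simp add: algebra_simps power2_eq_square)
    show "12 * - \<beta> * (- c * \<beta> * (5 * \<alpha> + \<beta>)) + 2 * (- \<alpha> * (- c * \<beta> * (5 * \<alpha> + \<beta>)) + - \<beta> * (- c * \<alpha> * (\<alpha> + 5 * \<beta>))) = - 2 * K * - \<beta>"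
      unfolding hK Q_def by (simp add: algebra_simps power2_eq_square)
    have "2 * (1 * (- c * \<alpha> * (\<alpha> + 5 * \<beta>)) + - \<alpha> * (2 * K * P)) + 2 * (1 * (- c * \<beta> * (5 * \<alpha> + \<beta>)) + - \<beta> * (2 * K * P))
      = - 2 * c * (\<alpha> * (\<alpha> + 5 * \<beta>) + \<beta> * (5 * \<alpha> + \<beta>)) - 2 * P * (2 * K * (\<alpha> + \<beta>))"
      by (simp add: algebra_simps)
    also have "\<dots> = - 2 * K * 1" unfolding hS unfolding hK P_def Q_def by (simp add: algebra_simps power2_eq_square)
    finally show "2 * (1 * (- c * \<alpha> * (\<alpha> + 5 * \<beta>)) + - \<alpha> * (2 * K * P)) + 2 * (1 * (- c * \<beta> * (5 * \<alpha> + \<beta>)) + - \<beta> * (2 * K * P)) = - 2 * K * 1" .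
    show "open (elliptic_domain a b)" unfolding D by (intro open_Collect_less continuous_intros)
    show "0 < K" by (rule K)
    have "- \<alpha> * (- c * \<beta> * (5 * \<alpha> + \<beta>)) - - \<beta> * (- c * \<alpha> * (\<alpha> + 5 * \<beta>)) = 4 * c * \<alpha> * \<beta> * (\<alpha> - \<beta>)"
      by (simp add: algebra_simps)
    also have "\<dots> \<noteq> 0" using c pos ne by simp
    finally show "- \<alpha> * (- c * \<beta> * (5 * \<alpha> + \<beta>)) \<noteq> - \<beta> * (- c * \<alpha> * (\<alpha> + 5 * \<beta>))" by simp
    show "- \<alpha> \<noteq> 0" "- \<beta> \<noteq> 0" using pos by auto
  next
    fix z assume z: "z \<in> elliptic_domain a b"
    then show "0 < 1 + - \<alpha> * (fst z)^2 + - \<beta> * (snd z)^2 + 0 * snd z" by (simp add: D)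
    \<comment> \<open>\<open>2 * K * P\<close> dominates both coefficients, so
      \<open>q \<ge> 0\<close> follows from
      \<open>\<alpha> * x^2 + \<beta> * y^2 < 1\<close>.\<close>
    have P: "c * (\<alpha> + 5 * \<beta>) \<le> 2 * K * P" "c * (5 * \<alpha> + \<beta>) \<le> 2 * K * P"
    proof -
      have "c * (\<alpha> + 5 * \<beta>) * (\<alpha> + \<beta>) \<le> P" "c * (5 * \<alpha> + \<beta>) * (\<alpha> + \<beta>) \<le> P"
        unfolding P_def using c pos by (simp_all add: mult.assoc) (simp_all add: algebra_simps power2_eq_square)
      then have "2 * K * (c * (\<alpha> + 5 * \<beta>) * (\<alpha> + \<beta>)) \<le> 2 * K * P" "2 * K * (c * (5 * \<alpha> + \<beta>) * (\<alpha> + \<beta>)) \<le> 2 * K * P"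
        using K by simp_all
      moreover have "2 * K * (d * (\<alpha> + \<beta>)) = d" for d
      proof -
        have "2 * K * (d * (\<alpha> + \<beta>)) = d * (2 * K * (\<alpha> + \<beta>))" by simp
        then show ?thesis unfolding hS by simp
      qed
      ultimately show "c * (\<alpha> + 5 * \<beta>) \<le> 2 * K * P" "c * (5 * \<alpha> + \<beta>) \<le> 2 * K * P" by simp_all
    qed
    have "(2 * K * P) * 1 \<ge> (2 * K * P) * (\<alpha> * (fst z)^2 + \<beta> * (snd z)^2)"
      using z c pos K by (intro mult_left_mono) (auto simp: D P_def)
    moreover have "c * (\<alpha> + 5 * \<beta>) * (\<alpha> * (fst z)^2) \<le> 2 * K * P * (\<alpha> * (fst z)^2)"
      "c * (5 * \<alpha> + \<beta>) * (\<beta> * (snd z)^2) \<le> 2 * K * P * (\<beta> * (snd z)^2)"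
      by (rule mult_right_mono[OF P(1)] mult_right_mono[OF P(2)]; use pos in simp)+
    ultimately show "0 \<le> 2 * K * P + - c * \<alpha> * (\<alpha> + 5 * \<beta>) * (fst z)^2 + - c * \<beta> * (5 * \<alpha> + \<beta>) * (snd z)^2 + 0 * snd z"
      by (simp add: algebra_simps)
  next
    fix z assume "z \<in> closure (elliptic_domain a b)" "z \<notin> elliptic_domain a b"
    then show "1 + - \<alpha> * (fst z)^2 + - \<beta> * (snd z)^2 + 0 * snd z = 0" using cl by (auto simp: D)
  qed (auto simp: D)
qed

text \<open>Treats the hyperbola (\<open>\<kappa> = a^2\<close>) and the wedge
  (\<open>\<kappa> = 0\<close>) at once. Halving the equations for the \<open>x^2\<close> and
  \<open>y^2\<close> coefficients of \<open>q\<close> gives the determinant \<open>6 * Q\<close>;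
  with \<open>\<rho> > 1\<close> its positivity means \<open>\<rho> > (1 + sqrt 2)^2\<close>. It
  makes \<open>c\<close> positive, from which \<open>q \<ge> 0\<close> follows.\<close>

lemma cone_determined:
  assumes D: "D = {z. 0 < (fst z)^2 - \<rho> * (snd z)^2 - \<kappa> \<and> 0 < fst z}" and \<kappa>: "0 \<le> \<kappa>"
    and \<rho>: "1 < \<rho>" "0 < \<rho>^2 - 6 * \<rho> + 1"
  shows "determined_by_two_moments M B D"
proof -
  define K where "K = 1 / (2 * (\<rho> - 1))"
  define Q where "Q = \<rho>^2 - 6 * \<rho> + 1"
  define c where "c = K / (6 * Q)"
  define P where "P = c * ((5 * \<rho> - 1) * (\<rho> - 5))"
  have Q: "0 < Q" using \<rho> by (simp add: Q_def)
  have K: "0 < K" using \<rho> by (simp add: K_def)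
  have hS: "2 * K * (\<rho> - 1) = 1" using \<rho> by (simp add: K_def)
  have hK: "K = 6 * c * Q" using Q by (simp add: c_def)
  have c: "0 < c" using K Q by (simp add: c_def)
  have cl: "closure D \<subseteq> {z. 0 \<le> (fst z)^2 - \<rho> * (snd z)^2 - \<kappa> \<and> 0 \<le> fst z}"
    unfolding D by (intro closure_minimal closed_Collect_conj closed_Collect_le continuous_intros) auto
  show ?thesis
  proof (rule centred_conic_determined[where K = K and ?k0.0 = "-\<kappa>" and ?k1.0 = 1 and ?k2.0 = "-\<rho>"
        and ?A0.0 = "- 2 * K * \<kappa> * P" and ?A1.0 = "c * (5 * \<rho> - 1)" and ?A2.0 = "c * \<rho> * (5 - \<rho>)"])
    show "2 * K * (1 + - \<rho>) = - 1" using hS by (simp add: algebra_simps)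
    show "12 * 1 * (c * (5 * \<rho> - 1)) + 2 * (1 * (c * \<rho> * (5 - \<rho>)) + - \<rho> * (c * (5 * \<rho> - 1))) = - 2 * K * 1"
      unfolding hK Q_def by (simp add: algebra_simps power2_eq_square)
    show "12 * - \<rho> * (c * \<rho> * (5 - \<rho>)) + 2 * (1 * (c * \<rho> * (5 - \<rho>)) + - \<rho> * (c * (5 * \<rho> - 1))) = - 2 * K * - \<rho>"
      unfolding hK Q_def by (simp add: algebra_simps power2_eq_square)
    have "2 * (- \<kappa> * (c * (5 * \<rho> - 1)) + 1 * (- 2 * K * \<kappa> * P)) + 2 * (- \<kappa> * (c * \<rho> * (5 - \<rho>)) + - \<rho> * (- 2 * K * \<kappa> * P))
      = - 2 * \<kappa> * c * ((5 * \<rho> - 1) + \<rho> * (5 - \<rho>)) + 2 * \<kappa> * P * (2 * K * (\<rho> - 1))"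
      by (simp add: algebra_simps)
    also have "\<dots> = - 2 * K * - \<kappa>" unfolding hS unfolding hK P_def Q_def by (simp add: algebra_simps power2_eq_square)
    finally show "2 * (- \<kappa> * (c * (5 * \<rho> - 1)) + 1 * (- 2 * K * \<kappa> * P)) + 2 * (- \<kappa> * (c * \<rho> * (5 - \<rho>)) + - \<rho> * (- 2 * K * \<kappa> * P)) = - 2 * K * - \<kappa>" .
    show "open D" unfolding D by (intro open_Collect_conj open_Collect_less continuous_intros)
    show "0 < K" by (rule K)
    have "1 * (c * \<rho> * (5 - \<rho>)) - - \<rho> * (c * (5 * \<rho> - 1)) = 4 * c * \<rho> * (\<rho> + 1)"
      by (simp add: algebra_simps)
    also have "\<dots> \<noteq> 0" using c \<rho> by simp
    finally show "1 * (c * \<rho> * (5 - \<rho>)) \<noteq> - \<rho> * (c * (5 * \<rho> - 1))" by simp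
    show "(1::real) \<noteq> 0" "- \<rho> \<noteq> 0" using \<rho> by auto
  next
    fix z assume z: "z \<in> D"
    then show "0 < - \<kappa> + 1 * (fst z)^2 + - \<rho> * (snd z)^2 + 0 * snd z" by (simp add: D)
    \<comment> \<open>On \<open>D\<close> one has \<open>x^2 \<ge> \<rho> * y^2 + \<kappa>\<close>.
      Inserting this bound into \<open>q\<close> leaves the \<open>y^2\<close> coefficient
      \<open>4 * c * \<rho> * (\<rho> + 1)\<close> and the constant
      \<open>c * (5 * \<rho> - 1) * \<kappa> * (8 * K)\<close>, both nonnegative.\<close>
    have "c * (5 * \<rho> - 1) * (\<rho> * (snd z)^2 + \<kappa>) \<le> c * (5 * \<rho> - 1) * (fst z)^2"
      using z c \<rho> by (intro mult_left_mono) (auto simp: D)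
    moreover have "0 \<le> 4 * c * \<rho> * (\<rho> + 1) * (snd z)^2" using c \<rho> by simp
    moreover have "0 \<le> c * (5 * \<rho> - 1) * \<kappa> * (8 * K)" using c \<rho> \<kappa> K by simp
    moreover have "c * (5 * \<rho> - 1) * \<kappa> * (8 * K) = c * (5 * \<rho> - 1) * \<kappa> * (2 * K * (\<rho> - 1)) - 2 * K * \<kappa> * P"
      by (simp add: P_def algebra_simps)
    ultimately show "0 \<le> - 2 * K * \<kappa> * P + c * (5 * \<rho> - 1) * (fst z)^2 + c * \<rho> * (5 - \<rho>) * (snd z)^2 + 0 * snd z"
      unfolding hS by (simp add: algebra_simps)
  next
    fix z assume z: "z \<in> closure D" "z \<notin> D"
    then have ge: "0 \<le> (fst z)^2 - \<rho> * (snd z)^2 - \<kappa>" "0 \<le> fst z" using cl by auto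
    have "(fst z)^2 - \<rho> * (snd z)^2 - \<kappa> = 0"
    proof (cases "fst z = 0")
      \<comment> \<open>Where \<open>x = 0\<close> the closed inequality forces \<open>y = 0\<close>
        and \<open>\<kappa> = 0\<close>: only the vertex of a wedge qualifies.\<close>
      case True
      have "0 \<le> \<rho> * (snd z)^2" using \<rho> by simp
      then show ?thesis using True ge(1) \<kappa> by simp
    next
      case False
      then show ?thesis using z(2) ge by (auto simp: D)
    qed
    then show "- \<kappa> + 1 * (fst z)^2 + - \<rho> * (snd z)^2 + 0 * snd z = 0" by simp
  qed (auto simp: D)
qed

text \<open>With \<open>r = a / b\<close> the determinant factors as
  \<open>(r^2 - 2 * r - 1) * (r^2 + 2 * r - 1)\<close>, and the first factor changes sign at
  \<open>r = 1 + sqrt 2\<close>. The sign of \<open>x\<close> already selects the branch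
  \<open>x > a\<close>.\<close>

lemma hyperbolic_determined:
  assumes ab: "0 < a" "0 < b" "a > (1 + sqrt 2) * b"
  shows "determined_by_two_moments M B (hyperbolic_domain a b)"
proof (rule cone_determined[where \<rho> = "(a / b)^2" and \<kappa> = "a^2"])
  define r where "r = a / b"
  have r: "1 + sqrt 2 < r" using ab by (simp add: r_def field_simps)
  have s: "0 \<le> sqrt 2" by simp
  have "1 < r" using r s by linarith
  then show "1 < (a / b)^2" unfolding r_def[symmetric] by (simp add: one_less_power)
  have "sqrt 2 ^ 2 < (r - 1)^2" using r by (intro power_strict_mono) auto
  then have "0 < r^2 - 2 * r - 1" by (simp add: power2_diff)
  moreover have "0 < r^2 + 2 * r - 1" using \<open>1 < r\<close> by (smt (verit) one_less_power pos2)
  ultimately have "0 < (r^2 - 2 * r - 1) * (r^2 + 2 * r - 1)" by simp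
  also have "\<dots> = (r^2)^2 - 6 * r^2 + 1" by (simp add: algebra_simps power2_eq_square)
  finally show "0 < ((a / b)^2)^2 - 6 * (a / b)^2 + 1" unfolding r_def .
  show "hyperbolic_domain a b = {z. 0 < (fst z)^2 - (a / b)^2 * (snd z)^2 - a^2 \<and> 0 < fst z}"
  proof (intro set_eqI)
    fix z :: "real \<times> real"
    obtain x y where z: "z = (x, y)" by (cases z)
    have eq: "x^2 - (a / b)^2 * y^2 - a^2 = a^2 * (x^2 / a^2 - y^2 / b^2 - 1)"
      using ab by (simp add: field_simps)
    have iff: "0 < x^2 - (a / b)^2 * y^2 - a^2 \<longleftrightarrow> x^2 / a^2 - y^2 / b^2 > 1"
      unfolding eq using ab by (simp add: zero_less_mult_iff)
    have "a < x" if "x^2 / a^2 - y^2 / b^2 > 1" "0 < x"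
    proof -
      have "0 \<le> (a / b)^2 * y^2" by simp
      then have "a^2 < x^2" using that(1) unfolding iff[symmetric] by linarith
      then show ?thesis using that(2) by (simp add: power_less_imp_less_base)
    qed
    then show "z \<in> hyperbolic_domain a b \<longleftrightarrow> z \<in> {z. 0 < (fst z)^2 - (a / b)^2 * (snd z)^2 - a^2 \<and> 0 < fst z}"
      using ab iff by (auto simp: z hyperbolic_domain_def)
  qed
qed simp

text \<open>A linear term in \<open>y\<close> replaces the quadratic one, and the system for
  \<open>q\<close> becomes triangular. Both \<open>w\<close> and \<open>q\<close> are affine in
  \<open>x^2\<close> and \<open>y\<close>, hence determine the point up to the sign of
  \<open>x\<close>.\<close>

lemma parabolic_determined:
  assumes c: "0 < c"
  shows "determined_by_two_moments M B (parabolic_domain c)"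
proof -
  define w where "w z = 0 + - c * (fst z)^2 + 0 * (snd z)^2 + 1 * snd z" for z :: "real \<times> real"
  define q where "q z = 5 / (12 * c^3) + - 1 / (12 * c) * (fst z)^2 + 0 * (snd z)^2 + 5 / (12 * c^2) * snd z" for z :: "real \<times> real"
  have D: "parabolic_domain c = {z. 0 < snd z - c * (fst z)^2}" by (auto simp: parabolic_domain_def)
  have op: "open (parabolic_domain c)" unfolding D by (intro open_Collect_less continuous_intros)
  have cl: "closure (parabolic_domain c) \<subseteq> {z. 0 \<le> snd z - c * (fst z)^2}"
    unfolding D by (intro closure_minimal closed_Collect_le continuous_intros) auto
  have w: "0 < w z" if "z \<in> parabolic_domain c" for z using that by (simp add: w_def D)
  have w0: "w z = 0" if "z \<in> closure (parabolic_domain c)" "z \<notin> parabolic_domain c" for z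
    using that cl by (auto simp: w_def D)
  have q: "0 \<le> q z" if "z \<in> parabolic_domain c" for z
  proof -
    have "c * (fst z)^2 < snd z" using that by (simp add: D)
    moreover have "0 \<le> c * (fst z)^2" using c by simp
    ultimately have y: "c * (fst z)^2 \<le> 5 * snd z" by linarith
    have "q z = 5 / (12 * c^3) + (5 * snd z - c * (fst z)^2) / (12 * c^2)"
      using c by (simp add: q_def field_simps power2_eq_square)
    then show ?thesis using y c by simp
  qed
  have eqs: "2 * (1 / (2 * c)) * (- c + 0) = - 1"
      "12 * - c * (- 1 / (12 * c)) + 2 * (- c * 0 + 0 * (- 1 / (12 * c))) = - 2 * (1 / (2 * c)) * - c"
      "12 * 0 * 0 + 2 * (- c * 0 + 0 * (- 1 / (12 * c))) = - 2 * (1 / (2 * c)) * 0"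
      "2 * (- c * (5 / (12 * c^2)) + 1 * (- 1 / (12 * c))) + 6 * (0 * (5 / (12 * c^2)) + 1 * 0) = - 2 * (1 / (2 * c)) * 1"
      "2 * (0 * (- 1 / (12 * c)) + - c * (5 / (12 * c^3))) + 2 * (0 * 0 + 0 * (5 / (12 * c^3)) + 1 * (5 / (12 * c^2))) = - 2 * (1 / (2 * c)) * 0"
    using c by (simp_all add: field_simps power2_eq_square power3_eq_cube)
  show ?thesis
  proof (rule two_moments_determine)
    fix z assume z: "z \<in> parabolic_domain c"
    have K: "0 \<le> 1 / (2 * c)" using c by simp
    show "exit_moment M B (parabolic_domain c) 1 z = ennreal (1 / (2 * c) * w z)"
      "exit_moment M B (parabolic_domain c) 2 z = ennreal (w z * q z)"
      using exit_moments_conic[OF eqs op z K w[unfolded w_def] w0[unfolded w_def] q[unfolded q_def]]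
      by (simp_all add: w_def q_def)
    show "0 \<le> 1 / (2 * c) * w z" "0 \<le> w z * q z" using w[OF z] q[OF z] c by simp_all
  next
    fix z z' assume z: "z \<in> parabolic_domain c" "z' \<in> parabolic_domain c"
      and "1 / (2 * c) * w z = 1 / (2 * c) * w z'" "w z * q z = w z' * q z'"
    then have "w z = w z'" and qq: "q z = q z'" using c w[OF z(1)] by auto
    then have 1: "snd z - snd z' = c * ((fst z)^2 - (fst z')^2)" by (simp add: w_def algebra_simps)
    have "0 = 12 * c^2 * (q z - q z')" using qq by simp
    also have "\<dots> = 5 * (snd z - snd z') - c * ((fst z)^2 - (fst z')^2)"
      using c by (simp add: q_def field_simps power2_eq_square)
    also have "\<dots> = 4 * c * ((fst z)^2 - (fst z')^2)" unfolding 1 by simp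
    finally have x: "(fst z')^2 = (fst z)^2" using c by simp
    then have y: "snd z' = snd z" using 1 by simp
    have "\<exists>g. symmetry_of (parabolic_domain c) g \<and> (fst z', snd z') = g (fst z, snd z)"
      by (rule symmetry_of_signs) (use x y in \<open>auto simp: power2_eq_iff D\<close>)
    then show "\<exists>g. symmetry_of (parabolic_domain c) g \<and> z' = g z" by simp
  qed
qed

end


text \<open>In Cartesian terms the wedge is \<open>\<bar>y\<bar> < tan (\<alpha> / 2) * x\<close>, a
  cone with \<open>\<kappa> = 0\<close>.\<close>

lemma wedge_domain_eq_cone:
  assumes "0 < \<alpha>" "\<alpha> < pi / 4"
  shows "wedge_domain \<alpha> = {z. 0 < (fst z)^2 - (1 / tan (\<alpha> / 2))^2 * (snd z)^2 - 0 \<and> 0 < fst z}"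
proof -
  define m where "m = tan (\<alpha> / 2)"
  have \<alpha>2: "0 < \<alpha> / 2" "\<alpha> / 2 < pi / 2" using assms pi_gt_zero by auto
  have m: "0 < m" unfolding m_def using \<alpha>2 by (rule tan_gt_zero)
  have iff: "0 < x^2 - (1 / m)^2 * y^2 - 0 \<longleftrightarrow> \<bar>y\<bar> < m * x" if "0 < x" for x y :: real
  proof -
    have "0 < x^2 - (1 / m)^2 * y^2 - 0 \<longleftrightarrow> y^2 < (m * x)^2"
      using m by (simp add: field_simps)
    also have "\<dots> \<longleftrightarrow> \<bar>y\<bar> < \<bar>m * x\<bar>" by (metis abs_le_square_iff not_le)
    finally show ?thesis using m that by simp
  qed
  show ?thesis
    unfolding m_def[symmetric]
  proof (intro equalityI subsetI)
    fix z assume "z \<in> wedge_domain \<alpha>"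
    then obtain r \<theta> where z: "z = (r * cos \<theta>, r * sin \<theta>)" and r: "0 < r" and \<theta>: "- \<alpha> / 2 < \<theta>" "\<theta> < \<alpha> / 2"
      by (auto simp: wedge_domain_def)
    have c: "0 < cos \<theta>" using \<theta> \<alpha>2 by (intro cos_gt_zero_pi) auto
    have "tan \<theta> < m" unfolding m_def using \<theta> \<alpha>2 by (intro tan_monotone) auto
    moreover have "tan (- (\<alpha> / 2)) < tan \<theta>" using \<theta> \<alpha>2 by (intro tan_monotone) auto
    ultimately have "\<bar>tan \<theta>\<bar> < m" by (simp add: m_def)
    then have "\<bar>r * sin \<theta>\<bar> < m * (r * cos \<theta>)"
      using c r by (simp add: tan_def abs_mult field_simps)
    then show "z \<in> {z. 0 < (fst z)^2 - (1 / m)^2 * (snd z)^2 - 0 \<and> 0 < fst z}"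
      using iff[of "r * cos \<theta>" "r * sin \<theta>"] r c by (simp add: z)
  next
    fix z assume "z \<in> {z. 0 < (fst z)^2 - (1 / m)^2 * (snd z)^2 - 0 \<and> 0 < fst z}"
    then have x: "0 < fst z" and y: "\<bar>snd z\<bar> < m * fst z" using iff[of "fst z" "snd z"] by auto
    define \<theta> where "\<theta> = arctan (snd z / fst z)"
    define r where "r = fst z * sqrt (1 + (snd z / fst z)^2)"
    have s: "0 < sqrt (1 + (snd z / fst z)^2)" by (simp add: add_pos_nonneg)
    have "z = (r * cos \<theta>, r * sin \<theta>)"
      using x s by (intro prod_eqI) (simp_all add: r_def \<theta>_def cos_arctan sin_arctan)
    moreover have "0 < r" using x s by (simp add: r_def)
    moreover have "- \<alpha> / 2 < \<theta>" "\<theta> < \<alpha> / 2"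
    proof -
      have "arctan m = \<alpha> / 2" unfolding m_def using \<alpha>2 by (intro arctan_tan) auto
      moreover have "snd z / fst z < m" "- m < snd z / fst z" using x y by (auto simp: field_simps abs_less_iff)
      ultimately show "- \<alpha> / 2 < \<theta>" "\<theta> < \<alpha> / 2"
        unfolding \<theta>_def using arctan_less_iff[of "- m"] arctan_less_iff[of _ m] by (auto simp: arctan_minus)
    qed
    ultimately show "z \<in> wedge_domain \<alpha>" unfolding wedge_domain_def by blast
  qed
qed

text \<open>The double angle formula turns \<open>tan \<alpha> < 1\<close> into
  \<open>2 * m < 1 - m^2\<close> for \<open>m = tan (\<alpha> / 2)\<close>; squaring and dividing by
  \<open>m^4\<close> gives the determinant condition.\<close>

lemma (in standard_planar_brownian_motion) wedge_determined:
  assumes "0 < \<alpha>" "\<alpha> < pi / 4"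
  shows "determined_by_two_moments M B (wedge_domain \<alpha>)"
proof (rule cone_determined[OF wedge_domain_eq_cone[OF assms] order.refl])
  define m where "m = tan (\<alpha> / 2)"
  have m: "0 < m" "m < 1"
    unfolding m_def using assms tan_gt_zero[of "\<alpha> / 2"] tan_monotone[of "\<alpha> / 2" "pi / 4"]
    by (auto simp: tan_45)
  have m2: "0 < 1 - m^2" using m by (simp add: power_less_one_iff abs_square_less_1)
  have "tan \<alpha> < 1" using tan_monotone[of \<alpha> "pi / 4"] assms by (simp add: tan_45)
  moreover have "tan (2 * (\<alpha> / 2)) = 2 * m / (1 - m^2)"
    unfolding m_def using assms
    by (intro tan_double) (auto intro!: less_imp_neq[THEN not_sym] cos_gt_zero_pi)
  ultimately have "2 * m / (1 - m^2) < 1" by simp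
  then have "2 * m < 1 - m^2" using m2 by (simp add: pos_divide_less_eq)
  then have "(2 * m)^2 < (1 - m^2)^2" using m by (intro power_strict_mono) auto
  then have pos: "0 < 1 - 6 * m^2 + m^4" by (simp add: power2_diff power_mult_distrib)
  show "1 < (1 / tan (\<alpha> / 2))^2" unfolding m_def[symmetric] using m m2 by (simp add: power_divide)
  have "((1 / m)^2)^2 - 6 * (1 / m)^2 + 1 = (1 - 6 * m^2 + m^4) / m^4"
    using m by (simp add: field_simps)
  then show "0 < ((1 / tan (\<alpha> / 2))^2)^2 - 6 * (1 / tan (\<alpha> / 2))^2 + 1"
    unfolding m_def[symmetric] using pos m by simp
qed

section \<open>The equilateral triangle\<close>

lemma symmetry_of_comp:
  assumes "symmetry_of D f" "symmetry_of D g"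
  shows "symmetry_of D (f \<circ> g)"
proof -
  have "\<And>u v. dist (f u) (f v) = dist u v" "\<And>u v. dist (g u) (g v) = dist u v" "f ` D = D" "g ` D = D"
    using assms unfolding symmetry_of_def by blast+
  then show ?thesis unfolding symmetry_of_def by (simp only: o_apply image_comp[symmetric] simp_thms)
qed

lemma symmetry_of_id: "symmetry_of D id"
  by (simp add: symmetry_of_def)

text \<open>Equal elementary symmetric functions mean the same monic cubic, hence the same roots
  with multiplicity.\<close>

lemma vieta3_permutation:
  fixes a b c a' b' c' :: real
  assumes s1: "a' + b' + c' = a + b + c" and s2: "a' * b' + b' * c' + c' * a' = a * b + b * c + c * a"
    and s3: "a' * b' * c' = a * b * c"
  shows "(a', b', c') \<in> {(a, b, c), (a, c, b), (b, a, c), (b, c, a), (c, a, b), (c, b, a)}"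
proof -
  have root: "(r - a) * (r - b) * (r - c) = (r - a') * (r - b') * (r - c')" for r
  proof -
    have "(r - x) * (r - y) * (r - z) = r^3 - (x + y + z) * r^2 + (x * y + y * z + z * x) * r - x * y * z" for x y z :: real
      by (simp add: algebra_simps power2_eq_square power3_eq_cube)
    then show ?thesis using assms by simp
  qed
  have pair: "y' = y \<and> z' = z \<or> y' = z \<and> z' = y"
    if "x + y' + z' = x + y + z" "x * y' + y' * z' + z' * x = x * y + y * z + z * x" for x y z y' z' :: real
  proof -
    have z': "z' = y + z - y'" using that(1) by simp
    have "(y' - y) * (y' - z) = 0" using that(2) unfolding z' by (simp add: algebra_simps)
    then show ?thesis using z' by auto
  qed
  have "(a' - a) * (a' - b) * (a' - c) = 0" unfolding root by simp
  then consider "a' = a" | "a' = b" | "a' = c" by auto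
  then show ?thesis
  proof cases
    case 1
    then show ?thesis using pair[of a b' c' b c] s1 s2 by auto
  next
    case 2
    then show ?thesis using pair[of b b' c' a c] s1 s2 by (auto simp: algebra_simps)
  next
    case 3
    then show ?thesis using pair[of c b' c' a b] s1 s2 by (auto simp: algebra_simps)
  qed
qed

text \<open>Distances of a point from the three sides of the triangle.\<close>

definition side1 :: "real \<Rightarrow> real \<times> real \<Rightarrow> real" where "side1 b z = snd z"
definition side2 :: "real \<Rightarrow> real \<times> real \<Rightarrow> real" where "side2 b z = (b - snd z - sqrt 3 * fst z) / 2"
definition side3 :: "real \<Rightarrow> real \<times> real \<Rightarrow> real" where "side3 b z = (b - snd z + sqrt 3 * fst z) / 2"

lemmas side_defs = side1_def side2_def side3_def

lemma sum_sides: "side1 b z + side2 b z + side3 b z = b"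
  by (simp add: side_defs field_simps)

lemma sides_inj:
  assumes "side1 b z = side1 b w" "side2 b z = side2 b w"
  shows "z = w"
  using assms by (intro prod_eqI) (simp_all add: side_defs)

lemma equilateral_triangle_sides:
  assumes "0 < b"
  shows "equilateral_triangle b = {z. 0 < side1 b z \<and> 0 < side2 b z \<and> 0 < side3 b z}"
proof (rule set_eqI)
  fix z :: "real \<times> real"
  obtain x y where z: "z = (x, y)" by (cases z)
  have "\<bar>x\<bar> < b / sqrt 3" if "0 < y" "sqrt 3 * \<bar>x\<bar> < b - y"
    using that by (simp add: field_simps)
  moreover have "sqrt 3 * \<bar>x\<bar> < b - y \<longleftrightarrow> 0 < side2 b z \<and> 0 < side3 b z"
  proof -
    have "sqrt 3 * \<bar>x\<bar> = \<bar>sqrt 3 * x\<bar>" by (simp add: abs_mult)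
    then show ?thesis by (auto simp: z side_defs)
  qed
  ultimately show "z \<in> equilateral_triangle b \<longleftrightarrow> z \<in> {z. 0 < side1 b z \<and> 0 < side2 b z \<and> 0 < side3 b z}"
    by (auto simp: z side_defs equilateral_triangle_def abs_less_iff)
qed

text \<open>The reflection exchanging the first two sides, found by solving for the point whose
  distances to them are interchanged.\<close>

definition swap12 :: "real \<Rightarrow> real \<times> real \<Rightarrow> real \<times> real" where
  "swap12 b z = ((b / sqrt 3 - sqrt 3 * snd z + fst z) / 2, (b - snd z - sqrt 3 * fst z) / 2)"

definition swap23 :: "real \<times> real \<Rightarrow> real \<times> real" where
  "swap23 z = (0 + (-1) * fst z, 0 + 1 * snd z)"

lemma sides_swap:
  "side1 b (swap12 b z) = side2 b z" "side2 b (swap12 b z) = side1 b z" "side3 b (swap12 b z) = side3 b z"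
  "side1 b (swap23 z) = side1 b z" "side2 b (swap23 z) = side3 b z" "side3 b (swap23 z) = side2 b z"
  by (simp_all add: side_defs swap12_def swap23_def field_simps)

lemma symmetry_swap:
  assumes "0 < b"
  shows "symmetry_of (equilateral_triangle b) (swap12 b)" "symmetry_of (equilateral_triangle b) swap23"
proof -
  show "symmetry_of (equilateral_triangle b) (swap12 b)"
  proof (rule symmetry_ofI)
    show "dist (swap12 b u) (swap12 b v) = dist u v" for u v
    proof -
      define p where "p = fst u - fst v"
      define q where "q = snd u - snd v"
      have 1: "fst (swap12 b u) - fst (swap12 b v) = (p - sqrt 3 * q) / 2"
        "snd (swap12 b u) - snd (swap12 b v) = (- q - sqrt 3 * p) / 2"
        by (simp_all add: swap12_def p_def q_def algebra_simps diff_divide_distrib add_divide_distrib)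
      have "((p - sqrt 3 * q) / 2)^2 + ((- q - sqrt 3 * p) / 2)^2 = p^2 + q^2"
        by (simp add: power_divide power2_diff power_mult_distrib field_simps)
      then show ?thesis unfolding dist_prod_def dist_real_def power2_abs 1 by (simp add: p_def q_def)
    qed
    show "swap12 b z \<in> equilateral_triangle b \<longleftrightarrow> z \<in> equilateral_triangle b" for z
      unfolding equilateral_triangle_sides[OF assms] by (auto simp: sides_swap)
    show "surj (swap12 b)"
      by (intro surjI[of _ "swap12 b"] sides_inj[of b]) (simp_all add: sides_swap)
  qed
  show "symmetry_of (equilateral_triangle b) swap23"
    unfolding swap23_def by (intro symmetry_of_axis_maps) (auto simp: equilateral_triangle_def)
qed

context standard_planar_brownian_motion
begin

text \<open>The distances to the sides add up to the constant \<open>b\<close>, so their product and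
  second symmetric function, which the two moments supply, fix them up to order. Every permutation
  of the distances comes from a symmetry.\<close>

lemma triangle_determined:
  assumes b: "0 < b"
  shows "determined_by_two_moments M B (equilateral_triangle b)"
proof -
  let ?D = "equilateral_triangle b"
  define e3 where "e3 z = side1 b z * side2 b z * side3 b z" for z
  define e2 where "e2 z = side1 b z * side2 b z + side2 b z * side3 b z + side3 b z * side1 b z" for z
  define u1 where "u1 z = e3 z / b" for z
  define u2 where "u2 z = e3 z * e2 z / (6 * b)" for z
  have D: "?D = {z. 0 < side1 b z \<and> 0 < side2 b z \<and> 0 < side3 b z}" by (rule equilateral_triangle_sides[OF b])
  have op: "open ?D"
    unfolding D side_defs by (intro open_Collect_conj open_Collect_less continuous_intros) auto
  have cl: "closure ?D \<subseteq> {z. 0 \<le> side1 b z \<and> 0 \<le> side2 b z \<and> 0 \<le> side3 b z}"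
    unfolding D unfolding side_defs
    by (intro closure_minimal closed_Collect_conj closed_Collect_le continuous_intros) auto
  have pos: "0 < e3 z" "0 < e2 z" if "z \<in> ?D" for z
    using that by (auto simp: D e3_def e2_def intro!: add_pos_pos)
  have u_pos: "0 \<le> u1 z" "0 \<le> u2 z" if "z \<in> ?D" for z
    using pos[OF that] b by (simp_all add: u1_def u2_def)
  have bd: "u1 z = 0" "u2 z = 0" if "z \<in> closure ?D" "z \<notin> ?D" for z
  proof -
    have "e3 z = 0" using that cl by (auto simp: D e3_def)
    then show "u1 z = 0" "u2 z = 0" by (simp_all add: u1_def u2_def)
  qed
  have side23: "side2 b z * side3 b z = ((b - snd z)^2 - 3 * (fst z)^2) / 4" for z
    by (simp add: side_defs power2_eq_square algebra_simps) 
  have e3_eq: "e3 z = (b^2 * snd z - 2 * b * snd z ^ 2 + snd z ^ 3 - 3 * fst z ^ 2 * snd z) / 4" for z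
    unfolding e3_def mult.assoc side23 by (simp add: side1_def power2_eq_square power3_eq_cube algebra_simps)
  have e2_eq: "e2 z = (b^2 + 2 * b * snd z - 3 * snd z ^ 2 - 3 * fst z ^ 2) / 4" for z
  proof -
    have "e2 z = side2 b z * side3 b z + side1 b z * (side2 b z + side3 b z)" by (simp add: e2_def algebra_simps)
    also have "side2 b z + side3 b z = b - snd z" by (simp add: side_defs field_simps)
    finally show ?thesis unfolding side23 by (simp add: side1_def power2_eq_square field_simps)
  qed
  have cal1: "caloric (\<lambda>t z. t + u1 z)"
  \<comment> \<open>The coefficients of \<open>e3_eq\<close> divided by \<open>b\<close>.\<close>
  proof (rule caloric_polynomial[of _ "[(b / 4, 0, 1), (- 1 / 2, 0, 2), (1 / (4 * b), 0, 3), (- 3 / (4 * b), 2, 1)]"])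
    fix t x y
    show "t + u1 (x, y) = (\<Sum>(a, i, j)\<leftarrow>[(b / 4, 0, 1), (- 1 / 2, 0, 2), (1 / (4 * b), 0, 3), (- 3 / (4 * b), 2, 1)].
        a * (heat_poly i t x * heat_poly j t y))"
      using b by (simp add: u1_def e3_eq heat_poly_simps field_simps power2_eq_square power3_eq_cube)
  qed simp
  have cal2: "caloric (\<lambda>t z. t^2 + 2 * t * u1 z + u2 z)"
  \<comment> \<open>The coefficients of the quintic \<open>e3 * e2 / (6 * b)\<close>, in which the
    terms in \<open>y^2\<close> and \<open>x^2 * y^2\<close> cancel.\<close>
  proof (rule caloric_polynomial[of _ "[(b^3 / 96, 0, 1), (- b / 16, 0, 3), (- b / 16, 2, 1), (1 / 12, 0, 4),
      (- 1 / (32 * b), 0, 5), (1 / (16 * b), 2, 3), (3 / (32 * b), 4, 1)]"])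
    fix t x y
    show "t^2 + 2 * t * u1 (x, y) + u2 (x, y) = (\<Sum>(a, i, j)\<leftarrow>[(b^3 / 96, 0, 1), (- b / 16, 0, 3), (- b / 16, 2, 1), (1 / 12, 0, 4),
      (- 1 / (32 * b), 0, 5), (1 / (16 * b), 2, 3), (3 / (32 * b), 4, 1)].
        a * (heat_poly i t x * heat_poly j t y))"
      using b by (simp add: u1_def u2_def e2_eq e3_eq heat_poly_simps field_simps power_numeral_reduce)
  qed simp
  have bound: "(u1 z)^2 + u2 z \<le> 2 * b^4 * (1 + fst z ^ 4 + snd z ^ 4)" if z: "z \<in> ?D" for z
  proof -
    have l: "0 < side1 b z" "0 < side2 b z" "0 < side3 b z" using z by (auto simp: D)
    then have lb: "side1 b z \<le> b" "side2 b z \<le> b" "side3 b z \<le> b" using sum_sides[of b z] by linarith+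
    have "e3 z \<le> b * b * b" unfolding e3_def using l lb b by (intro mult_mono) auto
    then have e3b: "e3 z \<le> b^3" by (simp add: power3_eq_cube)
    have "e2 z \<le> b * b + b * b + b * b" unfolding e2_def using l lb b by (intro add_mono mult_mono) auto
    then have e2b: "e2 z \<le> 3 * b^2" by (simp add: power2_eq_square)
    have "u1 z \<le> b^3 / b" unfolding u1_def using e3b b by (intro divide_right_mono) auto
    then have "u1 z \<le> b^2" using b by (simp add: power2_eq_square power3_eq_cube)
    then have "(u1 z)^2 \<le> (b^2)^2" using u_pos[OF z] by (intro power_mono) auto
    then have 1: "(u1 z)^2 \<le> b^4" by simp
    have "e3 z * e2 z \<le> b^3 * (3 * b^2)" using pos[OF z] e3b e2b b by (intro mult_mono) auto
    then have "u2 z \<le> b^3 * (3 * b^2) / (6 * b)" unfolding u2_def using b by (intro divide_right_mono) auto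
    also have "\<dots> = b^4 / 2" using b by (simp add: power_numeral_reduce field_simps)
    also have "\<dots> \<le> b^4" by simp
    finally have "(u1 z)^2 + u2 z \<le> 2 * b^4 * 1" using 1 by simp
    also have "\<dots> \<le> 2 * b^4 * (1 + fst z ^ 4 + snd z ^ 4)" by (intro mult_left_mono) auto
    finally show ?thesis .
  qed
  have C: "0 \<le> 2 * b^4" by simp
  note moments = exit_moments_eqI[OF op _ cal1 cal2 u_pos bd bound C]
  show ?thesis
  proof (rule two_moments_determine[OF moments u_pos])
    fix p q assume pq: "p \<in> ?D" "q \<in> ?D" "u1 p = u1 q" "u2 p = u2 q"
    then have 3: "e3 q = e3 p" using b by (simp add: u1_def)
    then have 2: "e2 q = e2 p" using b pos[OF pq(1)] pq(4) by (simp add: u2_def)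
    have *: "(side1 b q, side2 b q, side3 b q) \<in>
      {(side1 b p, side2 b p, side3 b p), (side1 b p, side3 b p, side2 b p), (side2 b p, side1 b p, side3 b p),
       (side2 b p, side3 b p, side1 b p), (side3 b p, side1 b p, side2 b p), (side3 b p, side2 b p, side1 b p)}"
      using 2 3 sum_sides[of b] unfolding e2_def e3_def by (intro vieta3_permutation) auto
    \<comment> \<open>The six permutations as words in two generating reflections.\<close>
    have "q = id p \<or> q = swap23 p \<or> q = swap12 b p \<or> q = (swap23 \<circ> swap12 b) p
        \<or> q = (swap12 b \<circ> swap23) p \<or> q = (swap23 \<circ> (swap12 b \<circ> swap23)) p"
    proof -
      have "q = w \<longleftrightarrow> side1 b q = side1 b w \<and> side2 b q = side2 b w" for w
        using sides_inj by blast
      then show ?thesis using * by (simp add: sides_swap) blast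
    qed
    moreover note symmetry_of_id[of ?D] symmetry_swap[OF b] symmetry_of_comp
    ultimately show "\<exists>g. symmetry_of ?D g \<and> q = g p" by blast
  qed
qed

end


section \<open>The rectangle\<close>

text \<open>The gamma integral, read off from the normalisation of the Erlang density.\<close>

lemma integral_power_exp:
  assumes l: "0 < (l::real)"
  shows "has_bochner_integral lborel (\<lambda>t. indicator {0..} t * t ^ k * exp (- l * t)) (fact k / l ^ Suc k)"
proof -
  have "has_bochner_integral lborel (\<lambda>t. erlang_density k l t) 1"
    using nn_integral_erlang_ith_moment[OF l, of k 0] l by (intro has_bochner_integral_nn_integral) auto
  from has_bochner_integral_mult_right[OF this, of "fact k / l ^ Suc k"]
  have "has_bochner_integral lborel (\<lambda>t. fact k / l ^ Suc k * erlang_density k l t) (fact k / l ^ Suc k)" by simp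
  moreover have "(\<lambda>t. fact k / l ^ Suc k * erlang_density k l t) = (\<lambda>t. indicator {0..} t * t ^ k * exp (- l * t))"
    using l by (auto simp: erlang_density_def fun_eq_iff indicator_def)
  ultimately show ?thesis by simp
qed

text \<open>The moments of high order see only the slowest exponential.\<close>

lemma leading_exponential_unique:
  fixes f :: "real \<Rightarrow> real"
  assumes f: "f \<in> borel_measurable borel" and \<mu>: "0 < \<mu>" "\<mu> < \<nu>"
    and bound: "\<And>t. 0 \<le> t \<Longrightarrow> \<bar>f t - d * exp (- \<mu> * t)\<bar> \<le> C * exp (- \<nu> * t)"
    and zero: "\<And>k. integral\<^sup>L lborel (\<lambda>t. indicator {0..} t * t ^ k * f t) = 0"
  shows "d = 0"
proof -
  have C: "0 \<le> C" using bound[of 0] by simp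
  \<comment> \<open>Integrating the pointwise bound against \<open>t ^ k\<close> gives
    \<open>\<bar>d\<bar> / \<mu> ^ Suc k \<le> C / \<nu> ^ Suc k\<close> once \<open>fact k\<close>
    is cancelled.\<close>
  have le: "\<bar>d\<bar> \<le> C * (\<mu> / \<nu>) ^ Suc k" for k
  proof -
    let ?g = "\<lambda>t. indicator {0..} t * t ^ k * f t"
    let ?h = "\<lambda>l t. indicator {0..} t * t ^ k * exp (- l * t) :: real"
    have h: "integrable lborel (?h l)" "integral\<^sup>L lborel (?h l) = fact k / l ^ Suc k" if "0 < l" for l
      using integral_power_exp[OF that, of k] by (auto simp: has_bochner_integral_iff)
    have \<nu>: "0 < \<nu>" using \<mu> by simp
    have pt: "\<bar>?g t - d * ?h \<mu> t\<bar> \<le> C * ?h \<nu> t" for t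
    proof (cases "0 \<le> t")
      case True
      have "t ^ k * \<bar>f t - d * exp (- \<mu> * t)\<bar> \<le> t ^ k * (C * exp (- \<nu> * t))"
        using bound[OF True] True by (intro mult_left_mono) auto
      moreover have "\<bar>t ^ k * f t - d * (t ^ k * exp (- \<mu> * t))\<bar> = t ^ k * \<bar>f t - d * exp (- \<mu> * t)\<bar>"
      proof -
        have "t ^ k * f t - d * (t ^ k * exp (- \<mu> * t)) = t ^ k * (f t - d * exp (- \<mu> * t))"
          by (simp add: algebra_simps)
        then show ?thesis using True by (simp only: abs_mult) simp
      qed
      ultimately show ?thesis using True by (simp add: mult_ac)
    qed simp
    have diff: "integrable lborel (\<lambda>t. ?g t - d * ?h \<mu> t)"
    proof (rule Bochner_Integration.integrable_bound)
      show "integrable lborel (\<lambda>t. C * ?h \<nu> t)" using h[OF \<nu>] by (intro integrable_mult_right) auto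
      show "AE t in lborel. norm (?g t - d * ?h \<mu> t) \<le> norm (C * ?h \<nu> t)"
        using pt order.trans[OF pt abs_ge_self] by (intro AE_I2) simp
    qed (use f in measurable)
    then have "integrable lborel (\<lambda>t. (?g t - d * ?h \<mu> t) + d * ?h \<mu> t)"
      using h[OF \<mu>(1)] by (intro Bochner_Integration.integrable_add integrable_mult_right) auto
    then have g: "integrable lborel ?g" by simp
    have "\<bar>integral\<^sup>L lborel (\<lambda>t. ?g t - d * ?h \<mu> t)\<bar> \<le> integral\<^sup>L lborel (\<lambda>t. \<bar>?g t - d * ?h \<mu> t\<bar>)"
      by (rule integral_abs_bound)
    also have "\<dots> \<le> integral\<^sup>L lborel (\<lambda>t. C * ?h \<nu> t)"
      using diff h[OF \<nu>] pt by (intro integral_mono integrable_abs integrable_mult_right) auto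
    also have "\<dots> = C * (fact k / \<nu> ^ Suc k)"
      using h[OF \<nu>] by (subst integral_mult_right_zero) auto
    also have "integral\<^sup>L lborel (\<lambda>t. ?g t - d * ?h \<mu> t) = 0 - d * (fact k / \<mu> ^ Suc k)"
      using h[OF \<mu>(1)] g zero[of k] by (subst Bochner_Integration.integral_diff) auto
    finally have "\<bar>d\<bar> * (fact k / \<mu> ^ Suc k) \<le> C * (fact k / \<nu> ^ Suc k)"
      using \<mu> by (simp add: abs_mult)
    then have "(\<bar>d\<bar> * (fact k / \<mu> ^ Suc k)) * (\<mu> ^ Suc k / fact k) \<le> (C * (fact k / \<nu> ^ Suc k)) * (\<mu> ^ Suc k / fact k)"
      using \<mu> by (intro mult_right_mono) auto
    then show ?thesis using \<mu> by (simp add: power_divide)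
  qed
  have "(\<lambda>k. C * (\<mu> / \<nu>) ^ Suc k) \<longlonglongrightarrow> C * 0"
    using \<mu> by (intro tendsto_mult tendsto_const LIMSEQ_Suc[OF LIMSEQ_realpow_zero]) auto
  then have "\<bar>d\<bar> \<le> C * 0" by (rule LIMSEQ_le_const) (use le in auto)
  then show ?thesis by simp
qed

text \<open>The second exponential is first absorbed into the remainder; once \<open>d1 = 0\<close>
  it is itself the leading one.\<close>

lemma two_exponentials_unique:
  fixes f :: "real \<Rightarrow> real"
  assumes f: "f \<in> borel_measurable borel" and \<mu>: "0 < \<mu>1" "\<mu>1 < \<mu>2" "\<mu>2 < \<mu>3"
    and bound: "\<And>t. 0 \<le> t \<Longrightarrow> \<bar>f t - d1 * exp (- \<mu>1 * t) - d2 * exp (- \<mu>2 * t)\<bar> \<le> C * exp (- \<mu>3 * t)"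
    and zero: "\<And>k. integral\<^sup>L lborel (\<lambda>t. indicator {0..} t * t ^ k * f t) = 0"
  shows "d1 = 0" "d2 = 0"
proof -
  have C: "0 \<le> C" using bound[of 0] by simp
  have "\<bar>f t - d1 * exp (- \<mu>1 * t)\<bar> \<le> (\<bar>d2\<bar> + C) * exp (- \<mu>2 * t)" if t: "0 \<le> t" for t
  proof -
    have "C * exp (- \<mu>3 * t) \<le> C * exp (- \<mu>2 * t)"
      using C \<mu> t by (intro mult_left_mono) (auto intro: mult_right_mono)
    moreover have "\<bar>d2 * exp (- \<mu>2 * t)\<bar> = \<bar>d2\<bar> * exp (- \<mu>2 * t)" by (simp add: abs_mult)
    ultimately show ?thesis using bound[OF t] unfolding distrib_right by linarith
  qed
  then show d1: "d1 = 0" using leading_exponential_unique[OF f \<mu>(1,2) _ zero] by blast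
  show "d2 = 0"
    using leading_exponential_unique[OF f _ \<mu>(3), of d2 C] bound zero \<mu> unfolding d1 by simp
qed

section \<open>The sine series of the constant 1\<close>

text \<open>Sine coefficients of \<open>1\<close> on the interval from \<open>0\<close> to
  \<open>pi\<close>: \<open>4 / (pi * n)\<close> for odd \<open>n\<close> and zero otherwise,
  including \<open>n = 0\<close>, where the numerator vanishes.\<close>

definition odd_coeff :: "nat \<Rightarrow> real" where
  "odd_coeff n = 2 * (1 - (-1) ^ n) / (pi * real n)"

lemma odd_coeff_simps:
  "odd_coeff 0 = 0" "odd_coeff 1 = 4 / pi" "odd_coeff 2 = 0" "odd_coeff 3 = 4 / (3 * pi)" "odd_coeff 4 = 0"
  by (simp_all add: odd_coeff_def)

lemma odd_coeff_bound: "\<bar>odd_coeff n\<bar> \<le> 2"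
proof (cases "n = 0")
  case False
  have "\<bar>2 * (1 - (-1) ^ n)\<bar> \<le> (4::real)" by (cases "even n") auto
  then have "\<bar>odd_coeff n\<bar> \<le> 4 / (pi * real n)"
    unfolding odd_coeff_def abs_divide by (intro frac_le) (use False in auto)
  also have "\<dots> \<le> 4 / (2 * 1)" using False pi_ge_two by (intro divide_left_mono mult_mono) auto
  finally show ?thesis by simp
qed (simp add: odd_coeff_def)

definition sine_sum :: "(nat \<Rightarrow> real) \<Rightarrow> nat \<Rightarrow> real \<Rightarrow> real" where
  "sine_sum a N \<theta> = (\<Sum>n<N. odd_coeff n * a n * sin (real n * \<theta>))"

text \<open>Up to the factor \<open>2 / pi\<close> this is the imaginary part of
  \<open>ln (1 + z) - ln (1 - z)\<close> at \<open>z = r * cis \<theta>\<close>, where the even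
  powers cancel. The closed form makes uniform bounds and the limit \<open>r = 1\<close>
  immediate.\<close>

lemma odd_sine_series:
  assumes r: "0 \<le> r" "r < 1"
  shows "(\<lambda>n. odd_coeff n * r ^ n * sin (real n * \<theta>)) sums
    (2 / pi * (Arg (1 + of_real r * cis \<theta>) - Arg (1 - of_real r * cis \<theta>)))"
proof -
  define z where "z = of_real r * cis \<theta>"
  have z: "cmod z < 1" using r by (simp add: z_def norm_mult)
  have nz: "1 + z \<noteq> 0" "1 - z \<noteq> 0" using z by (auto simp: add_eq_0_iff norm_minus_commute)
  have "(\<lambda>n. (-1) ^ Suc n / of_nat n * z ^ n - (-1) ^ Suc n / of_nat n * (- z) ^ n) sums (ln (1 + z) - ln (1 + - z))"
    using z by (intro sums_diff Ln_series) auto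
  moreover have "(-1) ^ Suc n / of_nat n * z ^ n - (-1) ^ Suc n / of_nat n * (- z) ^ n
      = of_real ((1 - (-1) ^ n) / real n) * z ^ n" for n
    by (cases "even n") (auto simp: power_minus[of z] diff_divide_distrib left_diff_distrib)
  ultimately have "(\<lambda>n. of_real ((1 - (-1) ^ n) / real n) * z ^ n) sums (ln (1 + z) - ln (1 - z))" by simp
  then have "(\<lambda>n. Im (of_real ((1 - (-1) ^ n) / real n) * z ^ n)) sums Im (ln (1 + z) - ln (1 - z))"
    by (rule sums_Im)
  moreover have "Im (of_real ((1 - (-1) ^ n) / real n) * z ^ n) = (1 - (-1) ^ n) / real n * (r ^ n * sin (real n * \<theta>))" for n
    by (simp add: z_def power_mult_distrib Complex.DeMoivre flip: of_real_power)
  moreover have "Im (ln (1 + z) - ln (1 - z)) = Arg (1 + z) - Arg (1 - z)"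
    using nz by (simp add: Arg_eq_Im_Ln)
  ultimately have "(\<lambda>n. (1 - (-1) ^ n) / real n * (r ^ n * sin (real n * \<theta>))) sums (Arg (1 + z) - Arg (1 - z))"
    by (simp only:)
  from sums_mult[OF this, of "2 / pi"]
  have "(\<lambda>n. 2 / pi * ((1 - (-1) ^ n) / real n * (r ^ n * sin (real n * \<theta>)))) sums (2 / pi * (Arg (1 + z) - Arg (1 - z)))" .
  moreover have "2 / pi * ((1 - (-1) ^ n) / real n * (r ^ n * sin (real n * \<theta>))) = odd_coeff n * r ^ n * sin (real n * \<theta>)" for n
    by (simp add: odd_coeff_def)
  ultimately show ?thesis by (simp only: z_def)
qed

text \<open>Half-angle factorisation of \<open>1 + cis \<theta>\<close> and
  \<open>1 - cis \<theta>\<close>. The two arguments differ by \<open>pi / 2\<close>, which is what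
  gives the series the value \<open>1\<close>.\<close>

lemma Arg_one_plus_cis:
  assumes "0 < \<theta>" "\<theta> < pi"
  shows "Arg (1 + cis \<theta>) = \<theta> / 2" "Arg (1 - cis \<theta>) = \<theta> / 2 - pi / 2"
proof -
  have dbl: "cos \<theta> = 2 * cos (\<theta> / 2) ^ 2 - 1" "cos \<theta> = 1 - 2 * sin (\<theta> / 2) ^ 2"
    "sin \<theta> = 2 * sin (\<theta> / 2) * cos (\<theta> / 2)"
    using cos_double_cos[of "\<theta> / 2"] cos_double_sin[of "\<theta> / 2"] sin_double[of "\<theta> / 2"] by simp_all
  have "1 + cis \<theta> = of_real (2 * cos (\<theta> / 2)) * exp (\<i> * complex_of_real (\<theta> / 2))"
    unfolding cis_conv_exp[symmetric] by (simp add: complex_eq_iff dbl(1,3) power2_eq_square)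
  moreover have "0 < cos (\<theta> / 2)" using assms by (intro cos_gt_zero_pi) auto
  ultimately show "Arg (1 + cis \<theta>) = \<theta> / 2"
    using assms by (intro Arg_unique[of "2 * cos (\<theta> / 2)"]) auto
  have "1 - cis \<theta> = of_real (2 * sin (\<theta> / 2)) * exp (\<i> * complex_of_real (\<theta> / 2 - pi / 2))"
    unfolding cis_conv_exp[symmetric] by (simp add: complex_eq_iff dbl(2,3) cos_diff sin_diff power2_eq_square)
  moreover have "0 < sin (\<theta> / 2)" using assms by (intro sin_gt_zero) auto
  ultimately show "Arg (1 - cis \<theta>) = \<theta> / 2 - pi / 2"
    using assms by (intro Arg_unique[of "2 * sin (\<theta> / 2)"]) auto
qed

text \<open>Abel summation of the Fourier sine series of the constant \<open>1\<close> on \<open>(0, \<pi>)\<close>.\<close>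

lemma bounded_sine_approximation:
  obtains r :: "nat \<Rightarrow> real" and N :: "nat \<Rightarrow> nat" where
    "\<And>k. 0 \<le> r k" "\<And>k. r k < 1" "r \<longlonglongrightarrow> 1" "\<And>k. 5 \<le> N k"
    "\<And>k \<theta>. \<bar>sine_sum (\<lambda>n. r k ^ n) (N k) \<theta>\<bar> \<le> 5"
    "\<And>\<theta>. 0 < \<theta> \<Longrightarrow> \<theta> < pi \<Longrightarrow> (\<lambda>k. sine_sum (\<lambda>n. r k ^ n) (N k) \<theta>) \<longlonglongrightarrow> 1"
proof -
  define r where "r k = 1 - 1 / (real k + 2)" for k :: nat
  have r: "0 \<le> r k" "r k < 1" for k by (auto simp: r_def field_simps)
  have r1: "r \<longlonglongrightarrow> 1"
  proof -
    have "(\<lambda>k. 1 - 1 / real (k + 2)) \<longlonglongrightarrow> 1 - 0"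
      by (intro tendsto_intros LIMSEQ_ignore_initial_segment[OF lim_1_over_n])
    then show ?thesis by (simp add: r_def[abs_def] add.commute)
  qed
  define S where "S k \<theta> = 2 / pi * (Arg (1 + of_real (r k) * cis \<theta>) - Arg (1 - of_real (r k) * cis \<theta>))" for k \<theta>
  \<comment> \<open>Comparison with a geometric series, uniformly in \<open>\<theta>\<close>, so
    that one truncation index per \<open>k\<close> serves all angles.\<close>
  have tail: "\<bar>S k \<theta> - sine_sum (\<lambda>n. r k ^ n) N \<theta>\<bar> \<le> 2 * r k ^ N / (1 - r k)" for k \<theta> N
  proof -
    let ?a = "\<lambda>n. odd_coeff n * r k ^ n * sin (real n * \<theta>)"
    have s: "?a sums S k \<theta>" unfolding S_def by (rule odd_sine_series[OF r])
    have le: "norm (?a (n + N)) \<le> 2 * r k ^ N * r k ^ n" for n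
    proof -
      have "\<bar>odd_coeff (n + N)\<bar> * (r k ^ (n + N) * \<bar>sin (real (n + N) * \<theta>)\<bar>) \<le> 2 * (r k ^ (n + N) * 1)"
        using odd_coeff_bound r by (intro mult_mono) auto
      then show ?thesis using r by (simp add: abs_mult power_add mult_ac)
    qed
    have g: "(\<lambda>n. 2 * r k ^ N * r k ^ n) sums (2 * r k ^ N * (1 / (1 - r k)))"
      using r by (intro sums_mult geometric_sums) auto
    have "S k \<theta> - sine_sum (\<lambda>n. r k ^ n) N \<theta> = (\<Sum>n. ?a (n + N))"
      using suminf_minus_initial_segment[of ?a N] s by (simp add: sums_iff sine_sum_def)
    also have "norm \<dots> \<le> (\<Sum>n. 2 * r k ^ N * r k ^ n)"
      by (rule norm_suminf_le[OF le]) (use g in \<open>simp add: sums_iff\<close>)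
    also have "\<dots> = 2 * r k ^ N / (1 - r k)" using g by (simp add: sums_iff)
    finally show ?thesis by simp
  qed
  \<comment> \<open>At least five terms, so that the harmonics 1 and 3 are always included.\<close>
  have "\<exists>N\<ge>5. 2 * r k ^ N / (1 - r k) \<le> 1 / (real k + 1)" for k
  proof -
    have "(\<lambda>N. 2 * r k ^ N / (1 - r k)) \<longlonglongrightarrow> 2 * 0 / (1 - r k)"
      using r[of k] by (intro tendsto_intros LIMSEQ_realpow_zero) auto
    then have "\<forall>\<^sub>F N in sequentially. 2 * r k ^ N / (1 - r k) < 1 / (real k + 1)"
      by (intro order_tendstoD) auto
    then have "\<forall>\<^sub>F N in sequentially. 5 \<le> N \<and> 2 * r k ^ N / (1 - r k) \<le> 1 / (real k + 1)"
      using eventually_ge_at_top[of 5] by eventually_elim auto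
    then show ?thesis by (auto simp: eventually_sequentially)
  qed
  then obtain N where N: "\<And>k. 5 \<le> N k" "\<And>k. 2 * r k ^ N k / (1 - r k) \<le> 1 / (real k + 1)" by metis
  have close: "\<bar>S k \<theta> - sine_sum (\<lambda>n. r k ^ n) (N k) \<theta>\<bar> \<le> 1 / (real k + 1)" for k \<theta>
    using tail[of k \<theta> "N k"] N(2)[of k] by linarith
  \<comment> \<open>Two principal arguments differ by at most \<open>2 * pi\<close>, so
    \<open>\<bar>S k \<theta>\<bar> \<le> 4\<close>; truncation adds at most one.\<close>
  have "\<bar>sine_sum (\<lambda>n. r k ^ n) (N k) \<theta>\<bar> \<le> 5" for k \<theta>
  proof -
    have "\<bar>Arg (1 + of_real (r k) * cis \<theta>) - Arg (1 - of_real (r k) * cis \<theta>)\<bar> \<le> 2 * pi"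
      using mpi_less_Arg[of "1 + of_real (r k) * cis \<theta>"] Arg_le_pi[of "1 + of_real (r k) * cis \<theta>"]
        mpi_less_Arg[of "1 - of_real (r k) * cis \<theta>"] Arg_le_pi[of "1 - of_real (r k) * cis \<theta>"] by linarith
    then have "\<bar>S k \<theta>\<bar> \<le> 2 / pi * (2 * pi)" unfolding S_def abs_mult by (intro mult_mono) auto
    then have "\<bar>S k \<theta>\<bar> \<le> 4" by simp
    moreover have "1 / (real k + 1) \<le> 1" by simp
    ultimately show ?thesis using close[of k \<theta>] by linarith
  qed
  moreover have "(\<lambda>k. sine_sum (\<lambda>n. r k ^ n) (N k) \<theta>) \<longlonglongrightarrow> 1" if \<theta>: "0 < \<theta>" "\<theta> < pi" for \<theta>
  proof -
    have s: "0 < sin \<theta>" using \<theta> by (rule sin_gt_zero)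
    \<comment> \<open>Since \<open>sin \<theta> > 0\<close>, both limit points lie off the closed
      negative real axis, where \<open>Arg\<close> is continuous.\<close>
    have "(\<lambda>k. S k \<theta>) \<longlonglongrightarrow> 2 / pi * (Arg (1 + of_real 1 * cis \<theta>) - Arg (1 - of_real 1 * cis \<theta>))"
      unfolding S_def using s
      by (intro tendsto_intros isCont_tendsto_compose[OF continuous_at_Arg] r1)
         (auto simp: complex_nonpos_Reals_iff)
    then have "(\<lambda>k. S k \<theta>) \<longlonglongrightarrow> 1" using Arg_one_plus_cis[OF \<theta>] by simp
    moreover have "(\<lambda>k. S k \<theta> - sine_sum (\<lambda>n. r k ^ n) (N k) \<theta>) \<longlonglongrightarrow> 0"
    proof (rule Lim_null_comparison)
      show "\<forall>\<^sub>F k in sequentially. norm (S k \<theta> - sine_sum (\<lambda>n. r k ^ n) (N k) \<theta>) \<le> 1 / (real k + 1)"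
        using close by simp
      show "(\<lambda>k. 1 / (real k + 1)) \<longlonglongrightarrow> 0"
        using LIMSEQ_Suc[OF lim_1_over_n] by (simp add: add.commute)
    qed
    ultimately have "(\<lambda>k. S k \<theta> - (S k \<theta> - sine_sum (\<lambda>n. r k ^ n) (N k) \<theta>)) \<longlonglongrightarrow> 1 - 0" by (rule tendsto_diff)
    then show ?thesis by simp
  qed
  ultimately show thesis using that r r1 N(1) by blast
qed

text \<open>From \<open>n = 5\<close> on, \<open>(n^2 - 25) * T \<ge> n - 5\<close> for
  \<open>T \<ge> 1\<close>, so beyond the factor \<open>exp (- (25 * \<beta>) * T)\<close> the tail
  is dominated by a geometric series of ratio \<open>exp (- \<beta>)\<close>. The bound is uniform
  in \<open>r\<close> and \<open>N\<close>, as the limit \<open>r = 1\<close> requires.\<close>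

lemma sine_sum_tail:
  fixes \<beta> T :: real
  assumes \<beta>: "0 < \<beta>" and T: "1 \<le> T" and r: "0 \<le> r" "r < 1" and N: "5 \<le> N"
  shows "\<bar>sine_sum (\<lambda>n. r ^ n * exp (- (\<beta> * real n ^ 2 * T))) N \<theta>
      - (4 / pi * r * exp (- \<beta> * T) * sin \<theta> + 4 / (3 * pi) * r ^ 3 * exp (- (9 * \<beta>) * T) * sin (3 * \<theta>))\<bar>
    \<le> 2 / (1 - exp (- \<beta>)) * exp (- (25 * \<beta>) * T)"
proof -
  let ?a = "\<lambda>n. odd_coeff n * (r ^ n * exp (- (\<beta> * real n ^ 2 * T))) * sin (real n * \<theta>)"
  have "sine_sum (\<lambda>n. r ^ n * exp (- (\<beta> * real n ^ 2 * T))) N \<theta> = (\<Sum>n<5. ?a n) + (\<Sum>n\<in>{5..<N}. ?a n)"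
    unfolding sine_sum_def using N
    by (subst sum.union_disjoint[symmetric]) (auto intro!: sum.cong)
  also have "(\<Sum>n<5. ?a n) = 4 / pi * r * exp (- \<beta> * T) * sin \<theta> + 4 / (3 * pi) * r ^ 3 * exp (- (9 * \<beta>) * T) * sin (3 * \<theta>)"
    using odd_coeff_simps by (simp add: eval_nat_numeral mult_ac)
  finally have "\<bar>sine_sum (\<lambda>n. r ^ n * exp (- (\<beta> * real n ^ 2 * T))) N \<theta>
      - (4 / pi * r * exp (- \<beta> * T) * sin \<theta> + 4 / (3 * pi) * r ^ 3 * exp (- (9 * \<beta>) * T) * sin (3 * \<theta>))\<bar>
      = \<bar>\<Sum>n\<in>{5..<N}. ?a n\<bar>" by simp
  also have "\<dots> \<le> (\<Sum>n\<in>{5..<N}. \<bar>?a n\<bar>)" by (rule sum_abs)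
  also have "\<dots> \<le> (\<Sum>n\<in>{5..<N}. 2 * exp (- (25 * \<beta>) * T) * exp (- \<beta>) ^ (n - 5))"
  proof (rule sum_mono)
    fix n assume n: "n \<in> {5..<N}"
    have rn: "r ^ n \<le> 1" using r by (intro power_le_one) auto
    have "\<bar>?a n\<bar> = \<bar>odd_coeff n\<bar> * (r ^ n * exp (- (\<beta> * real n ^ 2 * T))) * \<bar>sin (real n * \<theta>)\<bar>"
      using r by (simp add: abs_mult)
    also have "\<dots> \<le> 2 * (1 * exp (- (\<beta> * real n ^ 2 * T))) * 1"
      using odd_coeff_bound rn r by (intro mult_mono) auto
    also have "\<dots> \<le> 2 * (exp (- (25 * \<beta>) * T) * exp (- \<beta>) ^ (n - 5))"
    proof -
      have "real (n - 5) \<le> (real n ^ 2 - 25) * T"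
      proof -
        have "real (n - 5) * 1 \<le> (real n - 5) * (real n + 5)" using n by (intro mult_mono) auto
        also have "\<dots> = (real n ^ 2 - 25) * 1" by (simp add: algebra_simps power2_eq_square)
        also have "\<dots> \<le> (real n ^ 2 - 25) * T"
        proof (rule mult_left_mono[OF T])
          have "5 ^ 2 \<le> real n ^ 2" using n by (intro power_mono) auto
          then show "0 \<le> real n ^ 2 - 25" by simp
        qed
        finally show ?thesis by simp
      qed
      then have "\<beta> * real (n - 5) \<le> \<beta> * ((real n ^ 2 - 25) * T)" using \<beta> by (intro mult_left_mono) auto
      then have "exp (- (\<beta> * real n ^ 2 * T)) \<le> exp (- (25 * \<beta>) * T + real (n - 5) * (- \<beta>))"
        by (simp add: algebra_simps)
      also have "\<dots> = exp (- (25 * \<beta>) * T) * exp (- \<beta>) ^ (n - 5)"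
        by (simp only: exp_add exp_of_nat_mult)
      finally show ?thesis by simp
    qed
    finally show "\<bar>?a n\<bar> \<le> 2 * exp (- (25 * \<beta>) * T) * exp (- \<beta>) ^ (n - 5)" by simp
  qed
  also have "\<dots> = 2 * exp (- (25 * \<beta>) * T) * (\<Sum>n\<in>{5..<N}. exp (- \<beta>) ^ (n - 5))"
    by (simp add: sum_distrib_left)
  also have "(\<Sum>n\<in>{5..<N}. exp (- \<beta>) ^ (n - 5)) = (\<Sum>n<N - 5. exp (- \<beta>) ^ n)"
    by (rule sum.reindex_bij_witness[of _ "\<lambda>n. n + 5" "\<lambda>n. n - 5"]) auto
  also have "2 * exp (- (25 * \<beta>) * T) * \<dots> \<le> 2 * exp (- (25 * \<beta>) * T) * (1 / (1 - exp (- \<beta>)))"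
  proof (rule mult_left_mono)
    have g: "(\<lambda>n. exp (- \<beta>) ^ n) sums (1 / (1 - exp (- \<beta>)))" using \<beta> by (intro geometric_sums) auto
    then show "(\<Sum>n<N - 5. exp (- \<beta>) ^ n) \<le> 1 / (1 - exp (- \<beta>))"
      using sum_le_suminf[of "\<lambda>n. exp (- \<beta>) ^ n" "{..<N - 5}"] by (auto simp: sums_iff)
  qed simp
  finally show ?thesis by (simp add: mult_ac)
qed


section \<open>Two leading exponentials of a product of sine sums\<close>

text \<open>The harmonics 1 and 3 of the heat flow with undamped coefficients, that is, at
  \<open>r = 1\<close>.\<close>

definition sine_lead :: "real \<Rightarrow> real \<Rightarrow> real \<Rightarrow> real" where
  "sine_lead \<beta> \<theta> t = 4 / pi * exp (- \<beta> * t) * sin \<theta> + 4 / (3 * pi) * exp (- (9 * \<beta>) * t) * sin (3 * \<theta>)"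

definition tail_const :: "real \<Rightarrow> real" where
  "tail_const \<beta> = 2 / (1 - exp (- \<beta>))"

lemma abs_sine_lead_le:
  assumes "0 < \<beta>" "0 \<le> t"
  shows "\<bar>sine_lead \<beta> \<theta> t\<bar> \<le> 4 * exp (- \<beta> * t)"
proof -
  have pi2: "4 / pi \<le> 2" "4 / (3 * pi) \<le> 2"
    using pi_ge_two divide_left_mono[of 2 pi 4] divide_left_mono[of 2 "3 * pi" 4] by auto
  have "\<beta> * t \<le> 9 * \<beta> * t" using assms by simp
  then have e: "exp (- (9 * \<beta>) * t) \<le> exp (- \<beta> * t)" by simp
  have "\<bar>4 / pi * exp (- \<beta> * t) * sin \<theta>\<bar> \<le> 2 * exp (- \<beta> * t) * 1"
    unfolding abs_mult using pi2 by (intro mult_mono) auto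
  moreover have "\<bar>4 / (3 * pi) * exp (- (9 * \<beta>) * t) * sin (3 * \<theta>)\<bar> \<le> 2 * exp (- \<beta> * t) * 1"
    unfolding abs_mult using pi2 e by (intro mult_mono) auto
  ultimately show ?thesis unfolding sine_lead_def by linarith
qed

text \<open>When the product is multiplied out, every term apart from the rates
  \<open>\<beta> + \<beta>'\<close> and \<open>9 * \<beta> + \<beta>'\<close> decays at least at
  rate \<nu>; the slowest competitors are \<open>\<beta> + 9 * \<beta>'\<close> and
  \<open>25 * \<beta> + \<beta>'\<close>. The hypothesis starts at \<open>t = 1\<close>, so earlier
  times are covered by a constant.\<close>

lemma product_asymptotics:
  assumes \<beta>: "0 < \<beta>" "0 < \<beta>'"
    and P: "\<And>t. 1 \<le> t \<Longrightarrow> \<bar>P t - sine_lead \<beta> \<theta> t * sine_lead \<beta>' \<theta>' t\<bar> \<le>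
      \<bar>sine_lead \<beta> \<theta> t\<bar> * (tail_const \<beta>' * exp (- (25 * \<beta>') * t))
      + tail_const \<beta> * exp (- (25 * \<beta>) * t) * \<bar>sine_lead \<beta>' \<theta>' t\<bar>
      + tail_const \<beta> * exp (- (25 * \<beta>) * t) * (tail_const \<beta>' * exp (- (25 * \<beta>') * t))"
    and P1: "\<And>t. \<bar>P t\<bar> \<le> (1::real)"
  defines "\<nu> \<equiv> min (\<beta> + 9 * \<beta>') (25 * \<beta> + \<beta>')"
  shows "\<exists>C. \<forall>t\<ge>0. \<bar>P t - 16 / pi^2 * (sin \<theta> * sin \<theta>') * exp (- (\<beta> + \<beta>') * t)
      - 16 / (3 * pi^2) * (sin (3 * \<theta>) * sin \<theta>') * exp (- (9 * \<beta> + \<beta>') * t)\<bar> \<le> C * exp (- \<nu> * t)"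
proof -
  let ?K = "tail_const \<beta>" and ?K' = "tail_const \<beta>'"
  have K: "0 \<le> ?K" "0 \<le> ?K'" using \<beta> by (simp_all add: tail_const_def)
  \<comment> \<open>\<open>8\<close> for the two dropped products of leading terms, the rest for the
    three error terms of the hypothesis.\<close>
  define C0 where "C0 = 8 + 4 * ?K' + 4 * ?K + ?K * ?K'"
  have C0: "0 \<le> C0" using K by (simp add: C0_def)
  have \<nu>0: "0 < \<nu>" using \<beta> by (simp add: \<nu>_def)
  have pi2: "4 \<le> pi^2" using pi_ge_two power_mono[of 2 pi 2] by simp
  then have c: "16 / pi^2 \<le> 4" "16 / (3 * pi^2) \<le> 4" "16 / (9 * pi^2) \<le> 4"
    by (simp_all add: divide_le_eq)
  have exp_le: "exp (- l * t) \<le> exp (- \<nu> * t)" if "\<nu> \<le> l" "0 \<le> t" for l t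
    using mult_right_mono[OF that] by simp
  let ?m = "\<lambda>t. 16 / pi^2 * (sin \<theta> * sin \<theta>') * exp (- (\<beta> + \<beta>') * t)
      + 16 / (3 * pi^2) * (sin (3 * \<theta>) * sin \<theta>') * exp (- (9 * \<beta> + \<beta>') * t)"
  have sin2: "\<bar>sin u * sin v\<bar> \<le> 1" for u v :: real
    unfolding abs_mult by (intro mult_le_one) auto
  have big: "\<bar>P t - ?m t\<bar> \<le> C0 * exp (- \<nu> * t)" if t: "1 \<le> t" for t
  proof -
    have t0: "0 \<le> t" using t by simp
    have comb: "exp (- l * t) * exp (- l' * t) = exp (- (l + l') * t)" for l l'
      by (simp add: exp_add[symmetric] algebra_simps)
    have prod: "sine_lead \<beta> \<theta> t * sine_lead \<beta>' \<theta>' t = ?m t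
        + 16 / (3 * pi^2) * (sin \<theta> * sin (3 * \<theta>')) * exp (- (\<beta> + 9 * \<beta>') * t)
        + 16 / (9 * pi^2) * (sin (3 * \<theta>) * sin (3 * \<theta>')) * exp (- (9 * \<beta> + 9 * \<beta>') * t)"
      unfolding comb[symmetric] sine_lead_def by (simp add: field_simps power2_eq_square)
    have "\<bar>16 / (3 * pi^2) * (sin \<theta> * sin (3 * \<theta>')) * exp (- (\<beta> + 9 * \<beta>') * t)\<bar> \<le> 4 * 1 * exp (- \<nu> * t)"
      unfolding abs_mult[of _ "exp _"] abs_mult[of _ "sin _ * sin _"] using c sin2 exp_le[of "\<beta> + 9 * \<beta>'" t] t0
      by (intro mult_mono) (auto simp: \<nu>_def)
    moreover have "\<bar>16 / (9 * pi^2) * (sin (3 * \<theta>) * sin (3 * \<theta>')) * exp (- (9 * \<beta> + 9 * \<beta>') * t)\<bar> \<le> 4 * 1 * exp (- \<nu> * t)"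
      unfolding abs_mult[of _ "exp _"] abs_mult[of _ "sin _ * sin _"] using c sin2 exp_le[of "9 * \<beta> + 9 * \<beta>'" t] t0 \<beta>
      by (intro mult_mono) (auto simp: \<nu>_def)
    moreover have "\<bar>sine_lead \<beta> \<theta> t\<bar> * (?K' * exp (- (25 * \<beta>') * t)) \<le> 4 * ?K' * exp (- \<nu> * t)"
    proof -
      have "\<bar>sine_lead \<beta> \<theta> t\<bar> * (?K' * exp (- (25 * \<beta>') * t)) \<le> 4 * exp (- \<beta> * t) * (?K' * exp (- (25 * \<beta>') * t))"
        using abs_sine_lead_le[OF \<beta>(1) t0] K by (intro mult_right_mono) auto
      also have "\<dots> = 4 * ?K' * exp (- (\<beta> + 25 * \<beta>') * t)" unfolding comb[symmetric] by simp
      also have "\<dots> \<le> 4 * ?K' * exp (- \<nu> * t)" using K \<beta> t0 by (intro mult_left_mono exp_le) (auto simp: \<nu>_def)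
      finally show ?thesis .
    qed
    moreover have "?K * exp (- (25 * \<beta>) * t) * \<bar>sine_lead \<beta>' \<theta>' t\<bar> \<le> 4 * ?K * exp (- \<nu> * t)"
    proof -
      have "?K * exp (- (25 * \<beta>) * t) * \<bar>sine_lead \<beta>' \<theta>' t\<bar> \<le> ?K * exp (- (25 * \<beta>) * t) * (4 * exp (- \<beta>' * t))"
        using abs_sine_lead_le[OF \<beta>(2) t0] K by (intro mult_left_mono) auto
      also have "\<dots> = 4 * ?K * exp (- (25 * \<beta> + \<beta>') * t)" unfolding comb[symmetric] by simp
      also have "\<dots> \<le> 4 * ?K * exp (- \<nu> * t)" using K \<beta> t0 by (intro mult_left_mono exp_le) (auto simp: \<nu>_def)
      finally show ?thesis .
    qed
    moreover have "?K * exp (- (25 * \<beta>) * t) * (?K' * exp (- (25 * \<beta>') * t)) \<le> ?K * ?K' * exp (- \<nu> * t)"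
    proof -
      have "?K * exp (- (25 * \<beta>) * t) * (?K' * exp (- (25 * \<beta>') * t)) = ?K * ?K' * exp (- (25 * \<beta> + 25 * \<beta>') * t)"
        unfolding comb[symmetric] by simp
      also have "\<dots> \<le> ?K * ?K' * exp (- \<nu> * t)" using K \<beta> t0 by (intro mult_left_mono exp_le) (auto simp: \<nu>_def)
      finally show ?thesis .
    qed
    ultimately show ?thesis using P[OF t] unfolding prod C0_def distrib_right by linarith
  qed
  have le1: "exp (- l * t) \<le> 1" if "0 \<le> l" "0 \<le> t" for l t :: real
    using mult_nonneg_nonneg[OF that] by simp
  \<comment> \<open>\<open>9\<close> is one for \<open>P\<close> and four for each main term;
    \<open>exp \<nu>\<close> compensates the decay up to \<open>t = 1\<close>.\<close>
  have small: "\<bar>P t - ?m t\<bar> \<le> 9 * exp \<nu> * exp (- \<nu> * t)" if t: "0 \<le> t" "t < 1" for t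
  proof -
    have "\<bar>16 / pi^2 * (sin \<theta> * sin \<theta>') * exp (- (\<beta> + \<beta>') * t)\<bar> \<le> 4 * 1 * 1"
      unfolding abs_mult[of _ "exp _"] abs_mult[of _ "sin _ * sin _"] using c sin2 \<beta> t le1[of "\<beta> + \<beta>'" t]
      by (intro mult_mono) auto
    moreover have "\<bar>16 / (3 * pi^2) * (sin (3 * \<theta>) * sin \<theta>') * exp (- (9 * \<beta> + \<beta>') * t)\<bar> \<le> 4 * 1 * 1"
      unfolding abs_mult[of _ "exp _"] abs_mult[of _ "sin _ * sin _"] using c sin2 \<beta> t le1[of "9 * \<beta> + \<beta>'" t]
      by (intro mult_mono) auto
    ultimately have "\<bar>P t - ?m t\<bar> \<le> 9 * 1" using P1[of t] by linarith
    also have "\<dots> \<le> 9 * exp (\<nu> + (- \<nu> * t))"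
      using t \<nu>0 by (intro mult_left_mono) (auto simp: mult_left_le)
    finally show ?thesis by (simp only: exp_add mult.assoc)
  qed
  have "\<bar>P t - ?m t\<bar> \<le> (9 * exp \<nu> + C0) * exp (- \<nu> * t)" if t: "0 \<le> t" for t
  proof (cases "1 \<le> t")
    case True
    then show ?thesis using big[OF True] unfolding distrib_right by (smt (verit) exp_gt_zero mult_pos_pos)
  next
    case False
    then show ?thesis using small[OF t] mult_nonneg_nonneg[OF C0, of "exp (- \<nu> * t)"] unfolding distrib_right by auto
  qed
  then show ?thesis by (intro exI[of _ "9 * exp \<nu> + C0"]) (auto simp: diff_diff_eq)
qed

lemma sin_eq_imp_reflect:
  assumes "0 < \<theta>" "\<theta> < pi" "0 < \<phi>" "\<phi> < pi" "sin \<theta> = sin \<phi>"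
  shows "\<phi> = \<theta> \<or> \<phi> = pi - \<theta>"
proof -
  have inj: "u = v" if "sin u = sin v" "0 \<le> u" "u \<le> pi / 2" "0 \<le> v" "v \<le> pi / 2" for u v
    using that sin_inj_pi[of u v] pi_gt_zero by auto
  have s: "sin (pi - \<theta>) = sin \<theta>" "sin (pi - \<phi>) = sin \<phi>" by simp_all
  show ?thesis
    using assms s inj[of \<theta> \<phi>] inj[of "pi - \<theta>" \<phi>] inj[of \<theta> "pi - \<phi>"] inj[of "pi - \<theta>" "pi - \<phi>"]
    by (cases "\<theta> \<le> pi / 2"; cases "\<phi> \<le> pi / 2") auto
qed

text \<open>\<open>\<beta> < \<beta>'\<close> puts \<open>9 * \<beta> + \<beta>'\<close> strictly
  below the remainder rate, so both leading coefficients of \<open>P - Q\<close> vanish. Dividing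
  the second identity by the first, the triple angle formula leaves
  \<open>3 - 4 * sin \<theta> ^ 2\<close>, and the sines are positive.\<close>

lemma sines_determined:
  fixes P Q :: "real \<Rightarrow> real"
  assumes \<beta>: "0 < \<beta>" "\<beta> < \<beta>'"
    and meas: "P \<in> borel_measurable borel" "Q \<in> borel_measurable borel"
    and P: "\<exists>C. \<forall>t\<ge>0. \<bar>P t - 16 / pi^2 * (sin \<theta> * sin \<theta>') * exp (- (\<beta> + \<beta>') * t)
      - 16 / (3 * pi^2) * (sin (3 * \<theta>) * sin \<theta>') * exp (- (9 * \<beta> + \<beta>') * t)\<bar>
      \<le> C * exp (- min (\<beta> + 9 * \<beta>') (25 * \<beta> + \<beta>') * t)"
    and Q: "\<exists>C. \<forall>t\<ge>0. \<bar>Q t - 16 / pi^2 * (sin \<phi> * sin \<phi>') * exp (- (\<beta> + \<beta>') * t)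
      - 16 / (3 * pi^2) * (sin (3 * \<phi>) * sin \<phi>') * exp (- (9 * \<beta> + \<beta>') * t)\<bar>
      \<le> C * exp (- min (\<beta> + 9 * \<beta>') (25 * \<beta> + \<beta>') * t)"
    and zero: "\<And>k. integral\<^sup>L lborel (\<lambda>t. indicator {0..} t * t ^ k * (P t - Q t)) = 0"
    and range: "0 < \<theta>" "\<theta> < pi" "0 < \<theta>'" "\<theta>' < pi" "0 < \<phi>" "\<phi> < pi" "0 < \<phi>'" "\<phi>' < pi"
  shows "sin \<theta> = sin \<phi>" "sin \<theta>' = sin \<phi>'"
proof -
  let ?\<nu> = "min (\<beta> + 9 * \<beta>') (25 * \<beta> + \<beta>')"
  obtain C where C: "\<And>t. 0 \<le> t \<Longrightarrow> \<bar>P t - 16 / pi^2 * (sin \<theta> * sin \<theta>') * exp (- (\<beta> + \<beta>') * t)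
      - 16 / (3 * pi^2) * (sin (3 * \<theta>) * sin \<theta>') * exp (- (9 * \<beta> + \<beta>') * t)\<bar> \<le> C * exp (- ?\<nu> * t)"
    using P by blast
  obtain E where E: "\<And>t. 0 \<le> t \<Longrightarrow> \<bar>Q t - 16 / pi^2 * (sin \<phi> * sin \<phi>') * exp (- (\<beta> + \<beta>') * t)
      - 16 / (3 * pi^2) * (sin (3 * \<phi>) * sin \<phi>') * exp (- (9 * \<beta> + \<beta>') * t)\<bar> \<le> E * exp (- ?\<nu> * t)"
    using Q by blast
  define d1 where "d1 = 16 / pi^2 * (sin \<theta> * sin \<theta>' - sin \<phi> * sin \<phi>')"
  define d2 where "d2 = 16 / (3 * pi^2) * (sin (3 * \<theta>) * sin \<theta>' - sin (3 * \<phi>) * sin \<phi>')"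
  have bound: "\<bar>(P t - Q t) - d1 * exp (- (\<beta> + \<beta>') * t) - d2 * exp (- (9 * \<beta> + \<beta>') * t)\<bar>
      \<le> (C + E) * exp (- ?\<nu> * t)" if t: "0 \<le> t" for t
    using C[OF t] E[OF t] unfolding d1_def d2_def right_diff_distrib left_diff_distrib distrib_right by linarith
  have "d1 = 0 \<and> d2 = 0"
    using two_exponentials_unique[OF _ _ _ _ bound zero] meas \<beta> by auto
  then have 1: "sin \<theta> * sin \<theta>' = sin \<phi> * sin \<phi>'" and 2: "sin (3 * \<theta>) * sin \<theta>' = sin (3 * \<phi>) * sin \<phi>'"
    by (simp_all add: d1_def d2_def)
  have pos: "0 < sin \<theta>" "0 < sin \<theta>'" "0 < sin \<phi>" "0 < sin \<phi>'" using range by (auto intro: sin_gt_zero)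
  have triple: "sin (3 * u) = sin u * (3 - 4 * sin u ^ 2)" for u :: real
  proof -
    have "sin (3 * u) = sin (2 * u + u)" by simp
    also have "\<dots> = 2 * sin u * (cos u)^2 + (1 - 2 * (sin u)^2) * sin u"
      unfolding sin_add sin_double cos_double_sin by (simp add: power2_eq_square)
    finally show ?thesis unfolding cos_squared_eq by (simp add: algebra_simps power2_eq_square)
  qed
  have "(sin \<theta> * sin \<theta>') * (3 - 4 * sin \<theta> ^ 2) = (sin \<phi> * sin \<phi>') * (3 - 4 * sin \<phi> ^ 2)"
    using 2 unfolding triple by (simp add: mult_ac)
  then have "3 - 4 * sin \<theta> ^ 2 = 3 - 4 * sin \<phi> ^ 2"
    unfolding 1 using pos by (simp only: mult_cancel_left) auto
  then have "sin \<theta> ^ 2 = sin \<phi> ^ 2" by simp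
  then show s: "sin \<theta> = sin \<phi>" using pos by (simp add: power2_eq_iff_nonneg)
  show "sin \<theta>' = sin \<phi>'" using 1 pos unfolding s by simp
qed


lemma abs_mult_diff_mult_le:
  fixes g g' l l' :: real
  assumes "\<bar>g - l\<bar> \<le> e" "\<bar>g' - l'\<bar> \<le> e'"
  shows "\<bar>g * g' - l * l'\<bar> \<le> \<bar>l\<bar> * e' + e * \<bar>l'\<bar> + e * e'"
proof -
  have "g * g' - l * l' = l * (g' - l') + (g - l) * l' + (g - l) * (g' - l')"
    by (simp add: algebra_simps)
  then have "\<bar>g * g' - l * l'\<bar> \<le> \<bar>l * (g' - l')\<bar> + \<bar>(g - l) * l'\<bar> + \<bar>(g - l) * (g' - l')\<bar>"
    by linarith
  also have "\<dots> \<le> \<bar>l\<bar> * e' + e * \<bar>l'\<bar> + e * e'"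
    unfolding abs_mult using assms by (intro add_mono mult_mono) auto
  finally show ?thesis .
qed

section \<open>Moments as integrals of the survival probability\<close>

context standard_planar_brownian_motion
begin

text \<open>The survival probability is decreasing on the whole line, being one at negative
  times.\<close>

lemma prob_survives_measurable: "(\<lambda>t. prob (survives D p t)) \<in> borel_measurable borel"
  if "open D"
proof -
  have ev: "survives D p t \<in> events" for t
  proof (cases "0 \<le> t")
    case False
    then have "survives D p t = space M" by (auto simp: survives_def)
    then show ?thesis by simp
  qed (rule survives_events[OF that])
  have "mono (\<lambda>t. - prob (survives D p t))"
    using ev by (intro monoI) (simp add: finite_measure_mono survives_antimono)
  then have "(\<lambda>t. - prob (survives D p t)) \<in> borel_measurable borel" by (rule borel_measurable_mono)
  then have "(\<lambda>t. - (- prob (survives D p t))) \<in> borel_measurable borel" by (rule borel_measurable_uminus)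
  then show ?thesis by simp
qed

lemma nn_integral_power_initial:
  assumes "0 \<le> s"
  shows "(\<integral>\<^sup>+t. ennreal (real (Suc k) * t ^ k) * (indicator {0..} t * indicator {t. t < s} t) \<partial>lborel) = ennreal (s ^ Suc k)"
proof -
  have "(\<integral>\<^sup>+t. ennreal (real (Suc k) * t ^ k) * indicator {0..s} t \<partial>lborel) = ennreal (s ^ Suc k - 0 ^ Suc k)"
    using DERIV_pow[of "Suc k"] assms by (intro nn_integral_FTC_Icc) (auto simp del: power_Suc of_nat_Suc)
  moreover have "(\<integral>\<^sup>+t. ennreal (real (Suc k) * t ^ k) * (indicator {0..} t * indicator {t. t < s} t) \<partial>lborel)
      = (\<integral>\<^sup>+t. ennreal (real (Suc k) * t ^ k) * indicator {0..s} t \<partial>lborel)"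
    \<comment> \<open>The strict inequality \<open>t < s\<close> matches
      \<open>survives_iff_less_stop\<close>; the endpoint is a null set.\<close>
    using AE_lborel_singleton[of s]
    by (intro nn_integral_cong_AE) (auto elim!: eventually_mono simp: indicator_def)
  ultimately show ?thesis by simp
qed

text \<open>Layer cake: a power of the capped exit time is an integral up to that time, Fubini
  interchanges the integrals, and monotone convergence removes the cap.\<close>

lemma exit_moment_tail_formula:
  assumes D: "open D"
  shows "exit_moment M B D (Suc k) p =
    (\<integral>\<^sup>+t. ennreal (real (Suc k) * t ^ k) * (indicator {0..} t * ennreal (prob (survives D p t))) \<partial>lborel)"
proof -
  note [measurable] = measurable_stop[OF D] prob_survives_measurable[OF D]
  interpret L: pair_sigma_finite M lborel
    by (intro pair_sigma_finite.intro sigma_finite_measure_axioms lborel.sigma_finite_measure_axioms)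
  let ?w = "\<lambda>t. ennreal (real (Suc k) * t ^ k)"
  let ?P = "\<lambda>n t. ?w t * (indicator {0..} t * ennreal (prob (survives D p t))) * indicator {t. t < real n} t"
  have step: "ennreal (expectation (\<lambda>\<omega>. stop D p (real n) \<omega> ^ Suc k)) = (\<integral>\<^sup>+t. ?P n t \<partial>lborel)" for n
  proof -
    let ?\<sigma> = "stop D p (real n)"
    have [measurable]: "?\<sigma> \<in> borel_measurable M" by simp
    have "ennreal (expectation (\<lambda>\<omega>. ?\<sigma> \<omega> ^ Suc k)) = (\<integral>\<^sup>+\<omega>. ennreal (?\<sigma> \<omega> ^ Suc k) \<partial>M)"
      using integrable_stop_power(2)[OF D, of "real n" _ p "Suc k"] stop_nonneg[of "real n" D p]
      by (intro nn_integral_eq_integral[symmetric]) auto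
    also have "\<dots> = (\<integral>\<^sup>+\<omega>. (\<integral>\<^sup>+t. ?w t * (indicator {0..} t * indicator {t. t < ?\<sigma> \<omega>} t) \<partial>lborel) \<partial>M)"
      by (simp only: nn_integral_power_initial[OF stop_nonneg[OF of_nat_0_le_iff]])
    also have "\<dots> = (\<integral>\<^sup>+t. (\<integral>\<^sup>+\<omega>. ?w t * (indicator {0..} t * indicator {t. t < ?\<sigma> \<omega>} t) \<partial>M) \<partial>lborel)"
      by (rule L.Fubini'[symmetric]) (simp add: indicator_def case_prod_beta)
    also have "\<dots> = (\<integral>\<^sup>+t. ?P n t \<partial>lborel)"
    proof (rule nn_integral_cong)
      fix t :: real
      have "(\<integral>\<^sup>+\<omega>. ?w t * (indicator {0..} t * indicator {t. t < ?\<sigma> \<omega>} t) \<partial>M)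
          = (\<integral>\<^sup>+\<omega>. (?w t * indicator {0..} t) * indicator {\<omega> \<in> space M. t < ?\<sigma> \<omega>} \<omega> \<partial>M)"
        by (intro nn_integral_cong) (auto simp: indicator_def)
      also have "\<dots> = ?w t * indicator {0..} t * emeasure M {\<omega> \<in> space M. t < ?\<sigma> \<omega>}"
        by (subst nn_integral_cmult_indicator) auto
      also have "\<dots> = ?P n t"
      proof (cases "0 \<le> t")
        case True
        show ?thesis
        proof (cases "t < real n")
          case less: True
          have "survives D p t \<subseteq> space M" by (auto simp: survives_def)
          then have "{\<omega> \<in> space M. t < ?\<sigma> \<omega>} = survives D p t"
            using survives_iff_less_stop[OF D _ True less, of _ p] by blast
          then show ?thesis using True less by (simp add: emeasure_eq_measure)
        next
          case False
          then have "{\<omega> \<in> space M. t < ?\<sigma> \<omega>} = {}"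
            using stop_le[of "real n" D p] by (auto simp: not_less intro: order.trans)
          then have "emeasure M {\<omega> \<in> space M. t < ?\<sigma> \<omega>} = 0" by (simp only: emeasure_empty)
          then show ?thesis using False by simp
        qed
      qed simp
      finally show "(\<integral>\<^sup>+\<omega>. ?w t * (indicator {0..} t * indicator {t. t < ?\<sigma> \<omega>} t) \<partial>M) = ?P n t" .
    qed
    finally show ?thesis .
  qed
  have "(\<lambda>n. \<integral>\<^sup>+t. ?P n t \<partial>lborel) \<longlonglongrightarrow>
    (\<integral>\<^sup>+t. ?w t * (indicator {0..} t * ennreal (prob (survives D p t))) \<partial>lborel)"
  proof (rule nn_integral_LIMSEQ)
    show "incseq ?P" by (auto simp: incseq_def le_fun_def indicator_def)
    show "?P n \<in> borel_measurable lborel" for n by measurable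
    show "(\<lambda>n. ?P n t) \<longlonglongrightarrow> ?w t * (indicator {0..} t * ennreal (prob (survives D p t)))" for t
    proof -
      obtain m :: nat where "t < m" using reals_Archimedean2 by blast
      then show ?thesis
        by (intro tendsto_eventually) (auto simp: eventually_sequentially indicator_def intro!: exI[of _ m])
    qed
  qed
  then show ?thesis
    using exit_moment_limit[OF D, of "Suc k" p] LIMSEQ_unique unfolding step by auto
qed

text \<open>Exponential decay makes the tail integrals finite, so an equation between extended
  numbers becomes one between reals that can be subtracted.\<close>

lemma equal_moments_imp_tail_moments:
  assumes D: "open D" and C: "0 < \<mu>"
    "\<And>t. 0 \<le> t \<Longrightarrow> prob (survives D p t) \<le> C * exp (- \<mu> * t)"
    "\<And>t. 0 \<le> t \<Longrightarrow> prob (survives D q t) \<le> C * exp (- \<mu> * t)"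
    and eq: "exit_moment M B D (Suc k) p = exit_moment M B D (Suc k) q"
  shows "integral\<^sup>L lborel (\<lambda>t. indicator {0..} t * t ^ k * (prob (survives D p t) - prob (survives D q t))) = 0"
proof -
  note [measurable] = prob_survives_measurable[OF D]
  have int: "integrable lborel (\<lambda>t. indicator {0..} t * t ^ k * prob (survives D z t))"
    and nn: "exit_moment M B D (Suc k) z = ennreal (real (Suc k) * integral\<^sup>L lborel (\<lambda>t. indicator {0..} t * t ^ k * prob (survives D z t)))"
    if z: "\<And>t. 0 \<le> t \<Longrightarrow> prob (survives D z t) \<le> C * exp (- \<mu> * t)" for z
  proof -
    let ?f = "\<lambda>t. indicator {0..} t * t ^ k * prob (survives D z t)"
    show f: "integrable lborel ?f"
    proof (rule Bochner_Integration.integrable_bound)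
      show "integrable lborel (\<lambda>t. C * (indicator {0..} t * t ^ k * exp (- \<mu> * t)))"
        using integral_power_exp[OF C(1), of k] by (intro integrable_mult_right) (simp add: has_bochner_integral_iff)
      show "AE t in lborel. norm (?f t) \<le> norm (C * (indicator {0..} t * t ^ k * exp (- \<mu> * t)))"
      proof (intro AE_I2)
        fix t :: real
        show "norm (?f t) \<le> norm (C * (indicator {0..} t * t ^ k * exp (- \<mu> * t)))"
        proof (cases "0 \<le> t")
          case True
          have "t ^ k * prob (survives D z t) \<le> t ^ k * (C * exp (- \<mu> * t))"
            using z[OF True] True by (intro mult_left_mono) auto
          also have "\<dots> \<le> \<bar>t ^ k * (C * exp (- \<mu> * t))\<bar>" by (rule abs_ge_self)
          finally show ?thesis using True by (simp add: abs_mult mult_ac)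
        qed simp
      qed
    qed measurable
    have "exit_moment M B D (Suc k) z = (\<integral>\<^sup>+t. ennreal (real (Suc k) * ?f t) \<partial>lborel)"
      unfolding exit_moment_tail_formula[OF D]
      by (intro nn_integral_cong) (auto simp: indicator_def ennreal_mult'[symmetric] mult_ac simp del: of_nat_Suc)
    also have "\<dots> = ennreal (integral\<^sup>L lborel (\<lambda>t. real (Suc k) * ?f t))"
      using f by (intro nn_integral_eq_integral integrable_mult_right) (auto simp: indicator_def)
    finally show "exit_moment M B D (Suc k) z = ennreal (real (Suc k) * integral\<^sup>L lborel ?f)" by simp
  qed
  have "integral\<^sup>L lborel (\<lambda>t. indicator {0..} t * t ^ k * prob (survives D p t))
      = integral\<^sup>L lborel (\<lambda>t. indicator {0..} t * t ^ k * prob (survives D q t))"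
  proof -
    have nonneg: "0 \<le> integral\<^sup>L lborel (\<lambda>t. indicator {0..} t * t ^ k * prob (survives D z t))" for z
      by (intro Bochner_Integration.integral_nonneg) (auto simp: indicator_def)
    let ?I = "\<lambda>z. integral\<^sup>L lborel (\<lambda>t. indicator {0..} t * t ^ k * prob (survives D z t))"
    have "ennreal (real (Suc k) * ?I p) = ennreal (real (Suc k) * ?I q)"
      using eq nn[OF C(2)] nn[OF C(3)] by simp
    then have "real (Suc k) * ?I p = real (Suc k) * ?I q"
      using nonneg by (subst (asm) ennreal_inj) (auto intro!: mult_nonneg_nonneg)
    then show ?thesis by (simp del: of_nat_Suc)
  qed
  then show ?thesis
    using int[OF C(2)] int[OF C(3)] by (simp add: right_diff_distrib)
qed

section \<open>Sine modes and survival in the rectangle\<close>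

text \<open>A growing exponential makes the mode caloric. As the mode vanishes on the sides, only
  survivors contribute at the stopped time, and for them that time is the constant \<open>T\<close>,
  so the exponential can be moved to the other side.\<close>

lemma rectangle_mode:
  assumes ab: "0 < a" "0 < b" and p: "p \<in> rectangle a b" and T: "0 \<le> T"
  defines "S \<equiv> survives (rectangle a b) p T"
  shows "integrable M (\<lambda>\<omega>. indicator S \<omega> * (sin (real m * (pi / a * fst (brownian_from B p T \<omega>)))
      * sin (real n * (pi / b * snd (brownian_from B p T \<omega>)))))" (is "integrable M ?f")
    and "expectation (\<lambda>\<omega>. indicator S \<omega> * (sin (real m * (pi / a * fst (brownian_from B p T \<omega>)))
      * sin (real n * (pi / b * snd (brownian_from B p T \<omega>)))))
      = (exp (- ((pi / a)^2 * real m ^ 2 * T)) * sin (real m * (pi / a * fst p)))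
        * (exp (- ((pi / b)^2 * real n ^ 2 * T)) * sin (real n * (pi / b * snd p)))"
proof -
  let ?D = "rectangle a b"
  define c where "c = real m * (pi / a)"
  define d where "d = real n * (pi / b)"
  define u where "u z = sin (c * fst z) * sin (d * snd z)" for z
  define F where "F t z = (exp (c^2 * t) * sin (c * fst z)) * (exp (d^2 * t) * sin (d * snd z))" for t z
  have F: "caloric F" unfolding F_def by (intro caloric_mult caloric1_sin)
  have Fu: "F t z = exp ((c^2 + d^2) * t) * u z" for t z by (simp add: F_def u_def distrib_right exp_add)
  have D: "?D = {z. 0 < fst z \<and> fst z < a \<and> 0 < snd z \<and> snd z < b}" by (auto simp: rectangle_def)
  have op: "open ?D" unfolding D by (intro open_Collect_conj open_Collect_less continuous_intros)
  have cl: "closure ?D \<subseteq> {z. 0 \<le> fst z \<and> fst z \<le> a \<and> 0 \<le> snd z \<and> snd z \<le> b}"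
    unfolding D by (intro closure_minimal closed_Collect_conj closed_Collect_le continuous_intros) auto
  have "sin (c * a) = 0" "sin (d * b) = 0" using ab by (simp_all add: c_def d_def)
  then have sides: "u z = 0" if "fst z = 0 \<or> fst z = a \<or> snd z = 0 \<or> snd z = b" for z
    using that by (auto simp: u_def)
  have bd: "u z = 0" if "z \<in> closure ?D" "z \<notin> ?D" for z
  proof (rule sides)
    have "0 \<le> fst z \<and> fst z \<le> a \<and> 0 \<le> snd z \<and> snd z \<le> b" using that(1) cl by blast
    moreover have "\<not> (0 < fst z \<and> fst z < a \<and> 0 < snd z \<and> snd z < b)" using that(2) by (simp add: D)
    ultimately show "fst z = 0 \<or> fst z = a \<or> snd z = 0 \<or> snd z = b" by linarith
  qed
  have eq: "F (stop ?D p T \<omega>) (brownian_from B p (stop ?D p T \<omega>) \<omega>)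
      = exp ((c^2 + d^2) * T) * (indicator S \<omega> * u (brownian_from B p T \<omega>))" if "\<omega> \<in> space M" for \<omega>
    using vanishing_at_stop[OF op that T p bd] stop_eq_if_survives[of \<omega> ?D p T] T
    by (auto simp: Fu S_def indicator_def)
  note E = expectation_at_stop[OF op T p F]
  have f: "?f = (\<lambda>\<omega>. indicator S \<omega> * u (brownian_from B p T \<omega>))"
    by (simp add: u_def c_def d_def mult.assoc)
  have "integrable M (\<lambda>\<omega>. exp ((c^2 + d^2) * T) * (indicator S \<omega> * u (brownian_from B p T \<omega>)))"
    by (rule iffD1[OF Bochner_Integration.integrable_cong[OF refl eq] E(1)])
  then have "integrable M (\<lambda>\<omega>. exp (- ((c^2 + d^2) * T)) * (exp ((c^2 + d^2) * T) * (indicator S \<omega> * u (brownian_from B p T \<omega>))))"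
    by (rule integrable_mult_right)
  moreover have cancel: "exp (- ((c^2 + d^2) * T)) * (exp ((c^2 + d^2) * T) * v) = v" for v
    by (simp add: mult.assoc[symmetric] exp_add[symmetric])
  ultimately show "integrable M ?f" unfolding f by (simp only: cancel)
  have "exp ((c^2 + d^2) * T) * expectation ?f = F 0 p"
    unfolding f using E(2) Bochner_Integration.integral_cong[OF refl eq, of M] by simp
  then have "exp (- ((c^2 + d^2) * T)) * (exp ((c^2 + d^2) * T) * expectation ?f) = exp (- ((c^2 + d^2) * T)) * u p"
    by (simp add: Fu)
  then have "expectation ?f = exp (- ((c^2 + d^2) * T)) * u p" unfolding cancel .
  also have "exp (- ((c^2 + d^2) * T)) = exp (- ((pi / a)^2 * real m ^ 2 * T)) * exp (- ((pi / b)^2 * real n ^ 2 * T))"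
    by (simp add: exp_add[symmetric] c_def d_def power_mult_distrib power_divide algebra_simps)
  finally show "expectation ?f = (exp (- ((pi / a)^2 * real m ^ 2 * T)) * sin (real m * (pi / a * fst p)))
        * (exp (- ((pi / b)^2 * real n ^ 2 * T)) * sin (real n * (pi / b * snd p)))"
    by (simp add: u_def c_def d_def mult_ac)
qed

text \<open>Survivors are inside the rectangle at time \<open>T\<close>, where a product of two Abel
  sums tends boundedly to \<open>1\<close>. By \<open>rectangle_mode\<close> the mean of this
  product over survivors is a product of damped sums, whose limit is therefore the survival
  probability; the tail bounds are uniform and pass to the limit.\<close>

lemma rectangle_survival_asymptotics:
  assumes ab: "0 < a" "0 < b" and p: "p \<in> rectangle a b" and T: "1 \<le> T"
  defines "\<beta> \<equiv> (pi / a)^2" and "\<beta>' \<equiv> (pi / b)^2" and "\<theta> \<equiv> pi / a * fst p" and "\<theta>' \<equiv> pi / b * snd p"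
  shows "\<bar>prob (survives (rectangle a b) p T) - sine_lead \<beta> \<theta> T * sine_lead \<beta>' \<theta>' T\<bar> \<le>
      \<bar>sine_lead \<beta> \<theta> T\<bar> * (tail_const \<beta>' * exp (- (25 * \<beta>') * T))
      + tail_const \<beta> * exp (- (25 * \<beta>) * T) * \<bar>sine_lead \<beta>' \<theta>' T\<bar>
      + tail_const \<beta> * exp (- (25 * \<beta>) * T) * (tail_const \<beta>' * exp (- (25 * \<beta>') * T))"
proof -
  define S where "S = survives (rectangle a b) p T"
  define X where "X \<omega> = pi / a * fst (brownian_from B p T \<omega>)" for \<omega>
  define Y where "Y \<omega> = pi / b * snd (brownian_from B p T \<omega>)" for \<omega>
  have T0: "0 \<le> T" using T by simp
  have D: "rectangle a b = {z. 0 < fst z \<and> fst z < a \<and> 0 < snd z \<and> snd z < b}" by (auto simp: rectangle_def)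
  have op: "open (rectangle a b)" unfolding D by (intro open_Collect_conj open_Collect_less continuous_intros)
  have S_ev: "S \<in> events" unfolding S_def using op T0 by (rule survives_events)
  have \<beta>: "0 < \<beta>" "0 < \<beta>'" using ab by (simp_all add: \<beta>_def \<beta>'_def)
  obtain r N where r: "\<And>k. 0 \<le> r k" "\<And>k. r k < 1" "r \<longlonglongrightarrow> 1" and N: "\<And>k. 5 \<le> N k"
    and bound: "\<And>k \<theta>. \<bar>sine_sum (\<lambda>n. r k ^ n) (N k) \<theta>\<bar> \<le> 5"
    and lim: "\<And>\<theta>. 0 < \<theta> \<Longrightarrow> \<theta> < pi \<Longrightarrow> (\<lambda>k. sine_sum (\<lambda>n. r k ^ n) (N k) \<theta>) \<longlonglongrightarrow> 1"
    using bounded_sine_approximation by blast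
  let ?g = "\<lambda>k \<omega>. indicator S \<omega> * (sine_sum (\<lambda>n. r k ^ n) (N k) (X \<omega>) * sine_sum (\<lambda>n. r k ^ n) (N k) (Y \<omega>))"
  \<comment> \<open>The same sums with each harmonic damped by the heat flow up to time
    \<open>T\<close>.\<close>
  let ?G = "\<lambda>\<beta> \<theta> k. sine_sum (\<lambda>n. r k ^ n * exp (- (\<beta> * real n ^ 2 * T))) (N k) \<theta>"
  note mode = rectangle_mode[OF ab p T0, folded S_def X_def Y_def \<beta>_def \<beta>'_def \<theta>_def \<theta>'_def]
  have expand: "?g k \<omega> = (\<Sum>m<N k. \<Sum>n<N k. (odd_coeff m * r k ^ m * (odd_coeff n * r k ^ n)) *
      (indicator S \<omega> * (sin (real m * X \<omega>) * sin (real n * Y \<omega>))))" for k \<omega>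
    unfolding sine_sum_def sum_product by (simp add: sum_distrib_left mult_ac)
  have int: "integrable M (?g k)" for k
    unfolding expand by (intro Bochner_Integration.integrable_sum integrable_mult_right mode)
  have Eg: "expectation (?g k) = ?G \<beta> \<theta> k * ?G \<beta>' \<theta>' k" for k
  proof -
    have "expectation (?g k) = (\<Sum>m<N k. \<Sum>n<N k. (odd_coeff m * r k ^ m * (odd_coeff n * r k ^ n)) *
      expectation (\<lambda>\<omega>. indicator S \<omega> * (sin (real m * X \<omega>) * sin (real n * Y \<omega>))))"
      unfolding expand by (subst Bochner_Integration.integral_sum Bochner_Integration.integral_mult_right_zero;
        (intro Bochner_Integration.integrable_sum integrable_mult_right mode(1) refl)?)+
    also have "\<dots> = ?G \<beta> \<theta> k * ?G \<beta>' \<theta>' k"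
      unfolding mode(2) sine_sum_def sum_product by (simp add: mult_ac)
    finally show ?thesis .
  qed
  have "(\<lambda>k. expectation (?g k)) \<longlonglongrightarrow> expectation (indicat_real S)"
  proof (rule integral_dominated_convergence)
    show "?g k \<in> borel_measurable M" for k using int by (rule borel_measurable_integrable)
    show "integrable M (\<lambda>\<omega>. 5 * 5 :: real)" by simp
    show "indicat_real S \<in> borel_measurable M" using S_ev by simp
    show "AE \<omega> in M. norm (?g k \<omega>) \<le> 5 * 5" for k
    proof (intro AE_I2)
      fix \<omega>
      have "\<bar>sine_sum (\<lambda>n. r k ^ n) (N k) (X \<omega>)\<bar> * \<bar>sine_sum (\<lambda>n. r k ^ n) (N k) (Y \<omega>)\<bar> \<le> 5 * 5"
        by (intro mult_mono bound) auto
      then show "norm (?g k \<omega>) \<le> 5 * 5" by (simp add: abs_mult indicator_def)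
    qed
    show "AE \<omega> in M. (\<lambda>k. ?g k \<omega>) \<longlonglongrightarrow> indicat_real S \<omega>"
    proof (intro AE_I2)
      fix \<omega>
      show "(\<lambda>k. ?g k \<omega>) \<longlonglongrightarrow> indicat_real S \<omega>"
      proof (cases "\<omega> \<in> S")
        case True
        then have "brownian_from B p T \<omega> \<in> rectangle a b" using T0 by (simp add: S_def survives_def)
        then have "0 < X \<omega>" "X \<omega> < pi" "0 < Y \<omega>" "Y \<omega> < pi"
          using ab by (auto simp: D X_def Y_def field_simps)
        then have "(\<lambda>k. ?g k \<omega>) \<longlonglongrightarrow> indicator S \<omega> * (1 * 1)" by (intro tendsto_intros lim)
        then show ?thesis by simp
      qed simp
    qed
  qed
  then have conv: "(\<lambda>k. ?G \<beta> \<theta> k * ?G \<beta>' \<theta>' k) \<longlonglongrightarrow> prob S" unfolding Eg using S_ev by simp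
  let ?L = "\<lambda>\<beta> \<theta> k. 4 / pi * r k * exp (- \<beta> * T) * sin \<theta> + 4 / (3 * pi) * r k ^ 3 * exp (- (9 * \<beta>) * T) * sin (3 * \<theta>)"
  have L: "?L \<beta> \<theta> \<longlonglongrightarrow> sine_lead \<beta> \<theta> T" for \<beta> \<theta>
  proof -
    have "?L \<beta> \<theta> \<longlonglongrightarrow> 4 / pi * 1 * exp (- \<beta> * T) * sin \<theta> + 4 / (3 * pi) * 1 ^ 3 * exp (- (9 * \<beta>) * T) * sin (3 * \<theta>)"
      by (intro tendsto_intros r)
    then show ?thesis by (simp add: sine_lead_def)
  qed
  let ?\<epsilon> = "\<lambda>\<beta>. tail_const \<beta> * exp (- (25 * \<beta>) * T)"
  have close: "\<bar>?G \<beta> \<theta> k - ?L \<beta> \<theta> k\<bar> \<le> ?\<epsilon> \<beta>" if "0 < \<beta>" for \<beta> \<theta> k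
    using sine_sum_tail[OF that T r(1,2) N] by (simp add: tail_const_def)
  have "\<bar>?G \<beta> \<theta> k * ?G \<beta>' \<theta>' k - ?L \<beta> \<theta> k * ?L \<beta>' \<theta>' k\<bar>
      \<le> \<bar>?L \<beta> \<theta> k\<bar> * ?\<epsilon> \<beta>' + ?\<epsilon> \<beta> * \<bar>?L \<beta>' \<theta>' k\<bar> + ?\<epsilon> \<beta> * ?\<epsilon> \<beta>'" for k
    by (rule abs_mult_diff_mult_le[OF close[OF \<beta>(1)] close[OF \<beta>(2)]])
  note le = this
  have "\<bar>prob S - sine_lead \<beta> \<theta> T * sine_lead \<beta>' \<theta>' T\<bar>
      \<le> \<bar>sine_lead \<beta> \<theta> T\<bar> * ?\<epsilon> \<beta>' + ?\<epsilon> \<beta> * \<bar>sine_lead \<beta>' \<theta>' T\<bar> + ?\<epsilon> \<beta> * ?\<epsilon> \<beta>'"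
  proof (rule tendsto_le[OF trivial_limit_sequentially])
    show "(\<lambda>k. \<bar>?G \<beta> \<theta> k * ?G \<beta>' \<theta>' k - ?L \<beta> \<theta> k * ?L \<beta>' \<theta>' k\<bar>) \<longlonglongrightarrow> \<bar>prob S - sine_lead \<beta> \<theta> T * sine_lead \<beta>' \<theta>' T\<bar>"
      by (intro tendsto_rabs tendsto_diff conv tendsto_mult L)
    show "(\<lambda>k. \<bar>?L \<beta> \<theta> k\<bar> * ?\<epsilon> \<beta>' + ?\<epsilon> \<beta> * \<bar>?L \<beta>' \<theta>' k\<bar> + ?\<epsilon> \<beta> * ?\<epsilon> \<beta>') \<longlonglongrightarrow>
        \<bar>sine_lead \<beta> \<theta> T\<bar> * ?\<epsilon> \<beta>' + ?\<epsilon> \<beta> * \<bar>sine_lead \<beta>' \<theta>' T\<bar> + ?\<epsilon> \<beta> * ?\<epsilon> \<beta>'"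
      by (intro tendsto_add tendsto_mult tendsto_rabs L tendsto_const)
  qed (use le in simp)
  then show ?thesis by (simp only: S_def)
qed

theorem rectangle_determined:
  assumes ab: "0 < a" "0 < b" "a \<noteq> b" and p: "p \<in> rectangle a b" and q: "q \<in> rectangle a b"
    and eq: "\<forall>k\<ge>1. exit_moment M B (rectangle a b) k p = exit_moment M B (rectangle a b) k q"
  shows "\<exists>g. symmetry_of (rectangle a b) g \<and> q = g p"
proof -
  let ?D = "rectangle a b"
  let ?\<beta> = "(pi / a)^2" and ?\<beta>' = "(pi / b)^2"
  let ?\<theta> = "\<lambda>z :: real \<times> real. pi / a * fst z" and ?\<theta>' = "\<lambda>z :: real \<times> real. pi / b * snd z"
  let ?P = "\<lambda>z t. prob (survives ?D z t)"
  have D: "?D = {z. 0 < fst z \<and> fst z < a \<and> 0 < snd z \<and> snd z < b}" by (auto simp: rectangle_def)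
  have op: "open ?D" unfolding D by (intro open_Collect_conj open_Collect_less continuous_intros)
  have \<beta>: "0 < ?\<beta>" "0 < ?\<beta>'" using ab by simp_all
  have P1: "\<bar>?P z t\<bar> \<le> 1" for z t by simp
  have asym1: "\<exists>C. \<forall>t\<ge>0. \<bar>?P z t - 16 / pi^2 * (sin (?\<theta> z) * sin (?\<theta>' z)) * exp (- (?\<beta> + ?\<beta>') * t)
      - 16 / (3 * pi^2) * (sin (3 * ?\<theta> z) * sin (?\<theta>' z)) * exp (- (9 * ?\<beta> + ?\<beta>') * t)\<bar>
      \<le> C * exp (- min (?\<beta> + 9 * ?\<beta>') (25 * ?\<beta> + ?\<beta>') * t)" if "z \<in> ?D" for z
    using rectangle_survival_asymptotics[OF ab(1,2) that] by (intro product_asymptotics \<beta> P1)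
  \<comment> \<open>The axes exchanged: \<open>sines_determined\<close> wants the smaller rate, that
    is the longer side, first.\<close>
  have asym2: "\<exists>C. \<forall>t\<ge>0. \<bar>?P z t - 16 / pi^2 * (sin (?\<theta>' z) * sin (?\<theta> z)) * exp (- (?\<beta>' + ?\<beta>) * t)
      - 16 / (3 * pi^2) * (sin (3 * ?\<theta>' z) * sin (?\<theta> z)) * exp (- (9 * ?\<beta>' + ?\<beta>) * t)\<bar>
      \<le> C * exp (- min (?\<beta>' + 9 * ?\<beta>) (25 * ?\<beta>' + ?\<beta>) * t)" if "z \<in> ?D" for z
  proof (intro product_asymptotics \<beta> P1)
    fix t :: real assume "1 \<le> t"
    from rectangle_survival_asymptotics[OF ab(1,2) that this]
    show "\<bar>?P z t - sine_lead ?\<beta>' (?\<theta>' z) t * sine_lead ?\<beta> (?\<theta> z) t\<bar> \<le>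
      \<bar>sine_lead ?\<beta>' (?\<theta>' z) t\<bar> * (tail_const ?\<beta> * exp (- (25 * ?\<beta>) * t))
      + tail_const ?\<beta>' * exp (- (25 * ?\<beta>') * t) * \<bar>sine_lead ?\<beta> (?\<theta> z) t\<bar>
      + tail_const ?\<beta>' * exp (- (25 * ?\<beta>') * t) * (tail_const ?\<beta> * exp (- (25 * ?\<beta>) * t))"
      by (simp only: mult_ac add_ac)
  qed
  \<comment> \<open>Integrability is all that is at stake, so a rate below all those occurring
    suffices.\<close>
  have decay: "\<exists>C. \<forall>t\<ge>0. ?P z t \<le> C * exp (- (?\<beta> / 2) * t)" if z: "z \<in> ?D" for z
  proof -
    let ?\<nu> = "min (?\<beta> + 9 * ?\<beta>') (25 * ?\<beta> + ?\<beta>')"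
    obtain C where C: "\<And>t. 0 \<le> t \<Longrightarrow> \<bar>?P z t - 16 / pi^2 * (sin (?\<theta> z) * sin (?\<theta>' z)) * exp (- (?\<beta> + ?\<beta>') * t)
      - 16 / (3 * pi^2) * (sin (3 * ?\<theta> z) * sin (?\<theta>' z)) * exp (- (9 * ?\<beta> + ?\<beta>') * t)\<bar> \<le> C * exp (- ?\<nu> * t)"
      using asym1[OF z] by blast
    define A where "A = \<bar>16 / pi^2 * (sin (?\<theta> z) * sin (?\<theta>' z))\<bar>"
    define E where "E = \<bar>16 / (3 * pi^2) * (sin (3 * ?\<theta> z) * sin (?\<theta>' z))\<bar>"
    have "?P z t \<le> (A + E + \<bar>C\<bar>) * exp (- (?\<beta> / 2) * t)" if t: "0 \<le> t" for t
    proof -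
      have le: "x * exp (- l * t) \<le> \<bar>x\<bar> * exp (- (?\<beta> / 2) * t)" if "?\<beta> / 2 \<le> l" for x l
      proof -
        have "exp (- l * t) \<le> exp (- (?\<beta> / 2) * t)" using mult_right_mono[OF that t] by simp
        then show ?thesis by (intro mult_mono) auto
      qed
      have "16 / pi^2 * (sin (?\<theta> z) * sin (?\<theta>' z)) * exp (- (?\<beta> + ?\<beta>') * t) \<le> A * exp (- (?\<beta> / 2) * t)"
        unfolding A_def using \<beta> by (intro le) linarith
      moreover have "16 / (3 * pi^2) * (sin (3 * ?\<theta> z) * sin (?\<theta>' z)) * exp (- (9 * ?\<beta> + ?\<beta>') * t) \<le> E * exp (- (?\<beta> / 2) * t)"
        unfolding E_def using \<beta> by (intro le) linarith
      moreover have "C * exp (- ?\<nu> * t) \<le> \<bar>C\<bar> * exp (- (?\<beta> / 2) * t)"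
        using \<beta> by (intro le) linarith
      ultimately show ?thesis using C[OF t] unfolding distrib_right by linarith
    qed
    then show ?thesis by blast
  qed
  obtain C1 where C1: "\<And>t. 0 \<le> t \<Longrightarrow> ?P p t \<le> C1 * exp (- (?\<beta> / 2) * t)" using decay[OF p] by blast
  obtain C2 where C2: "\<And>t. 0 \<le> t \<Longrightarrow> ?P q t \<le> C2 * exp (- (?\<beta> / 2) * t)" using decay[OF q] by blast
  have zero: "integral\<^sup>L lborel (\<lambda>t. indicator {0..} t * t ^ k * (?P p t - ?P q t)) = 0" for k
  proof (rule equal_moments_imp_tail_moments[OF op, where \<mu> = "?\<beta> / 2" and C = "max C1 C2"])
    show "0 < ?\<beta> / 2" using \<beta> by simp
    show "exit_moment M B ?D (Suc k) p = exit_moment M B ?D (Suc k) q" using eq by simp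
    fix t :: real assume "0 \<le> t"
    show "?P p t \<le> max C1 C2 * exp (- (?\<beta> / 2) * t)"
      by (rule order.trans[OF C1[OF \<open>0 \<le> t\<close>]]) (intro mult_right_mono, auto)
    show "?P q t \<le> max C1 C2 * exp (- (?\<beta> / 2) * t)"
      by (rule order.trans[OF C2[OF \<open>0 \<le> t\<close>]]) (intro mult_right_mono, auto)
  qed
  have range: "0 < ?\<theta> z" "?\<theta> z < pi" "0 < ?\<theta>' z" "?\<theta>' z < pi" if "z \<in> ?D" for z
    using that ab by (auto simp: D field_simps)
  note meas = prob_survives_measurable[OF op]
  have "sin (?\<theta> p) = sin (?\<theta> q) \<and> sin (?\<theta>' p) = sin (?\<theta>' q)"
  proof (cases "a > b")
    case True
    then have "?\<beta> < ?\<beta>'" using ab by (intro power_strict_mono divide_strict_left_mono) auto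
    then show ?thesis
      using sines_determined[OF \<beta>(1) _ meas meas asym1[OF p] asym1[OF q] zero range[OF p] range[OF q]] by blast
  next
    case False
    then have "?\<beta>' < ?\<beta>" using ab by (intro power_strict_mono divide_strict_left_mono) auto
    then show ?thesis
      using sines_determined[OF \<beta>(2) _ meas meas asym2[OF p] asym2[OF q] zero range(3,4)[OF p] range(1,2)[OF p]
        range(3,4)[OF q] range(1,2)[OF q]] by blast
  qed
  then have sines: "sin (?\<theta> p) = sin (?\<theta> q)" "sin (?\<theta>' p) = sin (?\<theta>' q)" by blast+
  have "?\<theta> q = ?\<theta> p \<or> ?\<theta> q = pi - ?\<theta> p" "?\<theta>' q = ?\<theta>' p \<or> ?\<theta>' q = pi - ?\<theta>' p"
    by (rule sin_eq_imp_reflect[OF range(1,2)[OF p] range(1,2)[OF q] sines(1)]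
      sin_eq_imp_reflect[OF range(3,4)[OF p] range(3,4)[OF q] sines(2)])+
  have "fst q = fst p \<or> fst q = a - fst p" "snd q = snd p \<or> snd q = b - snd p"
  proof -
    have cancel: "u = v \<or> u = c - v" if "pi / c * u = pi / c * v \<or> pi / c * u = pi - pi / c * v" "0 < c" for c u v :: real
    proof -
      have "pi - pi / c * v = pi / c * (c - v)" using that(2) by (simp add: right_diff_distrib)
      then show ?thesis using that by auto
    qed
    then show "fst q = fst p \<or> fst q = a - fst p" "snd q = snd p \<or> snd q = b - snd p"
      using ab \<open>?\<theta> q = ?\<theta> p \<or> ?\<theta> q = pi - ?\<theta> p\<close> \<open>?\<theta>' q = ?\<theta>' p \<or> ?\<theta>' q = pi - ?\<theta>' p\<close>
      by blast+
  qed
  \<comment> \<open>\<open>s\<close> and \<open>r\<close> are the signs, \<open>c\<close> and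
    \<open>d\<close> the offsets of the reflections in the midlines.\<close>
  then obtain c s d r where g: "fst q = c + s * fst p" "c = 0 \<and> s = 1 \<or> c = a \<and> s = -1"
    "snd q = d + r * snd p" "d = 0 \<and> r = 1 \<or> d = b \<and> r = -1"
    by (metis add_0 diff_conv_add_uminus mult_1 mult_minus1)
  have "symmetry_of ?D (\<lambda>z. (c + s * fst z, d + r * snd z))"
    using g(2,4) by (intro symmetry_of_axis_maps) (auto simp: D)
  moreover have "q = (c + s * fst p, d + r * snd p)" using g by (simp add: prod_eq_iff)
  ultimately show ?thesis by blast
qed

end

theorem corollary1:
  fixes M :: "'w measure" and B :: "real \<Rightarrow> 'w \<Rightarrow> real \<times> real"
  assumes "standard_planar_brownian_motion M B"
  shows "(\<forall>D.
      (\<exists>a b. 0 < a \<and> 0 < b \<and> a \<noteq> b \<and> D = elliptic_domain a b) \<or>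
      (\<exists>c. 0 < c \<and> D = parabolic_domain c) \<or>
      (\<exists>a b. 0 < a \<and> 0 < b \<and> a > (1 + sqrt 2) * b \<and> D = hyperbolic_domain a b) \<or>
      (\<exists>\<alpha>. 0 < \<alpha> \<and> \<alpha> < pi / 4 \<and> D = wedge_domain \<alpha>) \<or>
      (\<exists>b. 0 < b \<and> D = equilateral_triangle b) \<longrightarrow>
      (\<forall>p\<in>D. \<forall>q\<in>D.
        exit_moment M B D 1 p = exit_moment M B D 1 q \<and>
        exit_moment M B D 2 p = exit_moment M B D 2 q \<longrightarrow>
        (\<exists>g. symmetry_of D g \<and> q = g p)) \<and>
      (\<forall>p\<in>D. \<forall>q\<in>D.
        exit_moment M B D 1 p = exit_moment M B D 1 q \<and>
        exit_variance M B D p = exit_variance M B D q \<longrightarrow>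
        (\<exists>g. symmetry_of D g \<and> q = g p))) \<and>
    (\<forall>a b. 0 < a \<and> 0 < b \<and> a \<noteq> b \<longrightarrow>
      (\<forall>p\<in>rectangle a b. \<forall>q\<in>rectangle a b.
        (\<forall>k\<ge>1. exit_moment M B (rectangle a b) k p = exit_moment M B (rectangle a b) k q) \<longrightarrow>
        (\<exists>g. symmetry_of (rectangle a b) g \<and> q = g p)))"
proof -
  interpret standard_planar_brownian_motion M B by (rule assms)
  have det: "determined_by_two_moments M B D"
    if "(\<exists>a b. 0 < a \<and> 0 < b \<and> a \<noteq> b \<and> D = elliptic_domain a b) \<or>
      (\<exists>c. 0 < c \<and> D = parabolic_domain c) \<or>
      (\<exists>a b. 0 < a \<and> 0 < b \<and> a > (1 + sqrt 2) * b \<and> D = hyperbolic_domain a b) \<or>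
      (\<exists>\<alpha>. 0 < \<alpha> \<and> \<alpha> < pi / 4 \<and> D = wedge_domain \<alpha>) \<or>
      (\<exists>b. 0 < b \<and> D = equilateral_triangle b)" for D
    using that elliptic_determined parabolic_determined hyperbolic_determined wedge_determined
      triangle_determined by blast
  show ?thesis
    by (rule conjI, intro allI impI, erule det[unfolded determined_by_two_moments_def],
        intro allI impI ballI, elim conjE, rule rectangle_determined; assumption)
qed

end
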